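(* Let $\Sigma$ be a smooth real 2-dimensional manifold (possibly nonorientable or noncompact), and let $U=S^1\times[-1,1]\subset\Sigma$ be an embedded cylinder with coordinates $(\theta,s)$ and orientation $d\theta\wedge ds$ (the embedding being orientation preserving if $\Sigma$ is oriented), with central curve $\gamma=S^1\times\{0\}$ oriented by $d\theta$ and based at $p=(0,0)$. Let $\mathcal{S}_\gamma$ be the set of flat $SU(2)$-connections $A$ on $\Sigma$ with $\mathrm{Hol}_\gamma A\neq\pm1$, let $\mathcal{M}_\gamma=\mathcal{S}_\gamma/\mathcal{G}(\Sigma)$, and let $f_\gamma:\mathcal{S}_\gamma\to\mathbb{R}$, $f_\gamma(A)=\mathrm{Arccos}\left(\tfrac12\mathrm{tr}(\mathrm{Hol}_\gamma A)\right)$. There are $\mathbb{R}$-actions $\{\Xi_t^+\}_{t\in\mathbb{R}}$ and $\{\Xi_t^-\}_{t\in\mathbb{R}}$ on $\mathcal{S}_\gamma$ satisfying the following conditions: (i) The $\mathbb{R}$-actions $\Xi_t^\pm$ have "support" in $U$ in the following sense: $\Xi_t^-(A)=A$ outside of some compact subset of $S^1\times(-1,0)\subset U$, and $\Xi_t^+(A)=A$ outside of some compact subset of $S^1\times(0,1)\subset U$. (ii) If $d(f_\gamma)_A$ is the tangent map of $f_\gamma$ at $A$ then $$d(f_\gamma)_A(B)=\int_U\left\langle\left(\left.\tfrac{d}{dt}\right|_{t=0}\Xi_t^\pm A\right)\wedge B\right\rangle$$ for $B\in T_A\mathcal{S}_\gamma=T_A\mathcal{A}_{\mathrm{flat}}(\Sigma)$.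 (iii) $\Xi_t^\pm$ are $\mathcal{G}(\Sigma)$-equivariant: if $A\in\mathcal{S}_\gamma$ and $\psi\in\mathcal{G}(\Sigma)$ then $\Xi_t^\pm(\psi.A)=\psi.(\Xi_t^\pm(A))$. (iv) If $A\in\mathcal{S}_\gamma$ and $t\in\mathbb{R}$ then there exists $\psi\in\mathcal{G}(\Sigma)$ such that $\psi.\Xi_t^-(A)=\Xi_t^+(A)$. The $\mathbb{R}$-actions $\Xi_t^+$ and $\Xi_t^-$ on $\mathcal{S}_\gamma$ thus define a common $\mathbb{R}$-action $\{\Xi_t\}_{t\in\mathbb{R}}$ on $\mathcal{M}_\gamma$. The action $\Xi_t$ is periodic, with period $\pi$ if $\Sigma\smallsetminus\gamma$ is disconnected and period $2\pi$ if $\Sigma\smallsetminus\gamma$ is connected. (The $S^1$-action on $\mathcal{M}_\gamma$ defined by $\Xi_t$ is called the Goldman flow associated to the cylinder $U$.)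
   Context: $G=SU(2)$, $\mathfrak g=\mathfrak{su}(2)$, with inner product $\langle\zeta,\eta\rangle=-\frac12\mathrm{tr}(\zeta\eta)$; for $\mathfrak g$-valued 1-forms, $\langle B\wedge C\rangle$ is the real 2-form obtained by combining the wedge product with $\langle\cdot,\cdot\rangle$. $S^1=\mathbb{R}/2\pi\mathbb{Z}$. Integrals over $U$ use the orientation $d\theta\wedge ds$. Conventions (left principal bundles): a connection on the trivial $SU(2)$-bundle is $A\in\Omega^1(\Sigma)\otimes\mathfrak g$, with curvature $dA-\frac12[A\wedge A]$; $\mathcal{A}_{\mathrm{flat}}(\Sigma)$ is the set of flat connections. The gauge group $\mathcal{G}(\Sigma)=C^\infty(\Sigma,SU(2))$ acts by $\psi.A=\psi A\psi^{-1}+(d\psi)\psi^{-1}$. For a curve $\sigma:[0,1]\to\Sigma$, $\mathrm{Hol}_\sigma(A)=h(1)^{-1}$ where $h'(r)=A(\sigma'(r))h(r)$, $h(0)=1$; thus $\mathrm{Hol}_\sigma(A)=\exp(-\int_0^1\sigma^*A)$ when $A$ takes values in an abelian subalgebra along $\sigma$, and $\mathrm{Hol}_\sigma(\psi.A)=\psi(\sigma(0))\,\mathrm{Hol}_\sigma(A)\,\psi(\sigma(1))^{-1}$. The tangent space is $T_A\mathcal{A}_{\mathrm{flat}}(\Sigma)=\{B\in\Omega^1(\Sigma)\otimes\mathfrak g: dB-[A\wedge B]=0\}$, and $d(f_\gamma)_A(B)=\left.\frac{d}{d\varepsilon}\right|_{\varepsilon=0}\mathrm{Arccos}\left(\frac12\mathrm{tr}\,\mathrm{Hol}_\gamma(A+\varepsilon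 B)\right)$. "Periodic with period $T$" means $\Xi_{t+T}=\Xi_t$ for all $t$.
   Formalization: The period-π claim is stated for connected Σ: if Σ is, e.g., a torus plus a disjoint sphere with γ nonseparating in the torus, then Σ∖γ is disconnected but the flow does not have period π. For disconnected Σ no period is stated. *)

theory Defs
  imports "HOL-Analysis.Analysis"
begin

section \<open>Smooth maps between Euclidean spaces\<close>

primrec Ck_on :: "nat \<Rightarrow> 'a::euclidean_space set \<Rightarrow> ('a \<Rightarrow> 'b::real_normed_vector) \<Rightarrow> bool" where
  "Ck_on 0 = (\<lambda>W f. continuous_on W f)"
| "Ck_on (Suc k) = (\<lambda>W f. (\<forall>x\<in>W. f differentiable (at x)) \<and>
      (\<forall>v. Ck_on k W (\<lambda>x. frechet_derivative f (at x) v)))"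

text \<open>On a set that need not be open (such as a closed strip), smooth means locally extendable to
  a smooth map on an open set.\<close>

definition smooth_on :: "'a::euclidean_space set \<Rightarrow> ('a \<Rightarrow> 'b::real_normed_vector) \<Rightarrow> bool" where
  "smooth_on S f \<longleftrightarrow>
     (\<forall>x\<in>S. \<exists>W g. open W \<and> x \<in> W \<and> (\<forall>k. Ck_on k W g) \<and> (\<forall>y\<in>S \<inter> W. g y = f y))"


section \<open>Smooth surfaces\<close>

text \<open>The surface is the whole type \<open>'a\<close>, with topology from the type classes; a chart is a pair of its
  domain and its coordinate map. The atlas is not required to be maximal.\<close>

type_synonym 'a chart = "'a set \<times> ('a \<Rightarrow> real \<times> real)"

abbreviation cdom :: "'a chart \<Rightarrow> 'a set" where "cdom \<equiv> fst"
abbreviation cmap :: "'a chart \<Rightarrow> 'a \<Rightarrow> real \<times> real" where "cmap \<equiv> snd"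

definition cinv :: "'a chart \<Rightarrow> real \<times> real \<Rightarrow> 'a" where
  "cinv c = inv_into (cdom c) (cmap c)"

definition smooth_surface :: "'a::{t2_space,second_countable_topology} chart set \<Rightarrow> bool" where
  "smooth_surface atl \<longleftrightarrow>
     (\<Union>c\<in>atl. cdom c) = UNIV \<and>
     (\<forall>c\<in>atl. open (cdom c) \<and> open (cmap c ` cdom c) \<and>
        homeomorphism (cdom c) (cmap c ` cdom c) (cmap c) (cinv c)) \<and>
     (\<forall>c\<in>atl. \<forall>d\<in>atl. smooth_on (cmap c ` (cdom c \<inter> cdom d)) (cmap d \<circ> cinv c))"

text \<open>Used only for expressions whose value does not depend on the chart chosen around \<open>p\<close>.\<close>

definition chart_at :: "'a chart set \<Rightarrow> 'a \<Rightarrow> 'a chart" where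
  "chart_at atl p = (SOME c. c \<in> atl \<and> p \<in> cdom c)"


section \<open>The group \<open>SU(2)\<close> and its Lie algebra\<close>

type_synonym mat2 = "complex^2^2"

definition conj_transpose :: "mat2 \<Rightarrow> mat2" where
  "conj_transpose X = (\<chi> i j. cnj (X $ j $ i))"

definition SU2 :: "mat2 set" where
  "SU2 = {X. X ** conj_transpose X = mat 1 \<and> det X = 1}"

definition su2 :: "mat2 set" where
  "su2 = {X. conj_transpose X = - X \<and> trace X = 0}"

definition bracket :: "mat2 \<Rightarrow> mat2 \<Rightarrow> mat2" where
  "bracket X Y = X ** Y - Y ** X"

text \<open>The trace is real for arguments in \<open>su2\<close>.\<close>

definition su2_inner :: "mat2 \<Rightarrow> mat2 \<Rightarrow> real" where
  "su2_inner X Y = - (1/2) * Re (trace (X ** Y))"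


section \<open>Differential forms with values in \<open>su2\<close>\<close>

text \<open>A form is given by its local expressions: \<open>\<omega> c p v\<close> is the value at \<open>p\<close> on the tangent vector
  that has coordinates \<open>v\<close> in the chart \<open>c\<close>; similarly \<open>\<omega> c p v w\<close> for 2-forms. To make equality of
  forms be equality of functions, local expressions of 1-forms vanish where they are meaningless.\<close>

type_synonym ('a, 'b) form1 = "'a chart \<Rightarrow> 'a \<Rightarrow> real \<times> real \<Rightarrow> 'b"
type_synonym ('a, 'b) form2 = "'a chart \<Rightarrow> 'a \<Rightarrow> real \<times> real \<Rightarrow> real \<times> real \<Rightarrow> 'b"

definition Omega1 :: "'a chart set \<Rightarrow> ('a, mat2) form1 set" where
  "Omega1 atl = {\<omega>.
     (\<forall>c p v. c \<notin> atl \<or> p \<notin> cdom c \<longrightarrow> \<omega> c p v = 0) \<and>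
     (\<forall>c\<in>atl. \<forall>p\<in>cdom c. linear (\<omega> c p) \<and> range (\<omega> c p) \<subseteq> su2) \<and>
     (\<forall>c\<in>atl. \<forall>d\<in>atl. \<forall>p\<in>cdom c \<inter> cdom d. \<forall>v.
        \<omega> c p v = \<omega> d p (frechet_derivative (cmap d \<circ> cinv c) (at (cmap c p)) v)) \<and>
     (\<forall>c\<in>atl. \<forall>v. smooth_on (cmap c ` cdom c) (\<lambda>x. \<omega> c (cinv c x) v))}"

definition ext_deriv :: "('a, mat2) form1 \<Rightarrow> ('a, mat2) form2" where
  "ext_deriv \<omega> c p v w =
     frechet_derivative (\<lambda>x. \<omega> c (cinv c x) w) (at (cmap c p)) v
   - frechet_derivative (\<lambda>x. \<omega> c (cinv c x) v) (at (cmap c p)) w"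

definition wedge_bracket ::
    "('a, mat2) form1 \<Rightarrow> ('a, mat2) form1 \<Rightarrow> ('a, mat2) form2" where
  "wedge_bracket A B c p v w = bracket (A c p v) (B c p w) - bracket (A c p w) (B c p v)"

definition wedge_inner ::
    "('a, mat2) form1 \<Rightarrow> ('a, mat2) form1 \<Rightarrow> ('a, real) form2" where
  "wedge_inner A B c p v w = su2_inner (A c p v) (B c p w) - su2_inner (A c p w) (B c p v)"

definition curvature :: "('a, mat2) form1 \<Rightarrow> ('a, mat2) form2" where
  "curvature A c p v w = ext_deriv A c p v w - (1/2) *\<^sub>R wedge_bracket A A c p v w"

definition A_flat :: "'a chart set \<Rightarrow> ('a, mat2) form1 set" where
  "A_flat atl = {A \<in> Omega1 atl. \<forall>c\<in>atl. \<forall>p\<in>cdom c. \<forall>v w. curvature A c p v w = 0}"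

definition T_flat :: "'a chart set \<Rightarrow> ('a, mat2) form1 \<Rightarrow> ('a, mat2) form1 set" where
  "T_flat atl A = {B \<in> Omega1 atl. \<forall>c\<in>atl. \<forall>p\<in>cdom c. \<forall>v w.
     ext_deriv B c p v w - wedge_bracket A B c p v w = 0}"

text \<open>Pull-backs along a map \<open>f\<close> defined on a subset \<open>S\<close> (an interval or a closed strip) of a
  Euclidean space; the value at \<open>x\<close> is a form on that Euclidean space.\<close>

definition coord_deriv ::
    "'a chart set \<Rightarrow> ('e::euclidean_space \<Rightarrow> 'a) \<Rightarrow> 'e set \<Rightarrow> 'e \<Rightarrow> 'e \<Rightarrow> real \<times> real" where
  "coord_deriv atl f S x = frechet_derivative (cmap (chart_at atl (f x)) \<circ> f) (at x within S)"

definition pullback1 ::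
    "'a chart set \<Rightarrow> ('e::euclidean_space \<Rightarrow> 'a) \<Rightarrow> 'e set \<Rightarrow> ('a, 'b) form1 \<Rightarrow> 'e \<Rightarrow> 'e \<Rightarrow> 'b" where
  "pullback1 atl f S \<omega> x v = \<omega> (chart_at atl (f x)) (f x) (coord_deriv atl f S x v)"

definition pullback2 ::
    "'a chart set \<Rightarrow> ('e::euclidean_space \<Rightarrow> 'a) \<Rightarrow> 'e set \<Rightarrow> ('a, 'b) form2 \<Rightarrow> 'e \<Rightarrow> 'e \<Rightarrow> 'e \<Rightarrow> 'b" where
  "pullback2 atl f S \<omega> x v w =
     \<omega> (chart_at atl (f x)) (f x) (coord_deriv atl f S x v) (coord_deriv atl f S x w)"


section \<open>Gauge transformations and holonomy\<close>

definition gauge_group :: "'a chart set \<Rightarrow> ('a \<Rightarrow> mat2) set" where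
  "gauge_group atl =
     {\<psi>. range \<psi> \<subseteq> SU2 \<and> (\<forall>c\<in>atl. smooth_on (cmap c ` cdom c) (\<psi> \<circ> cinv c))}"

definition gauge_act ::
    "'a chart set \<Rightarrow> ('a \<Rightarrow> mat2) \<Rightarrow> ('a, mat2) form1 \<Rightarrow> ('a, mat2) form1" where
  "gauge_act atl \<psi> A c p v =
     (if c \<in> atl \<and> p \<in> cdom c
      then \<psi> p ** A c p v ** matrix_inv (\<psi> p)
         + frechet_derivative (\<psi> \<circ> cinv c) (at (cmap c p)) v ** matrix_inv (\<psi> p)
      else 0)"

definition hol :: "'a chart set \<Rightarrow> (real \<Rightarrow> 'a) \<Rightarrow> ('a, mat2) form1 \<Rightarrow> mat2" where
  "hol atl \<sigma> A = (THE g. \<exists>h :: real \<Rightarrow> mat2. h 0 = mat 1 \<and>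
     (\<forall>r\<in>{0..1}. (h has_vector_derivative (pullback1 atl \<sigma> {0..1} A r 1 ** h r))
                   (at r within {0..1})) \<and>
     g = matrix_inv (h 1))"


section \<open>The cylinder\<close>

text \<open>Functions on \<open>S\<^sup>1 \<times> [-1,1]\<close>, \<open>S\<^sup>1\<close> being the reals modulo \<open>2\<pi>\<close>, are functions of
  \<open>(\<theta>, s)\<close> in the strip that are periodic in \<open>\<theta>\<close>. As the cylinder is compact, an injective
  immersion is an embedding.\<close>

definition strip :: "(real \<times> real) set" where
  "strip = UNIV \<times> {-1..1}"

definition embedded_cylinder ::
    "'a::{t2_space,second_countable_topology} chart set \<Rightarrow> (real \<times> real \<Rightarrow> 'a) \<Rightarrow> bool" where
  "embedded_cylinder atl u \<longleftrightarrow>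
     (\<forall>\<theta> \<theta>'. \<forall>s\<in>{-1..1}. \<forall>s'\<in>{-1..1}.
        u (\<theta>, s) = u (\<theta>', s') \<longleftrightarrow> s = s' \<and> (\<exists>k::int. \<theta>' = \<theta> + 2 * pi * of_int k)) \<and>
     continuous_on strip u \<and>
     (\<forall>c\<in>atl. smooth_on {x \<in> strip. u x \<in> cdom c} (cmap c \<circ> u)) \<and>
     (\<forall>c\<in>atl. \<forall>x\<in>strip. u x \<in> cdom c \<longrightarrow>
        (\<exists>L. ((cmap c \<circ> u) has_derivative L) (at x within strip) \<and> inj L))"

definition central_curve :: "(real \<times> real \<Rightarrow> 'a) \<Rightarrow> real \<Rightarrow> 'a" where
  "central_curve u r = u (2 * pi * r, 0)"

definition central_image :: "(real \<times> real \<Rightarrow> 'a) \<Rightarrow> 'a set" where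
  "central_image u = central_curve u ` {0..1}"

text \<open>The integrand is the coefficient of \<open>d\<theta> \<and> ds\<close>.\<close>

definition has_cylinder_integral ::
    "'a chart set \<Rightarrow> (real \<times> real \<Rightarrow> 'a) \<Rightarrow> ('a, real) form2 \<Rightarrow> real \<Rightarrow> bool" where
  "has_cylinder_integral atl u \<omega> I \<longleftrightarrow>
     ((\<lambda>x. pullback2 atl u strip \<omega> x (1, 0) (0, 1)) has_integral I) ({0..2*pi} \<times> {-1..1})"


section \<open>The spaces on which the flow acts\<close>

definition S_gamma ::
    "'a chart set \<Rightarrow> (real \<times> real \<Rightarrow> 'a) \<Rightarrow> ('a, mat2) form1 set" where
  "S_gamma atl u = {A \<in> A_flat atl. hol atl (central_curve u) A \<notin> {mat 1, - mat 1}}"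

text \<open>Defined for all connections, since \<open>A + \<epsilon>B\<close> need not be flat in the derivative of this
  function along \<open>B\<close>.\<close>

definition f_gamma ::
    "'a chart set \<Rightarrow> (real \<times> real \<Rightarrow> 'a) \<Rightarrow> ('a, mat2) form1 \<Rightarrow> real" where
  "f_gamma atl u A = arccos (1/2 * Re (trace (hol atl (central_curve u) A)))"

definition has_df_gamma :: "'a chart set \<Rightarrow> (real \<times> real \<Rightarrow> 'a) \<Rightarrow>
    ('a, mat2) form1 \<Rightarrow> ('a, mat2) form1 \<Rightarrow> real \<Rightarrow> bool" where
  "has_df_gamma atl u A B D \<longleftrightarrow>
     ((\<lambda>\<epsilon>. f_gamma atl u (\<lambda>c p v. A c p v + \<epsilon> *\<^sub>R B c p v)) has_real_derivative D) (at 0)"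

definition gauge_rel :: "'a chart set \<Rightarrow> (real \<times> real \<Rightarrow> 'a) \<Rightarrow>
    (('a, mat2) form1 \<times> ('a, mat2) form1) set" where
  "gauge_rel atl u =
     {(A, A'). A \<in> S_gamma atl u \<and> (\<exists>\<psi>\<in>gauge_group atl. A' = gauge_act atl \<psi> A)}"

definition gauge_class :: "'a chart set \<Rightarrow> (real \<times> real \<Rightarrow> 'a) \<Rightarrow>
    ('a, mat2) form1 \<Rightarrow> ('a, mat2) form1 set" where
  "gauge_class atl u A = gauge_rel atl u `` {A}"

definition M_gamma ::
    "'a chart set \<Rightarrow> (real \<times> real \<Rightarrow> 'a) \<Rightarrow> ('a, mat2) form1 set set" where
  "M_gamma atl u = S_gamma atl u // gauge_rel atl u"

definition real_action :: "'x set \<Rightarrow> (real \<Rightarrow> 'x \<Rightarrow> 'x) \<Rightarrow> bool" where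
  "real_action X \<Xi> \<longleftrightarrow>
     (\<forall>t. \<forall>x\<in>X. \<Xi> t x \<in> X) \<and>
     (\<forall>x\<in>X. \<Xi> 0 x = x) \<and>
     (\<forall>t t'. \<forall>x\<in>X. \<Xi> (t + t') x = \<Xi> t (\<Xi> t' x))"

definition periodic_action :: "'x set \<Rightarrow> (real \<Rightarrow> 'x \<Rightarrow> 'x) \<Rightarrow> real \<Rightarrow> bool" where
  "periodic_action X \<Xi> T \<longleftrightarrow> (\<forall>t. \<forall>x\<in>X. \<Xi> (t + T) x = \<Xi> t x)"

text \<open>The compact set is uniform in the time and in the connection.\<close>

definition supported_in ::
    "('a::topological_space, mat2) form1 set \<Rightarrow>
      (real \<Rightarrow> ('a, mat2) form1 \<Rightarrow> ('a, mat2) form1) \<Rightarrow> 'a set \<Rightarrow> bool" where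
  "supported_in X \<Xi> W \<longleftrightarrow>
     (\<exists>K. compact K \<and> K \<subseteq> W \<and> (\<forall>t. \<forall>A\<in>X. \<forall>p. p \<notin> K \<longrightarrow> (\<forall>c. \<Xi> t A c p = A c p)))"

definition has_velocity ::
    "(real \<Rightarrow> ('a, mat2) form1 \<Rightarrow> ('a, mat2) form1) \<Rightarrow> ('a, mat2) form1 \<Rightarrow> ('a, mat2) form1 \<Rightarrow> bool"
  where
  "has_velocity \<Xi> A V \<longleftrightarrow>
     (\<forall>c p v. ((\<lambda>t. \<Xi> t A c p v) has_vector_derivative V c p v) (at 0))"

end

theory Submission
  imports Defs
begin

text \<open>The holonomies of \<open>A\<close> around the circles of the cylinder form a covariantly constant section
  \<open>H\<close> with values in \<open>SU(2)\<close>. Since \<open>H \<noteq> \<plusminus>1\<close>, its normalized traceless part \<open>X\<close> is a section of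
  unit vectors of \<open>su(2)\<close> with \<open>dX = [A, X]\<close>, and for every bump function \<open>\<eta>\<close> with integral 1 the
  1-form \<open>\<eta>(s) X ds\<close> is a solution of the linearized flatness equation that does not change \<open>X\<close>.
  The flows are \<open>A + t \<eta>(s) X ds\<close>, with \<open>\<eta>\<close> supported on either side of the central curve.
  Gauge equivariance is that of \<open>X\<close>; the Hamiltonian property holds because \<open>\<langle>X, B\<rangle>\<close> is a closed
  1-form on the cylinder whose integral over the central curve is minus the derivative of the
  holonomy angle. The gauge transformation \<open>exp (g(s) X)\<close> adds \<open>g'(s) X ds\<close>: with \<open>g\<close> of compact
  support it compares the two flows, with \<open>g\<close> increasing from 0 to \<open>2\<pi>\<close> it extends by 1 and gives
  the period \<open>2\<pi>\<close>, and with \<open>g\<close> increasing from 0 to \<open>\<pi>\<close> it extends by \<open>-1\<close> on the far side if the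
  central curve separates the surface.\<close>

section \<open>Calculus of smooth maps\<close>

text \<open>The section \<open>X\<close> lives on the cylinder, but equations are solved on the
  strip that covers it. There the pulled-back connection has a unitary frame \<phi> with d\<phi> = A
  \<phi>, normalized at the base point, and \<open>X\<close> is the axis of the base holonomy H
  conjugated by \<phi>. A full turn multiplies \<phi> on the right by the inverse of H, which
  commutes with the axis of H; hence \<open>X\<close> is periodic and descends. The axis of a
  modified connection is not built again: it is recognized by the equation dX = [A, X] and its value
  at the base point, which determine it. Signs: the holonomy is the inverse of the end value of h' =
  A h, so that end value is cos f - sin f X, and this is what makes f decrease at the rate of the
  integral of \<langle>X, B\<rangle>. The coefficient of d\<theta> \<and> ds in the wedge of \<eta>
  X ds with B is -\<eta> \<langle>X, B(d/d\<theta>)\<rangle>, with the same sign. The periods do not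
  depend on the connection because X X = -1, so exp (r X) is a constant matrix when r is a multiple
  of \<pi>; and -1 is central, so it acts trivially on connections.\<close>

lemma Ck_on_subset: "Ck_on k W f \<Longrightarrow> V \<subseteq> W \<Longrightarrow> Ck_on k V f"
  by (induction k arbitrary: f) (auto intro: continuous_on_subset)

lemma has_derivative_frechet:
  "f differentiable (at x) \<Longrightarrow> (f has_derivative frechet_derivative f (at x)) (at x)"
  by (simp add: frechet_derivative_works)

lemma Ck_on_cong:
  assumes "open W" "\<And>x. x \<in> W \<Longrightarrow> f x = g x" "Ck_on k W f"
  shows "Ck_on k W g"
  using assms(2,3)
proof (induction k arbitrary: f g)
  case 0
  then show ?case by (auto cong: continuous_on_cong)
next
  case (Suc k)
  have d: "(g has_derivative frechet_derivative f (at x)) (at x)" if "x \<in> W" for x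
    using has_derivative_transform_within_open[OF _ \<open>open W\<close> that, of f _ UNIV g] Suc.prems that
    by (auto intro!: has_derivative_frechet)
  have "Ck_on k W (\<lambda>x. frechet_derivative g (at x) v)" for v
  proof (rule Suc.IH)
    show "Ck_on k W (\<lambda>x. frechet_derivative f (at x) v)" using Suc.prems(2) by simp
    show "frechet_derivative f (at x) v = frechet_derivative g (at x) v" if "x \<in> W" for x
      using frechet_derivative_at[OF d[OF that]] by simp
  qed
  then show ?case using d by (auto simp: differentiable_def)
qed

text \<open>The definition of \<open>Ck_on\<close> speaks of the chosen
  \<open>frechet_derivative\<close>; this rule lets any explicitly known derivative take its place,
  and most regularity proofs below go through it.\<close>

lemma Ck_on_Suc_derivI:
  assumes "open W" "\<And>x. x \<in> W \<Longrightarrow> (f has_derivative f' x) (at x)"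
    "\<And>v. Ck_on k W (\<lambda>x. f' x v)"
  shows "Ck_on (Suc k) W f"
proof -
  have "Ck_on k W (\<lambda>x. frechet_derivative f (at x) v)" for v
  proof (rule Ck_on_cong[OF assms(1) _ assms(3)])
    show "f' x v = frechet_derivative f (at x) v" if "x \<in> W" for x
      using frechet_derivative_at[OF assms(2)[OF that]] by simp
  qed
  then show ?thesis using assms(2) by (auto simp: differentiable_def)
qed

lemma Ck_on_SucD:
  assumes "Ck_on (Suc k) W f"
  shows "x \<in> W \<Longrightarrow> (f has_derivative frechet_derivative f (at x)) (at x)"
    "Ck_on k W (\<lambda>x. frechet_derivative f (at x) v)"
  using assms by (auto intro: has_derivative_frechet)

lemma Ck_on_Suc_imp: "Ck_on (Suc k) W f \<Longrightarrow> Ck_on k W f"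
proof (induction k arbitrary: f)
  case 0
  then show ?case
    by (auto intro!: continuous_at_imp_continuous_on differentiable_imp_continuous_within)
next
  case (Suc k)
  then show ?case by (metis Ck_on.simps(2))
qed

lemma Ck_on_linear:
  assumes "open W" "bounded_linear L" "Ck_on k W f"
  shows "Ck_on k W (\<lambda>x. L (f x))"
  using assms(3)
proof (induction k arbitrary: f)
  case 0
  then show ?case by (simp add: bounded_linear.continuous_on[OF assms(2)])
next
  case (Suc k)
  show ?case
    by (rule Ck_on_Suc_derivI[OF \<open>open W\<close>
          bounded_linear.has_derivative[OF assms(2) Ck_on_SucD(1)[OF Suc.prems]]])
      (auto intro!: Suc.IH Ck_on_SucD(2)[OF Suc.prems])
qed

lemma Ck_on_zero: "open W \<Longrightarrow> Ck_on k W (\<lambda>x. 0)"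
proof (induction k)
  case (Suc k)
  then show ?case by (intro Ck_on_Suc_derivI[where f'="\<lambda>x v. 0"]) auto
qed auto

lemma Ck_on_const: "open W \<Longrightarrow> Ck_on k W (\<lambda>x. c)"
  by (cases k) (auto intro!: Ck_on_Suc_derivI[where f'="\<lambda>x v. 0"] Ck_on_zero simp del: Ck_on.simps(2))

lemma Ck_on_id: "open W \<Longrightarrow> Ck_on k W (\<lambda>x. x)"
  by (cases k) (auto intro!: Ck_on_Suc_derivI[where f'="\<lambda>x v. v"] Ck_on_const simp del: Ck_on.simps(2))

lemma Ck_on_add:
  assumes "open W" "Ck_on k W f" "Ck_on k W g"
  shows "Ck_on k W (\<lambda>x. f x + g x)"
  using assms(2,3)
proof (induction k arbitrary: f g)
  case 0
  then show ?case by (auto intro: continuous_on_add)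
next
  case (Suc k)
  show ?case
    by (rule Ck_on_Suc_derivI[OF \<open>open W\<close>
        has_derivative_add[OF Ck_on_SucD(1)[OF Suc.prems(1)] Ck_on_SucD(1)[OF Suc.prems(2)]]])
      (auto intro!: Suc.IH Ck_on_SucD(2)[OF Suc.prems(1)] Ck_on_SucD(2)[OF Suc.prems(2)])
qed

lemma Ck_on_sum:
  assumes "open W" "\<And>i. i \<in> I \<Longrightarrow> Ck_on k W (f i)"
  shows "Ck_on k W (\<lambda>x. \<Sum>i\<in>I. f i x)"
  using assms(2)
  by (induction I rule: infinite_finite_induct)
    (auto intro!: Ck_on_add Ck_on_const \<open>open W\<close>)

lemma Ck_on_bilinear:
  assumes "open W" "bounded_bilinear m" "Ck_on k W f" "Ck_on k W g"
  shows "Ck_on k W (\<lambda>x. m (f x) (g x))"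
  using assms(3,4)
proof (induction k arbitrary: f g)
  case 0
  then show ?case by (auto intro: bounded_bilinear.continuous_on[OF assms(2)])
next
  case (Suc k)
  show ?case
    by (rule Ck_on_Suc_derivI[OF \<open>open W\<close> bounded_bilinear.FDERIV[OF assms(2)
        Ck_on_SucD(1)[OF Suc.prems(1)] Ck_on_SucD(1)[OF Suc.prems(2)]]])
      (auto intro!: Ck_on_add \<open>open W\<close> Suc.IH Ck_on_SucD(2)[OF Suc.prems(1)] Ck_on_SucD(2)[OF Suc.prems(2)]
         Ck_on_Suc_imp[OF Suc.prems(1)] Ck_on_Suc_imp[OF Suc.prems(2)] simp del: Ck_on.simps(2))
qed

lemma Ck_on_local:
  assumes "\<And>x. x \<in> W \<Longrightarrow> \<exists>V. open V \<and> x \<in> V \<and> Ck_on k V f"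
  shows "Ck_on k W f"
  using assms
proof (induction k arbitrary: f)
  case 0
  show ?case
    unfolding Ck_on.simps
  proof (intro continuous_at_imp_continuous_on ballI)
    fix x assume "x \<in> W"
    from 0[OF this] show "isCont f x" by (auto simp: continuous_on_eq_continuous_at)
  qed
next
  case (Suc k)
  have "f differentiable (at x)" if "x \<in> W" for x using Suc.prems[OF that] by auto
  moreover have "Ck_on k W (\<lambda>x. frechet_derivative f (at x) v)" for v
    by (rule Suc.IH) (metis Suc.prems Ck_on_SucD(2))
  ultimately show ?case by auto
qed

lemma Ck_on_compose:
  fixes f :: "'b::euclidean_space \<Rightarrow> 'c::real_normed_vector" and g :: "'a::euclidean_space \<Rightarrow> 'b"
  assumes "open W" "open V" "g ` W \<subseteq> V" "Ck_on k V f" "Ck_on k W g"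
  shows "Ck_on k W (\<lambda>x. f (g x))"
  using assms(4,5)
proof (induction k arbitrary: f)
  case 0
  then show ?case using assms(3) by (auto intro: continuous_on_compose2)
next
  case (Suc k)
  let ?D = "\<lambda>x. frechet_derivative f (at x)" and ?E = "\<lambda>x. frechet_derivative g (at x)"
  have lin: "linear (?D (g x))" if "x \<in> W" for x
    using Ck_on_SucD(1)[OF Suc.prems(1)] that assms(3) by (blast intro: has_derivative_linear)
  have 1: "((\<lambda>x. f (g x)) has_derivative (\<lambda>v. ?D (g x) (?E x v))) (at x)" if "x \<in> W" for x
    using diff_chain_at[OF Ck_on_SucD(1)[OF Suc.prems(2) that] Ck_on_SucD(1)[OF Suc.prems(1)]] that assms(3)
    by (auto simp: o_def)
  \<comment> \<open>The induction hypothesis covers derivatives of \<open>f\<close> in a fixed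
    direction, while the chain rule produces a direction that moves with \<open>x\<close>. Expanding
    it in \<open>Basis\<close> leaves products of scalar functions with derivatives in fixed
    directions.\<close>
  have 2: "?D (g x) (?E x v) = (\<Sum>b\<in>Basis. (?E x v \<bullet> b) *\<^sub>R ?D (g x) b)" if "x \<in> W" for x v
    by (subst euclidean_representation[symmetric, of "?E x v"])
      (simp only: linear_sum[OF lin[OF that]] linear_scale[OF lin[OF that]])
  have g: "Ck_on k W g" by (rule Ck_on_Suc_imp[OF Suc.prems(2)])
  have "Ck_on k W (\<lambda>x. \<Sum>b\<in>Basis. (?E x v \<bullet> b) *\<^sub>R ?D (g x) b)" for v
    by (intro Ck_on_sum Ck_on_bilinear[OF _ bounded_bilinear_scaleR] \<open>open W\<close>
        Ck_on_linear[OF _ bounded_linear_inner_left] Ck_on_SucD(2)[OF Suc.prems(2)]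
        Suc.IH[OF Ck_on_SucD(2)[OF Suc.prems(1)] g])
  then have "Ck_on k W (\<lambda>x. ?D (g x) (?E x v))" for v
    by (rule Ck_on_cong[OF \<open>open W\<close>, rotated]) (simp add: 2)
  then show ?case by (intro Ck_on_Suc_derivI[OF \<open>open W\<close> 1])
qed

text \<open>If the derivative is always as regular as the function, each order of differentiability
  yields the next. This serves functions known through a differential equation: the reciprocal,
  local inverses, and the axis of the holonomy.\<close>

lemma Ck_on_bootstrap:
  assumes "open W" "\<And>x. x \<in> W \<Longrightarrow> (f has_derivative f' x) (at x)"
    "\<And>k v. Ck_on k W f \<Longrightarrow> Ck_on k W (\<lambda>x. f' x v)"
  shows "Ck_on k W f"
proof (induction k)
  case 0
  then show ?case
    by (auto intro!: continuous_at_imp_continuous_on has_derivative_continuous[OF assms(2)])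
qed (use assms in \<open>auto intro!: Ck_on_Suc_derivI simp del: Ck_on.simps(2)\<close>)

section \<open>Smoothness on sets and its closure properties\<close>

lemma smooth_on_open: "open S \<Longrightarrow> smooth_on S f \<longleftrightarrow> (\<forall>k. Ck_on k S f)"
proof
  assume "open S" "smooth_on S f"
  show "\<forall>k. Ck_on k S f"
  proof (intro allI Ck_on_local)
    fix k x assume "x \<in> S"
    with \<open>smooth_on S f\<close> obtain W g where
      W: "open W" "x \<in> W" "Ck_on k W g" "\<forall>y\<in>S \<inter> W. g y = f y"
      unfolding smooth_on_def by blast
    have "Ck_on k (S \<inter> W) f"
      by (rule Ck_on_cong[where f=g]) (use W \<open>open S\<close> in \<open>auto intro: Ck_on_subset\<close>)
    then show "\<exists>V. open V \<and> x \<in> V \<and> Ck_on k V f" using W \<open>open S\<close> \<open>x \<in> S\<close> by blast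
  qed
qed (auto simp: smooth_on_def)

lemma smooth_on_subset:
  assumes "smooth_on S f" "T \<subseteq> S"
  shows "smooth_on T f"
  unfolding smooth_on_def
proof
  fix x assume "x \<in> T"
  then have "x \<in> S" using assms(2) by blast
  with assms(1) obtain W g where W: "open W" "x \<in> W" "\<forall>k. Ck_on k W g" "\<forall>y\<in>S \<inter> W. g y = f y"
    unfolding smooth_on_def by blast
  then have "\<forall>y\<in>T \<inter> W. g y = f y" using assms(2) by blast
  with W(1-3) show "\<exists>W g. open W \<and> x \<in> W \<and> (\<forall>k. Ck_on k W g) \<and> (\<forall>y\<in>T \<inter> W. g y = f y)"
    by (intro exI conjI)
qed

lemma smooth_on_cong: "smooth_on S f \<Longrightarrow> (\<And>x. x \<in> S \<Longrightarrow> f x = g x) \<Longrightarrow> smooth_on S g"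
  unfolding smooth_on_def by simp

lemma smooth_on_local:
  assumes "\<And>x. x \<in> S \<Longrightarrow> \<exists>V. open V \<and> x \<in> V \<and> smooth_on (S \<inter> V) f"
  shows "smooth_on S f"
  unfolding smooth_on_def
proof
  fix x assume "x \<in> S"
  then obtain V where V: "open V" "x \<in> V" "smooth_on (S \<inter> V) f" using assms by blast
  then obtain W g where "open W" "x \<in> W" "\<forall>k. Ck_on k W g" "\<forall>y\<in>S \<inter> V \<inter> W. g y = f y"
    using \<open>x \<in> S\<close> unfolding smooth_on_def by blast
  then show "\<exists>W g. open W \<and> x \<in> W \<and> (\<forall>k. Ck_on k W g) \<and> (\<forall>y\<in>S \<inter> W. g y = f y)"
    using V by (intro exI[of _ "V \<inter> W"] exI[of _ g]) (auto intro: Ck_on_subset)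
qed

lemma
  assumes "open S" "smooth_on S f"
  shows smooth_on_has_derivative: "x \<in> S \<Longrightarrow> (f has_derivative frechet_derivative f (at x)) (at x)"
    and smooth_on_deriv: "smooth_on S (\<lambda>x. frechet_derivative f (at x) v)"
    and smooth_on_continuous_on: "continuous_on S f"
proof -
  have C: "Ck_on k S f" for k using assms by (simp add: smooth_on_open)
  show "x \<in> S \<Longrightarrow> (f has_derivative frechet_derivative f (at x)) (at x)"
    by (rule Ck_on_SucD(1)[OF C[of "Suc 0"]])
  show "smooth_on S (\<lambda>x. frechet_derivative f (at x) v)"
    using Ck_on_SucD(2)[OF C] assms by (simp add: smooth_on_open)
  show "continuous_on S f" using C[of 0] by simp
qed

lemma smooth_on_has_real_derivative:
  assumes "smooth_on UNIV (f :: real \<Rightarrow> real)"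
  shows "(f has_real_derivative frechet_derivative f (at s) 1) (at s)"
proof -
  have d: "(f has_derivative frechet_derivative f (at s)) (at s)"
    by (rule smooth_on_has_derivative[OF open_UNIV assms]) simp
  have "frechet_derivative f (at s) h = frechet_derivative f (at s) 1 * h" for h
    using linear_scale[OF has_derivative_linear[OF d], of h 1] by (simp add: mult.commute)
  then have "frechet_derivative f (at s) = (*) (frechet_derivative f (at s) 1)" by (rule ext)
  with d show ?thesis by (simp add: has_field_derivative_def)
qed

lemma smooth_on_const: "open S \<Longrightarrow> smooth_on S (\<lambda>x. c)"
  by (simp add: smooth_on_open Ck_on_const)

lemma smooth_on_id: "open S \<Longrightarrow> smooth_on S (\<lambda>x. x)"
  by (simp add: smooth_on_open Ck_on_id)

lemma smooth_on_linear: "open S \<Longrightarrow> bounded_linear L \<Longrightarrow> smooth_on S f \<Longrightarrow> smooth_on S (\<lambda>x. L (f x))"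
  by (simp add: smooth_on_open Ck_on_linear)

lemma smooth_on_add:
  "open S \<Longrightarrow> smooth_on S f \<Longrightarrow> smooth_on S g \<Longrightarrow> smooth_on S (\<lambda>x. f x + g x)"
  by (simp add: smooth_on_open Ck_on_add)

lemma smooth_on_bilinear:
  "open S \<Longrightarrow> bounded_bilinear m \<Longrightarrow> smooth_on S f \<Longrightarrow> smooth_on S g \<Longrightarrow> smooth_on S (\<lambda>x. m (f x) (g x))"
  by (simp add: smooth_on_open Ck_on_bilinear)

lemmas smooth_on_scaleR = smooth_on_bilinear[OF _ bounded_bilinear_scaleR]
  and smooth_on_mult = smooth_on_bilinear[OF _ bounded_bilinear_mult]
  and smooth_on_fst = smooth_on_linear[OF _ bounded_linear_fst]
  and smooth_on_snd = smooth_on_linear[OF _ bounded_linear_snd]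
  and smooth_on_minus = smooth_on_linear[OF _ bounded_linear_minus[OF bounded_linear_ident]]

lemma smooth_on_diff:
  "open S \<Longrightarrow> smooth_on S f \<Longrightarrow> smooth_on S g \<Longrightarrow> smooth_on S (\<lambda>x. f x - g x)"
  using smooth_on_add[of S f "\<lambda>x. - g x"] smooth_on_minus[of S g] by simp

lemma smooth_on_sum:
  "open S \<Longrightarrow> (\<And>i. i \<in> I \<Longrightarrow> smooth_on S (f i)) \<Longrightarrow> smooth_on S (\<lambda>x. \<Sum>i\<in>I. f i x)"
  by (simp add: smooth_on_open Ck_on_sum)

lemma smooth_on_Pair:
  assumes "open S" "smooth_on S f" "smooth_on S g"
  shows "smooth_on S (\<lambda>x. (f x, g x))"
proof -
  have "bounded_linear (\<lambda>x. (x, 0))" "bounded_linear (\<lambda>x. (0, x))"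
    by (auto intro: bounded_linear_Pair)
  then have "smooth_on S (\<lambda>x. (f x, 0) + (0, g x))"
    using assms by (intro smooth_on_add smooth_on_linear[of S "\<lambda>x. (x, 0)"] smooth_on_linear[of S "\<lambda>x. (0, x)"])
  then show ?thesis by simp
qed

lemma smooth_on_compose:
  assumes "open S" "open T" "g ` S \<subseteq> T" "smooth_on T f" "smooth_on S g"
  shows "smooth_on S (\<lambda>x. f (g x))"
  using assms by (simp add: smooth_on_open Ck_on_compose)

lemma smooth_on_bootstrap:
  assumes "open S" "\<And>x. x \<in> S \<Longrightarrow> (f has_derivative f' x) (at x)"
    "\<And>k v. Ck_on k S f \<Longrightarrow> Ck_on k S (\<lambda>x. f' x v)"
  shows "smooth_on S f"
  using Ck_on_bootstrap[OF assms] assms(1) by (simp add: smooth_on_open)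

lemma smooth_on_inverse:
  assumes "open S" "smooth_on S f" "\<And>x. x \<in> S \<Longrightarrow> f x \<noteq> (0::real)"
  shows "smooth_on S (\<lambda>x. inverse (f x))"
proof (rule smooth_on_compose[where T="-{0}" and g=f])
  show "smooth_on (-{0}) (inverse :: real \<Rightarrow> real)"
  proof (rule smooth_on_bootstrap[where f'="\<lambda>x v. - (inverse x * v * inverse x)"])
    fix k v assume C: "Ck_on k (-{0}) (inverse :: real \<Rightarrow> real)"
    have "Ck_on k (-{0}) (\<lambda>x::real. inverse x * - v * inverse x)"
      by (intro Ck_on_bilinear[OF _ bounded_bilinear_mult] C Ck_on_const) auto
    then show "Ck_on k (-{0}) (\<lambda>x::real. - (inverse x * v * inverse x))" by simp
  qed (auto intro!: has_derivative_inverse')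
qed (use assms in auto)

lemma Ck_on_sin_cos: "Ck_on k UNIV (sin :: real \<Rightarrow> real) \<and> Ck_on k UNIV (cos :: real \<Rightarrow> real)"
proof (induction k)
  case 0
  then show ?case by (auto intro!: continuous_intros)
next
  case (Suc k)
  have "Ck_on k UNIV (\<lambda>x::real. cos x * v)" "Ck_on k UNIV (\<lambda>x::real. - (sin x * v))" for v
    using Suc by (auto intro!: Ck_on_linear[OF _ bounded_linear_minus[OF bounded_linear_ident]]
        Ck_on_bilinear[OF _ bounded_bilinear_mult] Ck_on_const)
  then show ?case
    by (intro conjI Ck_on_Suc_derivI[where f'="\<lambda>x v. cos x * v"]
        Ck_on_Suc_derivI[where f'="\<lambda>x v. - (sin x * v)"]) (auto intro!: derivative_eq_intros)
qed

lemma smooth_on_sin: "smooth_on UNIV (sin :: real \<Rightarrow> real)"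
  and smooth_on_cos: "smooth_on UNIV (cos :: real \<Rightarrow> real)"
  using Ck_on_sin_cos by (auto simp: smooth_on_open)

section \<open>Symmetry of second derivatives\<close>

lemma has_vector_derivative_line:
  assumes "(f has_derivative f') (at (x + t *\<^sub>R v))"
  shows "((\<lambda>t. f (x + t *\<^sub>R v)) has_vector_derivative f' v) (at t)"
proof -
  have "((\<lambda>t. x + t *\<^sub>R v) has_derivative (\<lambda>h. h *\<^sub>R v)) (at t)"
    by (auto intro!: derivative_eq_intros)
  from diff_chain_at[OF this assms]
  have "((\<lambda>t. f (x + t *\<^sub>R v)) has_derivative (\<lambda>h. f' (h *\<^sub>R v))) (at t)"
    by (simp add: o_def)
  moreover have "f' (h *\<^sub>R v) = h *\<^sub>R f' v" for h
    using has_derivative_linear[OF assms] by (rule linear_scale)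
  ultimately show ?thesis by (simp add: has_vector_derivative_def)
qed

text \<open>Two applications of the mean value theorem, one in each direction, turn the second
  difference into the mixed derivative at a nearby point. The second difference is symmetric in
  \<open>v\<close> and \<open>w\<close>, which is what makes this form of the limit useful.\<close>

lemma second_difference_limit:
  fixes f :: "'a::euclidean_space \<Rightarrow> real"
  assumes W: "open W" "smooth_on W f" "x \<in> W"
  shows "((\<lambda>h. (f (x + h *\<^sub>R v + h *\<^sub>R w) - f (x + h *\<^sub>R v) - f (x + h *\<^sub>R w) + f x) / h\<^sup>2)
      \<longlongrightarrow> frechet_derivative (\<lambda>y. frechet_derivative f (at y) v) (at x) w) (at_right 0)"
proof (rule tendstoI)
  define Dv where "Dv = (\<lambda>y. frechet_derivative f (at y) v)"
  define m where "m = (\<lambda>y. frechet_derivative Dv (at y) w)"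
  have sDv: "smooth_on W Dv" unfolding Dv_def by (rule smooth_on_deriv[OF W(1,2)])
  have sm: "smooth_on W m" unfolding m_def by (rule smooth_on_deriv[OF W(1) sDv])
  have d1: "((\<lambda>t. f (y + t *\<^sub>R v)) has_real_derivative Dv (y + t *\<^sub>R v)) (at t)"
    if "y + t *\<^sub>R v \<in> W" for y t
    using has_vector_derivative_line[OF smooth_on_has_derivative[OF W(1,2) that]]
    by (simp add: has_real_derivative_iff_has_vector_derivative Dv_def)
  have d2: "((\<lambda>t. Dv (y + t *\<^sub>R w)) has_real_derivative m (y + t *\<^sub>R w)) (at t)"
    if "y + t *\<^sub>R w \<in> W" for y t
    using has_vector_derivative_line[OF smooth_on_has_derivative[OF W(1) sDv that]]
    by (simp add: has_real_derivative_iff_has_vector_derivative m_def)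
  fix e :: real assume "e > 0"
  have "isCont m x" using smooth_on_continuous_on[OF W(1) sm] W by (simp add: continuous_on_eq_continuous_at)
  then obtain r0 where r0: "r0 > 0" "\<And>y. dist y x < r0 \<Longrightarrow> dist (m y) (m x) < e"
    using \<open>e > 0\<close> unfolding continuous_at_eps_delta by (auto simp: dist_commute)
  obtain r1 where r1: "r1 > 0" "ball x r1 \<subseteq> W" using W open_contains_ball by blast
  define r where "r = min r0 r1"
  define d where "d = r / (norm v + norm w + 1)"
  have pos: "norm v + norm w + 1 > 0" by (smt (verit) norm_ge_zero)
  have r: "r > 0" "r \<le> r0" "ball x r \<subseteq> W" using r0 r1 by (auto simp: r_def)
  have d: "d > 0" using r pos by (simp add: d_def)
  have near: "x + s *\<^sub>R v + t *\<^sub>R w \<in> ball x r" if "0 \<le> s" "s < d" "0 \<le> t" "t < d" for s t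
  proof -
    have "norm (s *\<^sub>R v + t *\<^sub>R w) \<le> s * norm v + t * norm w"
      using that by (metis abs_of_nonneg norm_scaleR norm_triangle_ineq)
    also have "\<dots> \<le> d * norm v + d * norm w"
      using that by (intro add_mono mult_right_mono) auto
    also have "\<dots> < d * (norm v + norm w + 1)" using d by (simp add: algebra_simps)
    also have "\<dots> = r" using pos by (simp add: d_def)
    finally have "x + (s *\<^sub>R v + t *\<^sub>R w) \<in> ball x r"
      by (metis add_diff_cancel_left' dist_commute dist_norm mem_ball)
    then show ?thesis by (simp only: add.assoc)
  qed
  have "dist ((f (x + h *\<^sub>R v + h *\<^sub>R w) - f (x + h *\<^sub>R v) - f (x + h *\<^sub>R w) + f x) / h\<^sup>2) (m x) < e"
    if h: "0 < h" "h < d" for h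
  proof -
    \<comment> \<open>The increment in direction \<open>w\<close> as a function of the step in
      direction \<open>v\<close>; the first mean value is taken along \<open>v\<close>, the second
      along \<open>w\<close>.\<close>
    define g where "g = (\<lambda>t. f ((x + h *\<^sub>R w) + t *\<^sub>R v) - f (x + t *\<^sub>R v))"
    have "\<exists>t. 0 < t \<and> t < h \<and> g h - g 0 = (h - 0) * (Dv ((x + h *\<^sub>R w) + t *\<^sub>R v) - Dv (x + t *\<^sub>R v))"
    proof (rule MVT2[OF h(1)])
      fix t assume t: "0 \<le> t" "t \<le> h"
      have "x + t *\<^sub>R v + 0 *\<^sub>R w \<in> ball x r" "x + t *\<^sub>R v + h *\<^sub>R w \<in> ball x r"
        by (rule near; use t h in simp)+
      then have "(x + h *\<^sub>R w) + t *\<^sub>R v \<in> W" "x + t *\<^sub>R v \<in> W"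
        using r(3) by (auto simp: algebra_simps)
      then show "(g has_real_derivative (Dv ((x + h *\<^sub>R w) + t *\<^sub>R v) - Dv (x + t *\<^sub>R v))) (at t)"
        unfolding g_def by (intro DERIV_diff d1)
    qed
    then obtain t where t: "0 < t" "t < h"
      "g h - g 0 = h * (Dv ((x + t *\<^sub>R v) + h *\<^sub>R w) - Dv ((x + t *\<^sub>R v) + 0 *\<^sub>R w))"
      by (auto simp: algebra_simps)
    have "\<exists>s. 0 < s \<and> s < h \<and> Dv ((x + t *\<^sub>R v) + h *\<^sub>R w) - Dv ((x + t *\<^sub>R v) + 0 *\<^sub>R w)
        = (h - 0) * m ((x + t *\<^sub>R v) + s *\<^sub>R w)"
      by (rule MVT2[OF h(1)], rule d2) (use near r(3) t h in force)
    then obtain s where s: "0 < s" "s < h"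
      "Dv ((x + t *\<^sub>R v) + h *\<^sub>R w) - Dv ((x + t *\<^sub>R v) + 0 *\<^sub>R w) = h * m ((x + t *\<^sub>R v) + s *\<^sub>R w)"
      by auto
    have "f (x + h *\<^sub>R v + h *\<^sub>R w) - f (x + h *\<^sub>R v) - f (x + h *\<^sub>R w) + f x = g h - g 0"
      by (simp add: g_def algebra_simps)
    also have "\<dots> = h\<^sup>2 * m (x + t *\<^sub>R v + s *\<^sub>R w)"
      unfolding t(3) s(3) by (simp add: power2_eq_square)
    finally have "(f (x + h *\<^sub>R v + h *\<^sub>R w) - f (x + h *\<^sub>R v) - f (x + h *\<^sub>R w) + f x) / h\<^sup>2
        = m (x + t *\<^sub>R v + s *\<^sub>R w)" using h by simp
    moreover have "x + t *\<^sub>R v + s *\<^sub>R w \<in> ball x r" by (rule near) (use s t h in auto)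
    ultimately show ?thesis using r0(2)[of "x + t *\<^sub>R v + s *\<^sub>R w"] r(2) by (simp add: dist_commute)
  qed
  then have "\<forall>\<^sub>F h in at_right 0. dist ((f (x + h *\<^sub>R v + h *\<^sub>R w) - f (x + h *\<^sub>R v) - f (x + h *\<^sub>R w) + f x) / h\<^sup>2) (m x) < e"
    using d unfolding eventually_at_right_field by (auto intro!: exI[of _ d])
  then show "\<forall>\<^sub>F h in at_right 0. dist ((f (x + h *\<^sub>R v + h *\<^sub>R w) - f (x + h *\<^sub>R v) - f (x + h *\<^sub>R w) + f x) / h\<^sup>2)
      (frechet_derivative (\<lambda>y. frechet_derivative f (at y) v) (at x) w) < e"
    by (simp add: m_def Dv_def)
qed

text \<open>Both orders of differentiation are limits of the same second difference. The mean value
  theorem is about real functions, so the argument runs through the components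
  \<open>f y \<bullet> b\<close>.\<close>

lemma symmetric_second_derivative:
  fixes f :: "'a::euclidean_space \<Rightarrow> 'b::euclidean_space"
  assumes W: "open W" "smooth_on W f" "x \<in> W"
  shows "frechet_derivative (\<lambda>y. frechet_derivative f (at y) v) (at x) w
       = frechet_derivative (\<lambda>y. frechet_derivative f (at y) w) (at x) v"
proof (rule euclidean_eqI)
  fix b :: 'b
  let ?f = "\<lambda>y. f y \<bullet> b"
  have sf: "smooth_on W ?f" by (rule smooth_on_linear[OF W(1) bounded_linear_inner_left W(2)])
  have 1: "((\<lambda>y. frechet_derivative ?f (at y) v) has_derivative
        (\<lambda>w. frechet_derivative (\<lambda>y. frechet_derivative f (at y) v) (at x) w \<bullet> b)) (at x)" for v
  proof (rule has_derivative_transform_within_open[OF _ W(1,3)])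
    show "((\<lambda>y. frechet_derivative f (at y) v \<bullet> b) has_derivative
        (\<lambda>w. frechet_derivative (\<lambda>y. frechet_derivative f (at y) v) (at x) w \<bullet> b)) (at x)"
      by (rule has_derivative_inner_left[OF smooth_on_has_derivative[OF W(1) smooth_on_deriv[OF W(1,2)] W(3)]])
    show "frechet_derivative f (at y) v \<bullet> b = frechet_derivative ?f (at y) v" if "y \<in> W" for y
      by (rule fun_cong[OF frechet_derivative_at[OF
            has_derivative_inner_left[OF smooth_on_has_derivative[OF W(1,2) that], of b]]])
  qed
  have swap: "?f (x + h *\<^sub>R w + h *\<^sub>R v) - ?f (x + h *\<^sub>R w) - ?f (x + h *\<^sub>R v) + ?f x
      = ?f (x + h *\<^sub>R v + h *\<^sub>R w) - ?f (x + h *\<^sub>R v) - ?f (x + h *\<^sub>R w) + ?f x" for h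
  proof -
    have e: "x + h *\<^sub>R w + h *\<^sub>R v = x + h *\<^sub>R v + h *\<^sub>R w" by (simp add: ac_simps)
    show ?thesis unfolding e by simp
  qed
  have "frechet_derivative (\<lambda>y. frechet_derivative ?f (at y) v) (at x) w
       = frechet_derivative (\<lambda>y. frechet_derivative ?f (at y) w) (at x) v"
    by (rule tendsto_unique[OF _ second_difference_limit[OF W(1) sf W(3), of v w]
          second_difference_limit[OF W(1) sf W(3), of w v, unfolded swap]]) simp
  then show "frechet_derivative (\<lambda>y. frechet_derivative f (at y) v) (at x) w \<bullet> b
       = frechet_derivative (\<lambda>y. frechet_derivative f (at y) w) (at x) v \<bullet> b"
    by (simp only: frechet_derivative_at[OF 1, symmetric])
qed

section \<open>The inverse function theorem with a smooth inverse\<close>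

lemma inv_linear_R2:
  fixes L :: "real \<times> real \<Rightarrow> real \<times> real"
  assumes "linear L" "inj L"
  defines "a \<equiv> fst (L (1,0))" and "b \<equiv> fst (L (0,1))"
    and "c \<equiv> snd (L (1,0))" and "d \<equiv> snd (L (0,1))"
  shows "a * d - b * c \<noteq> 0"
    and "inv L v = ((d * fst v - b * snd v) * inverse (a * d - b * c),
                    (a * snd v - c * fst v) * inverse (a * d - b * c))"
proof -
  have L: "L (p, q) = (a * p + b * q, c * p + d * q)" for p q
  proof -
    have "L (p, q) = L (p *\<^sub>R (1,0) + q *\<^sub>R (0,1))" by simp
    also have "\<dots> = p *\<^sub>R L (1,0) + q *\<^sub>R L (0,1)"
      by (simp only: linear_add[OF assms(1)] linear_scale[OF assms(1)])
    finally show ?thesis by (simp add: a_def b_def c_def d_def prod_eq_iff)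
  qed
  show nz: "a * d - b * c \<noteq> 0"
  proof
    assume z: "a * d - b * c = 0"
    have "L (d, - c) = L (0, 0)" "L (- b, a) = L (0, 0)" using z by (auto simp: L algebra_simps)
    then have "d = 0" "c = 0" "b = 0" "a = 0" using injD[OF assms(2)] by fastforce+
    then have "L (1, 0) = L (0, 0)" by (simp add: L)
    then show False using injD[OF assms(2)] by fastforce
  qed
  define k where "k = a * d - b * c"
  have "k \<noteq> 0" using nz by (simp add: k_def)
  have "L ((d * fst v - b * snd v) * inverse k, (a * snd v - c * fst v) * inverse k)
      = ((a * d - b * c) * inverse k * fst v, (a * d - b * c) * inverse k * snd v)"
    by (simp add: L algebra_simps)
  also have "\<dots> = v" using \<open>k \<noteq> 0\<close> by (simp flip: k_def)
  finally show "inv L v = ((d * fst v - b * snd v) * inverse (a * d - b * c),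
                    (a * snd v - c * fst v) * inverse (a * d - b * c))"
    using inv_f_eq[OF assms(2)] unfolding k_def by blast
qed

text \<open>The inverse function theorem gives \<open>g\<close> with derivative the inverse of the
  derivative of \<open>f\<close> at \<open>g y\<close>. By Cramer's rule this is a smooth function
  of \<open>g y\<close>, so it is as regular as \<open>g\<close>, and bootstrapping makes
  \<open>g\<close> smooth.\<close>

lemma smooth_inverse_function:
  fixes f :: "real \<times> real \<Rightarrow> real \<times> real"
  assumes U: "open U" "smooth_on U f" "x0 \<in> U" and inj: "inj (frechet_derivative f (at x0))"
  obtains U' V g where "open U'" "U' \<subseteq> U" "x0 \<in> U'" "open V" "f x0 \<in> V" "homeomorphism U' V f g"
    "smooth_on V g"
proof -
  let ?D = "\<lambda>x. frechet_derivative f (at x)"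
  have der: "(f has_derivative ?D x) (at x)" if "x \<in> U" for x
    using smooth_on_has_derivative[OF U(1,2) that] .
  have bl: "bounded_linear (?D x)" if "x \<in> U" for x
    using der[OF that] by (rule has_derivative_bounded_linear)
  define f' where "f' = (\<lambda>x. Blinfun (?D x))"
  have f': "blinfun_apply (f' x) = ?D x" if "x \<in> U" for x
    unfolding f'_def by (rule bounded_linear_Blinfun_apply[OF bl[OF that]])
  have cont: "continuous_on U f'"
  proof (rule continuous_on_blinfun_componentwise)
    fix i :: "real \<times> real"
    have "continuous_on U (\<lambda>x. ?D x i)" by (rule smooth_on_continuous_on[OF U(1) smooth_on_deriv[OF U(1,2)]])
    then show "continuous_on U (\<lambda>x. blinfun_apply (f' x) i)"
      by (simp add: f' cong: continuous_on_cong)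
  qed
  obtain h where h: "linear h" "h \<circ> ?D x0 = id"
    using linear_injective_left_inverse[OF has_derivative_linear[OF der[OF U(3)]] inj] by blast
  have "bounded_linear h" using h(1) by (rule linear_conv_bounded_linear[THEN iffD1])
  then have invf: "Blinfun h o\<^sub>L f' x0 = id_blinfun"
    by (intro blinfun_eqI) (use fun_cong[OF h(2)] in \<open>simp add: bounded_linear_Blinfun_apply f' U(3)\<close>)
  have derf: "(f has_derivative blinfun_apply (f' x)) (at x)" if "x \<in> U" for x
    using der[OF that] f'[OF that] by simp
  obtain U' V g g' where *: "open U'" "U' \<subseteq> U" "x0 \<in> U'" "open V" "f x0 \<in> V" "homeomorphism U' V f g"
    "\<And>y. y \<in> V \<Longrightarrow> (g has_derivative (g' y)) (at y)"
    "\<And>y. y \<in> V \<Longrightarrow> g' y = inv (blinfun_apply (f' (g y)))"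
    "\<And>y. y \<in> V \<Longrightarrow> bij (blinfun_apply (f' (g y)))"
    by (rule inverse_function_theorem[OF U(1) derf cont U(3) invf], assumption, rule that, auto)
  have gU: "g y \<in> U" if "y \<in> V" for y using that *(2,6) by (auto simp: homeomorphism_def)
  define det where "det = (\<lambda>x. fst (?D x (1,0)) * snd (?D x (0,1)) - fst (?D x (0,1)) * snd (?D x (1,0)))"
  \<comment> \<open>Away from \<open>x0\<close> the determinant may vanish inside \<open>U\<close>;
    the values of \<open>g\<close> stay in the open set where Cramer's formula is smooth.\<close>
  define U2 where "U2 = {x \<in> U. det x \<noteq> 0}"
  have sD: "smooth_on U (\<lambda>x. ?D x v)" for v by (rule smooth_on_deriv[OF U(1,2)])
  have sdet: "smooth_on U det" unfolding det_def
    by (intro smooth_on_diff smooth_on_mult smooth_on_fst smooth_on_snd sD U(1))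
  have "open U2" unfolding U2_def
    using continuous_open_preimage[OF smooth_on_continuous_on[OF U(1) sdet] U(1), of "-{0}"]
    by (simp add: vimage_def Int_def open_Compl)
  have U2: "U2 \<subseteq> U" by (auto simp: U2_def)
  have gU2: "g y \<in> U2" if "y \<in> V" for y
    using inv_linear_R2(1)[of "?D (g y)"] *(9)[OF that] der[OF gU[OF that]] gU[OF that]
    by (auto simp: f' U2_def det_def dest: bij_is_inj has_derivative_linear)
  define e where "e = (\<lambda>v x. ((snd (?D x (0,1)) * fst v - fst (?D x (0,1)) * snd v) * inverse (det x),
      (fst (?D x (1,0)) * snd v - snd (?D x (1,0)) * fst v) * inverse (det x)))"
  have se: "smooth_on U2 (e v)" for v
    unfolding e_def
    by (intro smooth_on_Pair smooth_on_mult smooth_on_diff smooth_on_fst smooth_on_snd smooth_on_inverse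
        smooth_on_const \<open>open U2\<close> smooth_on_subset[OF sdet U2] smooth_on_subset[OF sD U2])
      (auto simp: U2_def)
  have g'e: "g' y v = e v (g y)" if "y \<in> V" for y v
    using inv_linear_R2(2)[of "?D (g y)" v] *(9)[OF that] der[OF gU[OF that]] gU[OF that]
    by (auto simp: f' *(8)[OF that] e_def det_def dest: bij_is_inj has_derivative_linear)
  have "smooth_on V g"
  proof (rule smooth_on_bootstrap[where f'="\<lambda>y v. e v (g y)"])
    show "(g has_derivative (\<lambda>v. e v (g y))) (at y)" if "y \<in> V" for y
    proof -
      have "g' y = (\<lambda>v. e v (g y))" using g'e[OF that] by (rule ext)
      with *(7)[OF that] show ?thesis by simp
    qed
    fix k v assume "Ck_on k V g"
    then show "Ck_on k V (\<lambda>y. e v (g y))"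
      using Ck_on_compose[of V U2 g k "e v"] se[of v] \<open>open U2\<close> gU2 *(4)
      by (simp add: smooth_on_open image_subset_iff)
  qed (rule *)
  with that * show thesis by blast
qed

text \<open>The derivative is uniformly continuous on a compact thickening of \<open>K\<close>, and
  the mean value inequality along the segment from \<open>y\<close> to \<open>y + z\<close> turns
  this into a remainder bound uniform in \<open>y\<close>. It is used along a whole ray, where the
  remainder must be controlled simultaneously at all times.\<close>

lemma smooth_on_uniformly_differentiable:
  fixes f :: "'a::euclidean_space \<Rightarrow> 'b::real_normed_vector"
  assumes W: "open W" "smooth_on W f" and K: "compact K" "K \<subseteq> W" and "e > 0"
  obtains d where "d > 0" "\<And>y z. y \<in> K \<Longrightarrow> norm z < d \<Longrightarrow> y + z \<in> W"
    "\<And>y z. y \<in> K \<Longrightarrow> norm z < d \<Longrightarrow>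
      norm (f (y + z) - f y - frechet_derivative f (at y) z) \<le> e * norm z"
proof -
  let ?D = "\<lambda>x. frechet_derivative f (at x)"
  obtain r where r: "r > 0" "(\<Union>x\<in>K. cball x r) \<subseteq> W"
    using compact_subset_open_imp_cball_epsilon_subset[OF K(1) W(1) K(2)] by blast
  define K' where "K' = (\<Union>x\<in>K. cball x r)"
  have "K' = (\<Union>x\<in>K. \<Union>y\<in>cball 0 r. {x + y})"
  proof (intro set_eqI iffI)
    fix y assume "y \<in> K'"
    then obtain x where x: "x \<in> K" "dist x y \<le> r" by (auto simp: K'_def)
    then have "y - x \<in> cball 0 r" "y = x + (y - x)" by (auto simp: dist_norm norm_minus_commute)
    with x show "y \<in> (\<Union>x\<in>K. \<Union>y\<in>cball 0 r. {x + y})" by blast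
  next
    fix y assume "y \<in> (\<Union>x\<in>K. \<Union>y\<in>cball 0 r. {x + y})"
    then obtain x z where "x \<in> K" "norm z \<le> r" "y = x + z" by auto
    then have "y \<in> cball x r" by (simp add: dist_norm)
    with \<open>x \<in> K\<close> show "y \<in> K'" by (auto simp: K'_def)
  qed
  then have "compact K'" using compact_sums'[OF K(1) compact_cball] by simp
  have "K' \<subseteq> W" using r by (simp add: K'_def)
  \<comment> \<open>The derivative is compared on basis vectors only; an error of
    \<open>e / n\<close> in each of the \<open>n\<close> directions adds up to
    \<open>e\<close>.\<close>
  define n where "n = real DIM('a)"
  have "n > 0" by (simp add: n_def)
  have "\<exists>d>0. \<forall>x\<in>K'. \<forall>y\<in>K'. dist y x < d \<longrightarrow> dist (?D y b) (?D x b) < e / n" for b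
    using compact_uniformly_continuous[OF continuous_on_subset[OF
        smooth_on_continuous_on[OF W(1) smooth_on_deriv[OF W]] \<open>K' \<subseteq> W\<close>] \<open>compact K'\<close>, of b]
    \<open>e > 0\<close> \<open>n > 0\<close> unfolding uniformly_continuous_on_def by simp
  then obtain d0 where d0: "\<And>b. d0 b > 0"
    "\<And>b x y. x \<in> K' \<Longrightarrow> y \<in> K' \<Longrightarrow> dist y x < d0 b \<Longrightarrow> dist (?D y b) (?D x b) < e / n"
    by metis
  define d where "d = min r (Min (d0 ` (Basis :: 'a set)))"
  have d: "d > 0" "d \<le> r" "\<And>b. b \<in> Basis \<Longrightarrow> d \<le> d0 b"
    using r(1) d0(1) by (auto simp: d_def min.coboundedI2)
  show thesis
  proof (rule that)
    fix y z :: 'a assume yz: "y \<in> K" "norm z < d"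
    have inK': "y + t *\<^sub>R z \<in> K'" "norm (t *\<^sub>R z) < d" if "t \<in> {0..1}" for t
    proof -
      have "norm (t *\<^sub>R z) \<le> norm z" using that by (simp add: mult_left_le_one_le)
      then show "norm (t *\<^sub>R z) < d" using yz by simp
      then show "y + t *\<^sub>R z \<in> K'" using yz d(2) by (auto simp: K'_def dist_norm intro!: bexI[of _ y])
    qed
    show "y + z \<in> W" using inK'[of 1] \<open>K' \<subseteq> W\<close> by auto
    have "norm (f (y + z) - f y - ?D y ((y + z) - y)) \<le> norm ((y + z) - y) * e"
    proof (rule differentiable_bound_linearization[where S="(\<lambda>t. y + t *\<^sub>R z) ` {0..1}"])
      show "y + t *\<^sub>R (y + z - y) \<in> (\<lambda>t. y + t *\<^sub>R z) ` {0..1}" if "t \<in> {0..1}" for t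
        using that by (auto intro!: image_eqI[of _ _ t])
      show "y \<in> (\<lambda>t. y + t *\<^sub>R z) ` {0..1}" by (auto intro!: image_eqI[of _ _ 0])
      fix x assume "x \<in> (\<lambda>t. y + t *\<^sub>R z) ` {0..1}"
      then obtain t where t: "t \<in> {0..1}" "x = y + t *\<^sub>R z" by auto
      have xW: "x \<in> W" and yW: "y \<in> W" using inK'(1)[of t] inK'(1)[of 0] t \<open>K' \<subseteq> W\<close> by auto
      show "(f has_derivative ?D x) (at x within (\<lambda>t. y + t *\<^sub>R z) ` {0..1})"
        using smooth_on_has_derivative[OF W xW] by (rule has_derivative_at_withinI)
      have lin: "linear (\<lambda>h. ?D x h - ?D y h)"
        using smooth_on_has_derivative[OF W xW] smooth_on_has_derivative[OF W yW]
        by (intro linear_compose_sub has_derivative_linear)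
      show "onorm (?D x - ?D y) \<le> e"
        unfolding fun_diff_def
      proof (rule onorm_le)
        fix h :: 'a
        have "norm (?D x h - ?D y h) = norm (\<Sum>b\<in>Basis. (h \<bullet> b) *\<^sub>R (?D x b - ?D y b))"
          using linear_sum[OF lin, of "\<lambda>b. (h \<bullet> b) *\<^sub>R b" Basis]
          by (simp add: euclidean_representation linear_scale[OF lin])
        also have "\<dots> \<le> (\<Sum>b\<in>(Basis::'a set). norm h * (e / n))"
        proof (rule sum_norm_le)
          fix b :: 'a assume b: "b \<in> Basis"
          have "dist x y < d0 b" using inK'(2)[OF t(1)] t(2) d(3)[OF b] by (simp add: dist_norm)
          then have "norm (?D x b - ?D y b) \<le> e / n"
            using d0(2)[of y x b] inK'(1)[of t] inK'(1)[of 0] t by (simp add: dist_norm)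
          then show "norm ((h \<bullet> b) *\<^sub>R (?D x b - ?D y b)) \<le> norm h * (e / n)"
            using Basis_le_norm[OF b, of h] unfolding norm_scaleR by (intro mult_mono) auto
        qed
        also have "\<dots> = e * norm h" using \<open>n > 0\<close> by (simp add: n_def)
        finally show "norm (?D x h - ?D y h) \<le> e * norm h" .
      qed
    qed
    then show "norm (f (y + z) - f y - ?D y z) \<le> e * norm z" by (simp add: mult.commute)
  qed (rule d)
qed

subsection \<open>A smooth step function\<close>

text \<open>The powers of \<open>inverse x\<close> are there to make the family closed under
  differentiation up to linear combinations, so that all orders are handled by one
  induction.\<close>

definition flat_exp :: "nat \<Rightarrow> real \<Rightarrow> real" where
  "flat_exp n x = (if 0 < x then inverse x ^ n * exp (- inverse x) else 0)"

lemma flat_exp_tendsto: "(flat_exp n \<longlongrightarrow> 0) (at 0)"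
proof (subst filterlim_at_split, rule conjI)
  have "\<forall>\<^sub>F x in at_left 0. flat_exp n x = 0"
    using eventually_at_left_real[of "-1" 0] by (auto simp: flat_exp_def elim: eventually_mono)
  then show "(flat_exp n \<longlongrightarrow> 0) (at_left 0)" by (rule tendsto_eventually)
  have "((\<lambda>x. inverse x ^ n / exp (inverse x)) \<longlongrightarrow> (0::real)) (at_right 0)"
    by (rule filterlim_compose[OF tendsto_power_div_exp_0 filterlim_inverse_at_top_right])
  moreover have "\<forall>\<^sub>F x in at_right 0. inverse x ^ n / exp (inverse x) = flat_exp n x"
    using eventually_at_right_less[of "0::real"]
    by (rule eventually_mono) (auto simp: flat_exp_def exp_minus field_simps)
  ultimately show "(flat_exp n \<longlongrightarrow> 0) (at_right 0)" by (rule Lim_transform_eventually)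
qed

lemma flat_exp_deriv:
  "(flat_exp n has_real_derivative (flat_exp (n + 2) x - real n * flat_exp (n + 1) x)) (at x)"
proof -
  consider "x > 0" | "x < 0" | "x = 0" by linarith
  then show ?thesis
  proof cases
    case 1
    \<comment> \<open>The exponent \<open>n - 1\<close> is truncated at \<open>n = 0\<close>, where
      the factor \<open>real n\<close> vanishes.\<close>
    have e: "real n * inverse x ^ (n - 1) * (inverse x * inverse x) = real n * inverse x ^ (n + 1)"
      by (cases n) auto
    have "((\<lambda>x. inverse x ^ n * exp (- inverse x)) has_real_derivative
        (real n * inverse x ^ (n - 1) * - (inverse x * inverse x) * exp (- inverse x)
          + inverse x ^ n * (exp (- inverse x) * (inverse x * inverse x)))) (at x)"
      using 1 by (auto intro!: derivative_eq_intros simp: power2_eq_square)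
    also have "real n * inverse x ^ (n - 1) * - (inverse x * inverse x) * exp (- inverse x)
          + inverse x ^ n * (exp (- inverse x) * (inverse x * inverse x))
        = - (real n * inverse x ^ (n - 1) * (inverse x * inverse x)) * exp (- inverse x)
          + inverse x ^ (n + 2) * exp (- inverse x)" by (simp add: mult_ac)
    also have "\<dots> = inverse x ^ (n + 2) * exp (- inverse x) - real n * (inverse x ^ (n + 1) * exp (- inverse x))"
      unfolding e by simp
    finally have "((\<lambda>x. inverse x ^ n * exp (- inverse x)) has_real_derivative
        (inverse x ^ (n + 2) * exp (- inverse x) - real n * (inverse x ^ (n + 1) * exp (- inverse x)))) (at x)" .
    then have "((\<lambda>x. inverse x ^ n * exp (- inverse x)) has_real_derivative
        (flat_exp (n + 2) x - real n * flat_exp (n + 1) x)) (at x)"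
      using 1 by (simp add: flat_exp_def)
    then show ?thesis
      by (rule has_field_derivative_transform_within_open[where S="{0<..}"]) (use 1 in \<open>auto simp: flat_exp_def\<close>)
  next
    case 2
    have "((\<lambda>x. 0) has_real_derivative (flat_exp (n + 2) x - real n * flat_exp (n + 1) x)) (at x)"
      using 2 by (simp add: flat_exp_def)
    then show ?thesis
      by (rule has_field_derivative_transform_within_open[where S="{..<0}"]) (use 2 in \<open>auto simp: flat_exp_def\<close>)
  next
    case 3
    \<comment> \<open>The difference quotient at 0 is again a member of the family,
      \<open>flat_exp (Suc n)\<close>, and tends to 0.\<close>
    have "(flat_exp n has_real_derivative 0) (at 0)"
      unfolding has_field_derivative_iff
    proof (rule Lim_transform_eventually[OF flat_exp_tendsto[of "Suc n"]])
      have "\<forall>\<^sub>F x::real in at 0. x \<noteq> 0" by (auto simp: eventually_at_filter)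
      then show "\<forall>\<^sub>F x in at 0. flat_exp (Suc n) x = (flat_exp n x - flat_exp n 0) / (x - 0)"
        by (rule eventually_mono) (auto simp: flat_exp_def field_simps)
    qed
    then show ?thesis using 3 by (simp add: flat_exp_def)
  qed
qed

lemma Ck_on_flat_exp: "Ck_on k UNIV (flat_exp n)"
proof (induction k arbitrary: n)
  case 0
  then show ?case
    by (auto intro!: continuous_at_imp_continuous_on DERIV_isCont[OF flat_exp_deriv])
next
  case (Suc k)
  have *: "Ck_on k UNIV (\<lambda>x. (flat_exp (n + 2) x + (- real n) * flat_exp (n + 1) x) * v)" for v
    by (intro Ck_on_bilinear[OF _ bounded_bilinear_mult] Ck_on_add Ck_on_const Suc open_UNIV)
  show ?case
    by (rule Ck_on_Suc_derivI[where f'="\<lambda>x v. (flat_exp (n + 2) x + (- real n) * flat_exp (n + 1) x) * v"])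
      (use * flat_exp_deriv[of n] in \<open>simp_all add: has_field_derivative_def\<close>)
qed

text \<open>Of the form a / (a + b), where a vanishes up to 1/4 and b from 3/4 on, so that the
  denominator is never 0. The transition zone keeps a distance from the central curve at 0 and from
  the boundary at 1; translated by -1 it lies in the negative half of the cylinder.\<close>

definition smooth_step :: "real \<Rightarrow> real" where
  "smooth_step s = flat_exp 0 (s - 1/4) * inverse (flat_exp 0 (s - 1/4) + flat_exp 0 (3/4 - s))"

lemma smooth_step_eq_0: "s \<le> 1/4 \<Longrightarrow> smooth_step s = 0"
  and smooth_step_eq_1: "s \<ge> 3/4 \<Longrightarrow> smooth_step s = 1"
  by (auto simp: smooth_step_def flat_exp_def)

lemma smooth_on_smooth_step: "smooth_on UNIV smooth_step"
proof -
  have f: "smooth_on UNIV (flat_exp 0)" by (simp add: smooth_on_open Ck_on_flat_exp)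
  have 1: "smooth_on UNIV (\<lambda>s. flat_exp 0 (s - 1/4))"
    by (rule smooth_on_compose[OF _ _ _ f]) (auto intro!: smooth_on_diff smooth_on_id smooth_on_const)
  have 2: "smooth_on UNIV (\<lambda>s. flat_exp 0 (3/4 - s))"
    by (rule smooth_on_compose[OF _ _ _ f]) (auto intro!: smooth_on_diff smooth_on_id smooth_on_const)
  have "flat_exp 0 (s - 1/4) + flat_exp 0 (3/4 - s) \<noteq> 0" for s
    using exp_gt_zero[of "- inverse (s - 1/4)"] exp_gt_zero[of "- inverse (3/4 - s)"]
    by (auto simp: flat_exp_def simp del: exp_gt_zero)
  then show ?thesis unfolding smooth_step_def[abs_def]
    by (intro smooth_on_mult smooth_on_inverse smooth_on_add 1 2 open_UNIV)
qed

definition bump :: "real \<Rightarrow> real" where "bump s = frechet_derivative smooth_step (at s) 1"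

lemma smooth_on_bump: "smooth_on UNIV bump"
  unfolding bump_def[abs_def] by (intro smooth_on_deriv smooth_on_smooth_step open_UNIV)

lemma smooth_step_deriv: "(smooth_step has_real_derivative bump s) (at s)"
  unfolding bump_def by (rule smooth_on_has_real_derivative[OF smooth_on_smooth_step])

lemma smooth_step_translate_deriv: "((\<lambda>s. smooth_step (s + 1)) has_real_derivative bump (s + 1)) (at s)"
proof -
  have "((\<lambda>s. s + 1) has_real_derivative 1) (at s)" by (auto intro!: derivative_eq_intros)
  from DERIV_chain2[OF smooth_step_deriv this] show ?thesis by simp
qed

lemma bump_eq_0: "s < 1/4 \<or> s > 3/4 \<Longrightarrow> bump s = 0"
proof -
  have "(smooth_step has_real_derivative 0) (at s)" if "s < 1/4"
    by (rule has_field_derivative_transform_within_open[of "\<lambda>x. 0" _ _ "{..<1/4}"])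
      (use that in \<open>auto simp: smooth_step_eq_0\<close>)
  moreover have "(smooth_step has_real_derivative 0) (at s)" if "s > 3/4"
    by (rule has_field_derivative_transform_within_open[of "\<lambda>x. 1" _ _ "{3/4<..}"])
      (use that in \<open>auto simp: smooth_step_eq_1\<close>)
  ultimately show "s < 1/4 \<or> s > 3/4 \<Longrightarrow> bump s = 0"
    using DERIV_unique[OF smooth_step_deriv] by blast
qed

section \<open>Two by two matrices\<close>

abbreviation ct :: "mat2 \<Rightarrow> mat2" where "ct \<equiv> conj_transpose"

lemmas mat2_simps = vec_eq_iff forall_2 sum_2 matrix_matrix_mult_def conj_transpose_def mat_def

lemma ct_mult: "ct (X ** Y) = ct Y ** ct X"
  by (simp add: mat2_simps mult.commute)

lemma ct_simps [simp]: "ct (ct X) = X" "ct (mat 1) = mat 1" "ct 0 = 0" "ct (- X) = - ct X"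
  "ct (X + Y) = ct X + ct Y" "ct (X - Y) = ct X - ct Y" "ct (r *\<^sub>R X) = r *\<^sub>R ct X"
  by (simp_all add: mat2_simps)

lemma bounded_linear_ct: "bounded_linear ct"
  by (intro linear_conv_bounded_linear[THEN iffD1] linearI) simp_all

lemma matrix_minus_left [simp]: "(- X) ** Y = - (X ** (Y::mat2))"
  and matrix_minus_right [simp]: "X ** (- Y) = - (X ** (Y::mat2))"
  and matrix_scaleR_left [simp]: "(r *\<^sub>R X) ** Y = r *\<^sub>R (X ** (Y::mat2))"
  and matrix_scaleR_right [simp]: "X ** (r *\<^sub>R Y) = r *\<^sub>R (X ** (Y::mat2))"
  by (simp_all add: mat2_simps algebra_simps)

lemma matrix_distribs:
  "X ** (Y + Z) = X ** Y + X ** (Z::mat2)" "(Y + Z) ** X = Y ** X + Z ** (X::mat2)"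
  "X ** (Y - Z) = X ** Y - X ** (Z::mat2)" "(Y - Z) ** X = Y ** X - Z ** (X::mat2)"
  by (simp_all add: mat2_simps algebra_simps)

lemma bounded_bilinear_mat2: "bounded_bilinear ((**) :: mat2 \<Rightarrow> mat2 \<Rightarrow> mat2)"
  by (subst bilinear_conv_bounded_bilinear[symmetric])
    (auto simp: bilinear_def matrix_distribs intro!: linearI)

text \<open>The norm of the type is thus the Hilbert-Schmidt norm, for which multiplication by a
  unitary matrix on either side is an isometry.\<close>

lemma inner_mat2: "X \<bullet> Y = Re (trace (ct X ** (Y::mat2)))"
  by (simp add: inner_vec_def sum_2 trace_def matrix_matrix_mult_def conj_transpose_def inner_complex_def)

lemma trace_mult_commute: "trace (X ** Y) = trace (Y ** (X::mat2))"
  by (simp add: trace_def sum_2 matrix_matrix_mult_def algebra_simps)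

lemma trace_simps [simp]: "trace (- X) = - trace (X::mat2)" "trace (X + Y) = trace X + trace (Y::mat2)"
  "trace (X - Y) = trace X - trace (Y::mat2)" "trace (r *\<^sub>R X) = r *\<^sub>R trace (X::mat2)"
  "trace (ct X) = cnj (trace X)" "trace (mat 1 :: mat2) = 2"
  by (simp_all add: trace_def sum_2 conj_transpose_def mat_def algebra_simps)

lemma unitary_cancel:
  fixes X :: mat2
  assumes "ct U ** U = mat 1"
  shows "U ** ct U = mat 1" "ct U ** (U ** X) = X" "U ** (ct U ** X) = X"
    "X ** ct U ** U = X" "X ** U ** ct U = X"
proof -
  show 1: "U ** ct U = mat 1" using assms by (simp add: matrix_left_right_inverse)
  show "ct U ** (U ** X) = X" "U ** (ct U ** X) = X"
    by (simp_all add: matrix_mul_assoc assms 1)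
  show "X ** ct U ** U = X" "X ** U ** ct U = X"
    by (simp_all add: matrix_mul_assoc[symmetric] assms 1)
qed

lemma norm_unitary_left:
  assumes "ct U ** U = mat 1"
  shows "norm (U ** X) = norm (X :: mat2)"
proof -
  have "ct (U ** X) ** (U ** X) = ct X ** (ct U ** U) ** X"
    by (simp only: ct_mult matrix_mul_assoc)
  then show ?thesis by (simp add: norm_eq_sqrt_inner inner_mat2 assms)
qed

lemma norm_ct [simp]: "norm (ct X) = norm X"
  by (simp add: norm_eq_sqrt_inner inner_mat2 trace_mult_commute)

lemma norm_unitary_right: "ct U ** U = mat 1 \<Longrightarrow> norm (X ** U) = norm (X :: mat2)"
  using norm_unitary_left[of "ct U" "ct X"] norm_ct[of "X ** U"]
  by (simp add: ct_mult unitary_cancel)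

lemma matrix_inv_unitary: "ct U ** U = mat 1 \<Longrightarrow> matrix_inv U = ct U"
proof -
  assume U: "ct U ** U = mat 1"
  then have "\<exists>V. U ** V = mat 1 \<and> V ** U = mat 1" using unitary_cancel(1) by blast
  then have "U ** matrix_inv U = mat 1" unfolding matrix_inv_def by (rule someI2_ex) simp
  then have "ct U ** (U ** matrix_inv U) = ct U" by simp
  then show "matrix_inv U = ct U" by (simp add: unitary_cancel[OF U])
qed

lemma SU2_unitary: "U \<in> SU2 \<Longrightarrow> ct U ** U = mat 1"
  by (simp add: SU2_def matrix_left_right_inverse)

text \<open>The commutator with an antihermitian matrix is skew for the Hilbert-Schmidt product.
  Solutions of dZ = [a, Z] therefore have constant length, which is how uniqueness of the axis is
  obtained.\<close>

lemma bracket_inner_self: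
  assumes a: "ct a = - a"
  shows "Z \<bullet> bracket a Z = 0"
proof -
  \<comment> \<open>The matrix \<open>ct Z ** (a ** Z)\<close> is antihermitian, so its trace is
    imaginary.\<close>
  have 1: "Re (trace (ct Z ** (a ** Z))) = 0" for Z
  proof -
    have "cnj (trace (ct Z ** (a ** Z))) = trace (ct (ct Z ** (a ** Z)))" by simp
    also have "\<dots> = - trace (ct Z ** (a ** Z))"
      by (simp only: ct_mult a) (simp add: matrix_mul_assoc)
    finally have "Re (cnj (trace (ct Z ** (a ** Z)))) = - Re (trace (ct Z ** (a ** Z)))" by simp
    then show ?thesis by simp
  qed
  have "trace (ct Z ** (Z ** a)) = trace (Z ** (a ** ct Z))"
    using trace_mult_commute[of "ct Z" "Z ** a"] by (simp add: matrix_mul_assoc)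
  then show ?thesis
    using 1[of Z] 1[of "ct Z"] by (simp add: inner_mat2 bracket_def matrix_distribs)
qed

section \<open>Linear differential equations\<close>

lemma mat2_norm_mult_bound: "\<exists>B>0. \<forall>(X::mat2) (Y::mat2). norm (X ** Y) \<le> norm X * norm Y * B"
  by (rule bounded_bilinear.pos_bounded[OF bounded_bilinear_mat2])

lemma antiderivative_exists:
  fixes f :: "real \<Rightarrow> 'a::euclidean_space"
  assumes "\<And>t. isCont f t"
  shows "\<exists>F. F 0 = 0 \<and> (\<forall>t. (F has_vector_derivative f t) (at t))"
proof -
  obtain F where F: "\<And>t::real. (F has_vector_derivative f t) (at t)"
    using einterval_antiderivative[of "-\<infinity>" "\<infinity>" f] assms by auto
  have "((\<lambda>t. F t - F 0) has_vector_derivative f t) (at t)" for t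
    using has_vector_derivative_diff[OF F has_vector_derivative_const] by simp
  then show ?thesis by (intro exI[of _ "\<lambda>t. F t - F 0"]) simp
qed

definition antiderivative :: "(real \<Rightarrow> 'a::euclidean_space) \<Rightarrow> real \<Rightarrow> 'a" where
  "antiderivative f = (SOME F. F 0 = 0 \<and> (\<forall>t. (F has_vector_derivative f t) (at t)))"

lemma antiderivative:
  assumes "\<And>t. isCont f t"
  shows "antiderivative f 0 = 0" "(antiderivative f has_vector_derivative f t) (at t)"
  using someI_ex[OF antiderivative_exists[OF assms]] unfolding antiderivative_def by auto

text \<open>The estimate behind the factorials in the series. Rescaling the path to
  \<open>r * t\<close> with \<open>r\<close> in the unit interval treats negative and positive times
  alike.\<close>

lemma power_bound_integrate:
  fixes f :: "real \<Rightarrow> 'a::real_normed_vector"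
  assumes f: "\<And>s. \<bar>s\<bar> \<le> T \<Longrightarrow> (f has_vector_derivative f' s) (at s)"
    and b: "\<And>s. \<bar>s\<bar> \<le> T \<Longrightarrow> norm (f' s) \<le> C * \<bar>s\<bar> ^ n"
    and "\<bar>t\<bar> \<le> T" "f 0 = 0"
  shows "norm (f t) \<le> C * \<bar>t\<bar> ^ Suc n / real (Suc n)"
proof -
  let ?g = "\<lambda>r. f (r * t)" and ?\<phi> = "\<lambda>r. C * \<bar>t\<bar> ^ Suc n / real (Suc n) * r ^ Suc n"
  have in_T: "\<bar>r * t\<bar> \<le> T" if "r \<in> {0..1}" for r
    using that mult_left_le_one_le[of "\<bar>t\<bar>" r] assms(3) by (auto simp: abs_mult)
  have g: "(?g has_vector_derivative (t *\<^sub>R f' (r * t))) (at r)" if "r \<in> {0..1}" for r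
  proof -
    have "((\<lambda>r. r * t) has_vector_derivative t) (at r)"
      by (auto intro!: derivative_eq_intros simp: has_real_derivative_iff_has_vector_derivative[symmetric])
    from vector_diff_chain_at[OF this f[OF in_T[OF that]]] show ?thesis by (simp add: o_def)
  qed
  have "norm (?g 1 - ?g 0) \<le> ?\<phi> 1 - ?\<phi> 0"
  proof (rule differentiable_bound_general[where f'="\<lambda>r. t *\<^sub>R f' (r * t)"
        and \<phi>'="\<lambda>r. C * \<bar>t\<bar> ^ Suc n * r ^ n"])
    show "continuous_on {0..1} ?g"
      by (intro continuous_at_imp_continuous_on ballI has_vector_derivative_continuous[OF g])
    show "continuous_on {0..1} ?\<phi>" by (intro continuous_intros)
    fix r :: real assume r: "0 < r" "r < 1"
    then show "(?g has_vector_derivative t *\<^sub>R f' (r * t)) (at r)" by (intro g) auto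
    have "(?\<phi> has_real_derivative C * \<bar>t\<bar> ^ Suc n / real (Suc n) * (real (Suc n) * r ^ n)) (at r)"
      using DERIV_cmult[OF DERIV_pow[of "Suc n" r], of "C * \<bar>t\<bar> ^ Suc n / real (Suc n)"] by simp
    then show "(?\<phi> has_vector_derivative C * \<bar>t\<bar> ^ Suc n * r ^ n) (at r)"
      by (simp add: has_real_derivative_iff_has_vector_derivative mult.assoc del: of_nat_Suc power_Suc)
    have "norm (t *\<^sub>R f' (r * t)) \<le> \<bar>t\<bar> * (C * \<bar>r * t\<bar> ^ n)"
      using b[OF in_T[of r]] r by (auto intro!: mult_left_mono)
    then show "norm (t *\<^sub>R f' (r * t)) \<le> C * \<bar>t\<bar> ^ Suc n * r ^ n"
      using r by (simp add: abs_mult power_mult_distrib mult_ac)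
  qed auto
  then show ?thesis using assms(4) by simp
qed

text \<open>The terms of the series, that is the iterated integrals, and not the successive
  approximations; those are the partial sums.\<close>

primrec picard :: "(real \<Rightarrow> mat2) \<Rightarrow> nat \<Rightarrow> real \<Rightarrow> mat2" where
  "picard M 0 = (\<lambda>t. mat 1)"
| "picard M (Suc n) = antiderivative (\<lambda>t. M t ** picard M n t)"

lemma picard_deriv:
  assumes "\<And>t. isCont M t"
  shows "(picard M n has_vector_derivative (case n of 0 \<Rightarrow> 0 | Suc m \<Rightarrow> M t ** picard M m t)) (at t)"
proof (induction n arbitrary: t)
  case 0
  then show ?case by simp
next
  case (Suc n)
  have "isCont (\<lambda>t. M t ** picard M n t) t" for t
    using bounded_bilinear.continuous[OF bounded_bilinear_mat2 assms[of t]
        has_vector_derivative_continuous[OF Suc[of t]]] by simp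
  from antiderivative(2)[of "\<lambda>t. M t ** picard M n t", OF this] show ?case by simp
qed

lemma picard_Suc_0:
  assumes "\<And>t. isCont M t"
  shows "picard M (Suc n) 0 = 0"
proof -
  have "isCont (\<lambda>t. M t ** picard M n t) t" for t
    using bounded_bilinear.continuous[OF bounded_bilinear_mat2 assms[of t]
        has_vector_derivative_continuous[OF picard_deriv[OF assms]]] by simp
  then show ?thesis by (simp add: antiderivative(1))
qed

text \<open>On every bounded interval the terms are dominated by those of an exponential series, so
  the sum exists for all times and may be differentiated term by term.\<close>

lemma linear_ode_exists:
  assumes M: "\<And>t. isCont M t"
  obtains y :: "real \<Rightarrow> mat2" where "y 0 = mat 1" "\<And>t. (y has_vector_derivative M t ** y t) (at t)"
proof -
  obtain B where B: "B > 0" "\<And>(X::mat2) (Y::mat2). norm (X ** Y) \<le> norm X * norm Y * B"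
    using mat2_norm_mult_bound by auto
  define y where "y = (\<lambda>t. suminf (\<lambda>n. picard M n t))"
  have "y 0 = (\<Sum>n\<in>{0}. picard M n 0)" unfolding y_def
  proof (rule suminf_finite)
    show "picard M n 0 = 0" if "n \<notin> {0}" for n
      using that picard_Suc_0[OF M] by (cases n) (auto simp del: picard.simps)
  qed auto
  then have y0: "y 0 = mat 1" by simp
  have "(y has_vector_derivative M t0 ** y t0) (at t0)" for t0
  proof -
    \<comment> \<open>The added 1 makes \<open>t0\<close> an interior point, so that derivatives
      within the interval are full derivatives at \<open>t0\<close>.\<close>
    define T where "T = \<bar>t0\<bar> + 1"
    have "compact {-T..T}" "continuous_on {-T..T} M"
      using M by (auto intro: continuous_at_imp_continuous_on)
    then have "bounded (M ` {-T..T})" using compact_continuous_image compact_imp_bounded by blast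
    then obtain L where "L > 0" "\<forall>t\<in>{-T..T}. norm (M t) \<le> L" unfolding bounded_pos by auto
    then have L: "\<And>t. \<bar>t\<bar> \<le> T \<Longrightarrow> norm (M t) \<le> L" "L > 0" by (auto simp: abs_le_iff)
    define K where "K = L * B"
    have K: "K > 0" using L B by (simp add: K_def)
    have MK: "norm (M t ** X) \<le> K * norm X" if "\<bar>t\<bar> \<le> T" for t and X :: mat2
    proof -
      have "norm (M t ** X) \<le> norm (M t) * norm X * B" by (rule B)
      also have "\<dots> \<le> L * norm X * B" using L(1)[OF that] B(1) by (intro mult_right_mono) auto
      finally show "norm (M t ** X) \<le> K * norm X" by (simp add: K_def mult_ac)
    qed
    define c where "c = norm (mat 1 :: mat2)"
    have c: "c \<ge> 0" by (simp add: c_def)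
    have bound: "norm (picard M n t) \<le> c * K ^ n / fact n * \<bar>t\<bar> ^ n" if "\<bar>t\<bar> \<le> T" for n t
      using that
    proof (induction n arbitrary: t)
      case 0
      then show ?case by (simp add: c_def)
    next
      case (Suc n)
      have "norm (picard M (Suc n) t) \<le> (c * K ^ Suc n / fact n) * \<bar>t\<bar> ^ Suc n / real (Suc n)"
      proof (rule power_bound_integrate[where f="picard M (Suc n)" and f'="\<lambda>s. M s ** picard M n s"])
        show "picard M (Suc n) 0 = 0" by (rule picard_Suc_0[OF M])
        show "(picard M (Suc n) has_vector_derivative M s ** picard M n s) (at s)" for s
          using picard_deriv[OF M, of "Suc n" s] by simp
        fix s assume s: "\<bar>s\<bar> \<le> T"
        have "norm (M s ** picard M n s) \<le> K * (c * K ^ n / fact n * \<bar>s\<bar> ^ n)"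
          using MK[OF s] Suc.IH[OF s] K by (meson mult_left_mono less_imp_le order_trans)
        then show "norm (M s ** picard M n s) \<le> c * K ^ Suc n / fact n * \<bar>s\<bar> ^ n"
          by (simp add: mult_ac)
      qed (rule Suc.prems)
      also have "\<dots> = c * K ^ Suc n / fact (Suc n) * \<bar>t\<bar> ^ Suc n"
        by (simp add: field_simps del: of_nat_Suc)
      finally show ?case .
    qed
    have T: "T > 0" by (simp add: T_def)
    have bound': "norm (picard M n t) \<le> c * ((K * T) ^ n / fact n)" if "t \<in> {-T..T}" for n t
    proof -
      have t: "\<bar>t\<bar> \<le> T" using that by auto
      have "c * K ^ n / fact n * \<bar>t\<bar> ^ n \<le> c * K ^ n / fact n * T ^ n"
        using t c K by (intro mult_left_mono power_mono) auto
      then show ?thesis using bound[OF t, of n] by (simp add: power_mult_distrib mult_ac)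
    qed
    have summ: "summable (\<lambda>n. c * ((K * T) ^ n / fact n))"
      by (intro summable_mult) (use summable_exp[of "K * T"] in \<open>simp add: divide_inverse mult.commute\<close>)
    have unif: "uniform_limit {-T..T} (\<lambda>n t. \<Sum>i<n. picard M i t) y sequentially"
      unfolding y_def by (rule Weierstrass_m_test[OF bound' summ])
    have "\<exists>g. \<forall>t\<in>{-T..T}. (\<lambda>n. picard M n t) sums (g t) \<and>
        (g has_derivative (\<lambda>h. h *\<^sub>R (M t ** y t))) (at t within {-T..T})"
    proof (rule has_derivative_series[where x=0 and l="y 0"
          and f'="\<lambda>n t h. h *\<^sub>R (case n of 0 \<Rightarrow> 0 | Suc m \<Rightarrow> M t ** picard M m t)"])
      show "(picard M n has_derivative (\<lambda>h. h *\<^sub>R (case n of 0 \<Rightarrow> 0 | Suc m \<Rightarrow> M t ** picard M m t)))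
          (at t within {-T..T})" for n t
        using picard_deriv[OF M, of n t] by (simp add: has_vector_derivative_def has_derivative_at_withinI)
      show "(\<lambda>n. picard M n 0) sums y 0"
        using summable_comparison_test'[OF summ bound'[of 0]] T unfolding y_def by (intro summable_sums) auto
      fix e :: real assume "e > 0"
      then have "e / K > 0" using K by simp
      from uniform_limitD[OF unif this]
      have "\<forall>\<^sub>F n in sequentially. \<forall>t\<in>{-T..T}. \<forall>h. norm ((\<Sum>i<Suc n. h *\<^sub>R
          (case i of 0 \<Rightarrow> 0 | Suc m \<Rightarrow> M t ** picard M m t)) - h *\<^sub>R (M t ** y t)) \<le> e * norm h"
      proof (rule eventually_mono, intro ballI allI)
        fix n t h assume d: "\<forall>t\<in>{-T..T}. dist (\<Sum>i<n. picard M i t) (y t) < e / K" and t: "t \<in> {-T..T}"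
        \<comment> \<open>Term 0 is constant, so differentiating the first \<open>Suc n\<close>
          terms gives \<open>M t\<close> times the sum of the first \<open>n\<close> terms. The
          index shift is removed afterwards.\<close>
        have "(\<Sum>i<Suc n. h *\<^sub>R (case i of 0 \<Rightarrow> 0 | Suc m \<Rightarrow> M t ** picard M m t)) - h *\<^sub>R (M t ** y t)
            = h *\<^sub>R (M t ** ((\<Sum>i<n. picard M i t) - y t))"
          by (simp add: sum.lessThan_Suc_shift bounded_bilinear.sum_right[OF bounded_bilinear_mat2]
              matrix_distribs scaleR_diff_right scaleR_sum_right del: sum.lessThan_Suc)
        also have "norm \<dots> \<le> \<bar>h\<bar> * (K * (e / K))"
        proof -
          have "norm (M t ** ((\<Sum>i<n. picard M i t) - y t)) \<le> K * norm ((\<Sum>i<n. picard M i t) - y t)"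
            using t by (intro MK) auto
          also have "\<dots> \<le> K * (e / K)"
            using d t K by (intro mult_left_mono) (auto simp: dist_norm intro: less_imp_le)
          finally show ?thesis unfolding norm_scaleR by (intro mult_left_mono) auto
        qed
        finally show "norm ((\<Sum>i<Suc n. h *\<^sub>R (case i of 0 \<Rightarrow> 0 | Suc m \<Rightarrow> M t ** picard M m t))
            - h *\<^sub>R (M t ** y t)) \<le> e * norm h" using K by (simp add: mult.commute)
      qed
      then show "\<forall>\<^sub>F n in sequentially. \<forall>t\<in>{-T..T}. \<forall>h. norm ((\<Sum>i<n. h *\<^sub>R
          (case i of 0 \<Rightarrow> 0 | Suc m \<Rightarrow> M t ** picard M m t)) - h *\<^sub>R (M t ** y t)) \<le> e * norm h"
        by (subst eventually_sequentially_Suc[symmetric])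
    qed (use T in auto)
    then obtain g where g: "\<And>t. t \<in> {-T..T} \<Longrightarrow> (\<lambda>n. picard M n t) sums (g t)"
      "\<And>t. t \<in> {-T..T} \<Longrightarrow> (g has_derivative (\<lambda>h. h *\<^sub>R (M t ** y t))) (at t within {-T..T})" by blast
    have gy: "g t = y t" if "t \<in> {-T..T}" for t using sums_unique[OF g(1)[OF that]] by (simp add: y_def)
    have t0: "t0 \<in> {-T<..<T}" by (auto simp: T_def)
    then have "at t0 within {-T..T} = at t0" by (intro at_within_interior) auto
    then have "(g has_vector_derivative M t0 ** y t0) (at t0)"
      using g(2)[of t0] t0 by (simp add: has_vector_derivative_def)
    then show ?thesis
      by (rule has_vector_derivative_transform_within_open[where S="{-T<..<T}"]) (use t0 gy in auto)
  qed
  with y0 that show thesis by blast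
qed

text \<open>For antihermitian coefficients the two contributions of \<open>M t\<close> to the
  derivative of the product cancel. With \<open>z = y\<close> this gives unitarity, with two
  solutions it gives uniqueness; no Lipschitz argument is involved.\<close>

lemma ode_pair_const:
  assumes S: "convex S" "s \<in> S" "t \<in> S"
    and y: "\<And>t. t \<in> S \<Longrightarrow> (y has_vector_derivative M t ** y t) (at t within S)"
    and z: "\<And>t. t \<in> S \<Longrightarrow> (z has_vector_derivative M t ** z t) (at t within S)"
    and M: "\<And>t. t \<in> S \<Longrightarrow> ct (M t) = - M t"
  shows "ct (y t) ** z t = ct (y s) ** (z s :: mat2)"
proof (rule has_derivative_zero_unique[OF S(1) _ S(3,2)])
  fix t assume t: "t \<in> S"
  have "((\<lambda>t. ct (y t)) has_vector_derivative ct (M t ** y t)) (at t within S)"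
    by (rule bounded_linear.has_vector_derivative[OF bounded_linear_ct y[OF t]])
  from bounded_bilinear.has_vector_derivative[OF bounded_bilinear_mat2 this z[OF t]]
  have "((\<lambda>t. ct (y t) ** z t) has_vector_derivative 0) (at t within S)"
    by (simp add: ct_mult M[OF t] matrix_mul_assoc)
  then show "((\<lambda>t. ct (y t) ** z t) has_derivative (\<lambda>h. 0)) (at t within S)"
    by (simp add: has_vector_derivative_def)
qed

lemma ode_unitary:
  assumes "convex S" "0 \<in> S" "t \<in> S" "y 0 = mat 1"
    and "\<And>t. t \<in> S \<Longrightarrow> (y has_vector_derivative M t ** y t) (at t within S)"
    and "\<And>t. t \<in> S \<Longrightarrow> ct (M t) = - M t"
  shows "ct (y t) ** y t = mat 1"
  using ode_pair_const[OF assms(1-3,5,5,6)] by (simp add: assms(4))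

lemma ode_unique:
  assumes "convex S" "0 \<in> S" "t \<in> S" "y 0 = mat 1" "z 0 = mat 1"
    and y: "\<And>t. t \<in> S \<Longrightarrow> (y has_vector_derivative M t ** y t) (at t within S)"
    and z: "\<And>t. t \<in> S \<Longrightarrow> (z has_vector_derivative M t ** z t) (at t within S)"
    and M: "\<And>t. t \<in> S \<Longrightarrow> ct (M t) = - M t"
  shows "z t = (y t :: mat2)"
proof -
  have u: "ct (y t) ** y t = mat 1" by (rule ode_unitary[OF assms(1-4) y M])
  have "y t ** (ct (y t) ** z t) = y t ** mat 1"
    using ode_pair_const[OF assms(1-3) y z M] by (simp add: assms(4,5))
  then show ?thesis by (simp add: unitary_cancel[OF u])
qed

lemma vector_derivative_bound:
  fixes f :: "real \<Rightarrow> 'a::real_normed_vector"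
  assumes "\<And>t. t \<in> {0..1} \<Longrightarrow> (f has_vector_derivative f' t) (at t within {0..1})"
    "\<And>t. t \<in> {0..1} \<Longrightarrow> norm (f' t) \<le> B" "r \<in> {0..1}"
  shows "norm (f r - f 0) \<le> B"
proof -
  have "B \<ge> 0" using assms(2)[of 0] norm_ge_zero[of "f' 0"] by (simp del: norm_ge_zero)
  have "norm (f r - f 0) \<le> B * norm (r - 0)"
  proof (rule differentiable_bound[where S="{0..1}" and f'="\<lambda>t h. h *\<^sub>R f' t"])
    show "onorm (\<lambda>h. h *\<^sub>R f' t) \<le> B" if "t \<in> {0..1}" for t
      by (rule onorm_le) (use assms(2)[OF that] in \<open>simp add: mult.commute[of B] mult_left_mono\<close>)
  qed (use assms in \<open>auto simp: has_vector_derivative_def\<close>)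
  also have "\<dots> \<le> B * 1" using assms(3) \<open>B \<ge> 0\<close> by (intro mult_left_mono) auto
  finally show ?thesis by simp
qed

text \<open>Differentiability in the parameter needs no Gronwall estimate: unitary solutions are isometries,
  so variation of constants bounds the error by the error in the coefficients.\<close>

lemma ode_parameter_derivative:
  fixes P M N Z :: "'v::euclidean_space \<Rightarrow> real \<Rightarrow> mat2"
  assumes "\<delta> > 0" and init: "\<And>v. P v 0 = mat 1"
    and sol: "\<And>v r. norm v < \<delta> \<Longrightarrow> r \<in> {0..1} \<Longrightarrow> (P v has_vector_derivative M v r ** P v r) (at r within {0..1})"
    and skew: "\<And>v r. norm v < \<delta> \<Longrightarrow> r \<in> {0..1} \<Longrightarrow> ct (M v r) = - M v r"
    and approx: "\<And>e. e > 0 \<Longrightarrow> \<exists>d>0. \<forall>v r. norm v < d \<longrightarrow> r \<in> {0..1} \<longrightarrow>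
        norm (M v r - M 0 r - N v r) \<le> e * norm v"
    and linN: "\<And>r. r \<in> {0..1} \<Longrightarrow> linear (\<lambda>v. N v r)"
    and contN: "\<And>v. continuous_on {0..1} (N v)"
    and Z: "\<And>v r. r \<in> {0..1} \<Longrightarrow> (Z v has_vector_derivative ct (P 0 r) ** N v r ** P 0 r) (at r within {0..1})"
    and Z0: "\<And>v. Z v 0 = 0" and linZ: "linear (\<lambda>v. Z v 1)"
  shows "((\<lambda>v. P v 1) has_derivative (\<lambda>v. P 0 1 ** Z v 1)) (at 0)"
proof -
  obtain B where B: "B > 0" "\<And>(X::mat2) (Y::mat2). norm (X ** Y) \<le> norm X * norm Y * B"
    using mat2_norm_mult_bound by auto
  have uni: "ct (P v r) ** P v r = mat 1" if "norm v < \<delta>" "r \<in> {0..1}" for v r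
    by (rule ode_unitary[OF _ _ that(2) init sol[OF that(1)] skew[OF that(1)]]) auto
  have "\<exists>c. \<forall>r\<in>{0..1}. norm (N b r) \<le> c" for b
    using compact_imp_bounded[OF compact_continuous_image[OF contN[of b] compact_Icc]]
    unfolding bounded_iff by auto
  then obtain c where c: "\<And>b r. r \<in> {0..1} \<Longrightarrow> norm (N b r) \<le> c b" by metis
  define C where "C = (\<Sum>b\<in>(Basis::'v set). c b)"
  have C: "norm (N v r) \<le> C * norm v" if r: "r \<in> {0..1}" for v r
  proof -
    have "N v r = (\<Sum>b\<in>Basis. (v \<bullet> b) *\<^sub>R N b r)"
      using linear_sum[OF linN[OF r], of "\<lambda>b. (v \<bullet> b) *\<^sub>R b" Basis]
      by (simp add: euclidean_representation linear_scale[OF linN[OF r]])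
    also have "norm \<dots> \<le> (\<Sum>b\<in>(Basis::'v set). norm v * c b)"
    proof (rule sum_norm_le)
      fix b :: 'v assume "b \<in> Basis"
      from Basis_le_norm[OF this, of v] c[OF r, of b]
      show "norm ((v \<bullet> b) *\<^sub>R N b r) \<le> norm v * c b"
        unfolding norm_scaleR by (intro mult_mono) auto
    qed
    finally show ?thesis by (simp add: C_def sum_distrib_left mult.commute)
  qed
  have "C \<ge> 0" unfolding C_def using order_trans[OF norm_ge_zero c[of 0]] by (intro sum_nonneg) auto
  have z: "norm (0::'v) < \<delta>" using \<open>\<delta> > 0\<close> by simp
  obtain d1 where d1: "d1 > 0" "\<And>v r. norm v < d1 \<Longrightarrow> r \<in> {0..1} \<Longrightarrow>
        norm (M v r - M 0 r - N v r) \<le> 1 * norm v" using approx[of 1] by force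
  have ctP: "((\<lambda>r. ct (P 0 r)) has_vector_derivative ct (M 0 r ** P 0 r)) (at r within {0..1})"
    if "r \<in> {0..1}" for r
    by (rule bounded_linear.has_vector_derivative[OF bounded_linear_ct sol[OF z that]])
  \<comment> \<open>Variation of constants: seen from the unperturbed solution, only the difference
    of the coefficients drives the perturbed one.\<close>
  have prod: "((\<lambda>r. ct (P 0 r) ** P v r) has_vector_derivative ct (P 0 r) ** (M v r - M 0 r) ** P v r)
      (at r within {0..1})" if "norm v < \<delta>" "r \<in> {0..1}" for v r
    using bounded_bilinear.has_vector_derivative[OF bounded_bilinear_mat2 ctP[OF that(2)] sol[OF that]]
    by (simp add: ct_mult skew[OF z that(2)] matrix_mul_assoc matrix_distribs)
  have close: "norm (P v r - P 0 r) \<le> (1 + C) * norm v" if v: "norm v < \<delta>" "norm v < d1" and r: "r \<in> {0..1}" for v r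
  proof -
    have "norm (ct (P 0 r) ** P v r - ct (P 0 0) ** P v 0) \<le> (1 + C) * norm v"
    proof (rule vector_derivative_bound[OF prod[OF v(1)] _ r])
      fix t :: real assume t: "t \<in> {0..1}"
      have "norm (ct (P 0 t) ** (M v t - M 0 t) ** P v t) = norm (M v t - M 0 t)"
        using norm_unitary_right[OF uni[OF v(1) t]] norm_unitary_left[of "ct (P 0 t)"] unitary_cancel(1)[OF uni[OF z t]]
        by (simp flip: matrix_mul_assoc)
      also have "\<dots> \<le> norm (M v t - M 0 t - N v t) + norm (N v t)"
        by (metis add.commute diff_add_cancel norm_triangle_ineq)
      also have "\<dots> \<le> 1 * norm v + C * norm v" using d1(2)[OF v(2) t] C[OF t] by (intro add_mono)
      finally show "norm (ct (P 0 t) ** (M v t - M 0 t) ** P v t) \<le> (1 + C) * norm v"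
        by (simp add: algebra_simps)
    qed
    moreover have "P 0 r ** (ct (P 0 r) ** P v r - ct (P 0 0) ** P v 0) = P v r - P 0 r"
      by (simp add: init matrix_distribs unitary_cancel[OF uni[OF z r]])
    ultimately show ?thesis using norm_unitary_left[OF uni[OF z r]] by metis
  qed
  show ?thesis
    unfolding has_derivative_within_alt
  proof (intro conjI allI impI)
    have "linear (\<lambda>v. P 0 1 ** Z v 1)"
      using linear_compose[OF linZ bounded_linear.linear[OF
        bounded_bilinear.bounded_linear_right[OF bounded_bilinear_mat2, of "P 0 1"]]] by (simp add: o_def)
    then show "bounded_linear (\<lambda>v. P 0 1 ** Z v 1)" by (rule linear_conv_bounded_linear[THEN iffD1])
    fix e :: real assume "e > 0"
    obtain d2 where d2: "d2 > 0" "\<And>v r. norm v < d2 \<Longrightarrow> r \<in> {0..1} \<Longrightarrow>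
        norm (M v r - M 0 r - N v r) \<le> (e / 2) * norm v" using approx[of "e / 2"] \<open>e > 0\<close> by force
    \<comment> \<open>The error that remains after the linear approximation of the coefficients is
      quadratic in \<open>v\<close> with constant \<open>C * (1 + C) * B\<close>; adding 1 makes the
      bound positive, so that \<open>e / (2 * Q)\<close> is a legitimate radius.\<close>
    define Q where "Q = C * (1 + C) * B + 1"
    have Q: "Q > 0" using \<open>C \<ge> 0\<close> B(1) by (auto simp: Q_def intro!: add_nonneg_pos)
    define d where "d = min (min \<delta> d1) (min d2 (e / (2 * Q)))"
    have "d > 0" using \<open>\<delta> > 0\<close> d1 d2 \<open>e > 0\<close> Q by (auto simp: d_def)
    moreover have "norm (P v 1 - P 0 1 - P 0 1 ** Z (v - 0) 1) \<le> e * norm (v - 0)"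
      if "norm (v - 0) < d" for v
    proof -
      have v: "norm v < \<delta>" "norm v < d1" "norm v < d2" "norm v \<le> e / (2 * Q)"
        using that by (auto simp: d_def)
      \<comment> \<open>The perturbed solution in the unperturbed frame minus the candidate
        \<open>Z\<close> for its first variation. Multiplication by the unitary \<open>P 0 1\<close>
        brings the estimate back to \<open>P v 1\<close> without loss.\<close>
      let ?k = "\<lambda>r. ct (P 0 r) ** P v r - Z v r"
      have "norm (?k 1 - ?k 0) \<le> e * norm v"
      proof (rule vector_derivative_bound)
        fix t :: real assume t: "t \<in> {0..1}"
        show "(?k has_vector_derivative ct (P 0 t) ** (M v t - M 0 t) ** P v t - ct (P 0 t) ** N v t ** P 0 t)
            (at t within {0..1})"
          by (rule has_vector_derivative_diff[OF prod[OF v(1) t] Z[OF t]])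
        have "ct (P 0 t) ** (M v t - M 0 t) ** P v t - ct (P 0 t) ** N v t ** P 0 t
            = ct (P 0 t) ** ((M v t - M 0 t - N v t) ** P v t + N v t ** (P v t - P 0 t))"
          by (simp add: matrix_distribs matrix_mul_assoc)
        then have "norm (ct (P 0 t) ** (M v t - M 0 t) ** P v t - ct (P 0 t) ** N v t ** P 0 t)
            = norm ((M v t - M 0 t - N v t) ** P v t + N v t ** (P v t - P 0 t))"
          using norm_unitary_left[of "ct (P 0 t)"] unitary_cancel(1)[OF uni[OF z t]] by simp
        also have "\<dots> \<le> norm (M v t - M 0 t - N v t) + norm (N v t ** (P v t - P 0 t))"
          using norm_triangle_ineq[of "(M v t - M 0 t - N v t) ** P v t" "N v t ** (P v t - P 0 t)"]
          by (simp add: norm_unitary_right[OF uni[OF v(1) t]])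
        also have "\<dots> \<le> (e / 2) * norm v + (C * norm v) * ((1 + C) * norm v) * B"
        proof (rule add_mono[OF d2(2)[OF v(3) t]])
          have "norm (N v t ** (P v t - P 0 t)) \<le> norm (N v t) * norm (P v t - P 0 t) * B" by (rule B)
          also have "\<dots> \<le> (C * norm v) * ((1 + C) * norm v) * B"
            using C[OF t, of v] close[OF v(1,2) t] B(1) \<open>C \<ge> 0\<close> by (intro mult_right_mono mult_mono) auto
          finally show "norm (N v t ** (P v t - P 0 t)) \<le> (C * norm v) * ((1 + C) * norm v) * B" .
        qed
        also have "(C * norm v) * ((1 + C) * norm v) * B \<le> (e / 2) * norm v"
        proof -
          have "C * (1 + C) * B * norm v \<le> Q * norm v" by (intro mult_right_mono) (auto simp: Q_def)
          also have "\<dots> \<le> Q * (e / (2 * Q))" using v(4) Q by (intro mult_left_mono) auto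
          also have "\<dots> = e / 2" using Q by simp
          finally have "C * (1 + C) * B * norm v * norm v \<le> (e / 2) * norm v" by (intro mult_right_mono) auto
          then show ?thesis by (simp add: mult_ac)
        qed
        finally show "norm (ct (P 0 t) ** (M v t - M 0 t) ** P v t - ct (P 0 t) ** N v t ** P 0 t) \<le> e * norm v"
          by (simp add: algebra_simps)
      qed auto
      moreover have "P 0 1 ** (?k 1 - ?k 0) = P v 1 - P 0 1 - P 0 1 ** Z v 1"
        by (simp add: init Z0 matrix_distribs unitary_cancel[OF uni[OF z]])
      ultimately show ?thesis using norm_unitary_left[OF uni[OF z, of 1], of "?k 1 - ?k 0"] by simp
    qed
    ultimately show "\<exists>d>0. \<forall>v\<in>UNIV. norm (v - 0) < d \<longrightarrow>
        norm (P v 1 - P 0 1 - P 0 1 ** Z (v - 0) 1) \<le> e * norm (v - 0)" by blast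
  qed
qed

section \<open>Parallel frames of flat connections\<close>

text \<open>Turns a form, given as a linear map at each point, into one smooth function of point and
  vector together. This is what the chain rule needs when both vary: for pull-backs, where the
  vector is a derivative of the parametrization, and for rays whose end point is moved.\<close>

lemma smooth_on_combination:
  fixes a :: "'e::euclidean_space \<Rightarrow> 'e \<Rightarrow> 'b::real_normed_vector"
  assumes D: "open D" and lin: "\<And>x. x \<in> D \<Longrightarrow> linear (a x)" and sm: "\<And>v. smooth_on D (\<lambda>x. a x v)"
  defines "F \<equiv> \<lambda>p. \<Sum>b\<in>Basis. (snd p \<bullet> b) *\<^sub>R a (fst p) b"
  shows "smooth_on (D \<times> UNIV) F"
    and "y \<in> D \<Longrightarrow> F (y, w) = a y w"
    and "y \<in> D \<Longrightarrow> frechet_derivative F (at (y, w)) (z1, z2)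
        = frechet_derivative (\<lambda>x. a x w) (at y) z1 + a y z2"
proof -
  have o: "open (D \<times> (UNIV :: 'e set))" using D by (intro open_Times) auto
  have rep: "(\<Sum>b\<in>Basis. (w \<bullet> b) *\<^sub>R a y b) = a y w" if "y \<in> D" for y w
    using linear_sum[OF lin[OF that], of "\<lambda>b. (w \<bullet> b) *\<^sub>R b" Basis]
    by (simp add: euclidean_representation linear_scale[OF lin[OF that]])
  then show "y \<in> D \<Longrightarrow> F (y, w) = a y w" by (simp add: F_def)
  show "smooth_on (D \<times> UNIV) F" unfolding F_def
    by (intro smooth_on_sum smooth_on_scaleR o smooth_on_linear[OF o bounded_linear_inner_left]
        smooth_on_snd smooth_on_id smooth_on_compose[OF o D _ sm] smooth_on_fst) auto
  assume y: "y \<in> D"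
  have der: "((\<lambda>x. a x v) has_derivative frechet_derivative (\<lambda>x. a x v) (at y)) (at y)" for v
    by (rule smooth_on_has_derivative[OF D sm y])
  have "(F has_derivative (\<lambda>z. \<Sum>b\<in>Basis. (w \<bullet> b) *\<^sub>R frechet_derivative (\<lambda>x. a x b) (at y) (fst z)
      + (snd z \<bullet> b) *\<^sub>R a y b)) (at (y, w))"
    unfolding F_def
  proof (rule has_derivative_sum)
    fix b :: 'e
    have "((\<lambda>p. a (fst p) b) has_derivative (\<lambda>z. frechet_derivative (\<lambda>x. a x b) (at y) (fst z))) (at (y, w))"
      using diff_chain_at[OF has_derivative_fst[OF has_derivative_ident], of "\<lambda>x. a x b" _ "(y, w)"] der[of b]
      by (simp add: o_def)
    from has_derivative_scaleR[OF has_derivative_inner_left[OF has_derivative_snd[OF has_derivative_ident]] this]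
    show "((\<lambda>p. (snd p \<bullet> b) *\<^sub>R a (fst p) b) has_derivative
       (\<lambda>z. (w \<bullet> b) *\<^sub>R frechet_derivative (\<lambda>x. a x b) (at y) (fst z) + (snd z \<bullet> b) *\<^sub>R a y b)) (at (y, w))"
      by simp
  qed
  note 1 = frechet_derivative_at[OF this, symmetric]
  have "((\<lambda>x. \<Sum>b\<in>Basis. (w \<bullet> b) *\<^sub>R a x b) has_derivative
      (\<lambda>z. \<Sum>b\<in>Basis. (w \<bullet> b) *\<^sub>R frechet_derivative (\<lambda>x. a x b) (at y) z)) (at y)"
    by (intro has_derivative_sum has_derivative_scaleR_right der)
  then have "((\<lambda>x. a x w) has_derivative
      (\<lambda>z. \<Sum>b\<in>Basis. (w \<bullet> b) *\<^sub>R frechet_derivative (\<lambda>x. a x b) (at y) z)) (at y)"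
    by (rule has_derivative_transform_within_open[OF _ D y]) (simp add: rep)
  note 2 = frechet_derivative_at[OF this, symmetric]
  show "frechet_derivative F (at (y, w)) (z1, z2) = frechet_derivative (\<lambda>x. a x w) (at y) z1 + a y z2"
    unfolding 1 2 by (simp add: sum.distrib rep[OF y])
qed

text \<open>The frame at \<open>x\<close> is the parallel transport along the ray from the origin to \<open>x\<close>.\<close>

lemma flat_parallel_frame:
  fixes a :: "'e::euclidean_space \<Rightarrow> 'e \<Rightarrow> mat2"
  assumes D: "open D" "0 \<in> D" and star: "\<And>x r. x \<in> D \<Longrightarrow> r \<in> {0..1} \<Longrightarrow> r *\<^sub>R x \<in> D"
    and lin: "\<And>x. x \<in> D \<Longrightarrow> linear (a x)" and sm: "\<And>v. smooth_on D (\<lambda>x. a x v)"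
    and skew: "\<And>x v. x \<in> D \<Longrightarrow> ct (a x v) = - a x v"
    and flat: "\<And>x v w. x \<in> D \<Longrightarrow> frechet_derivative (\<lambda>x. a x w) (at x) v
        - frechet_derivative (\<lambda>x. a x v) (at x) w = bracket (a x v) (a x w)"
  obtains \<phi> where "\<phi> 0 = mat 1" "\<And>x. x \<in> D \<Longrightarrow> (\<phi> has_derivative (\<lambda>v. a x v ** \<phi> x)) (at x)"
    "\<And>x. x \<in> D \<Longrightarrow> ct (\<phi> x) ** \<phi> x = mat 1"
proof -
  \<comment> \<open>Clamping the time to the unit interval makes the coefficient continuous on the
    whole line, as the existence lemma demands, although the ray may leave \<open>D\<close> beyond
    its end points.\<close>
  define cl :: "real \<Rightarrow> real" where "cl = (\<lambda>r. max 0 (min 1 r))"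
  have cl: "cl r \<in> {0..1}" "r \<in> {0..1} \<Longrightarrow> cl r = r" for r by (auto simp: cl_def)
  have acont: "continuous_on D (\<lambda>y. a y v)" for v by (rule smooth_on_continuous_on[OF D(1) sm])
  have "\<exists>y. y 0 = mat 1 \<and> (\<forall>r\<in>{0..1}. (y has_vector_derivative a (r *\<^sub>R x) x ** y r) (at r within {0..1}))"
    if x: "x \<in> D" for x
  proof -
    have "continuous_on UNIV (\<lambda>r. a (cl r *\<^sub>R x) x)"
      by (rule continuous_on_compose2[OF acont]) (use star[OF x] cl in \<open>auto simp: cl_def intro!: continuous_intros\<close>)
    then have "isCont (\<lambda>r. a (cl r *\<^sub>R x) x) r" for r by (simp add: continuous_on_eq_continuous_at)
    from linear_ode_exists[OF this] obtain y where
      y: "y 0 = mat 1" "\<And>r. (y has_vector_derivative a (cl r *\<^sub>R x) x ** y r) (at r)" by blast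
    have "(y has_vector_derivative a (r *\<^sub>R x) x ** y r) (at r within {0..1})" if "r \<in> {0..1}" for r
      using has_vector_derivative_at_within[OF y(2)[of r]] cl(2)[OF that] by simp
    with y(1) show ?thesis by blast
  qed
  then have "\<forall>x. \<exists>y. x \<in> D \<longrightarrow> y 0 = mat 1 \<and>
      (\<forall>r\<in>{0..1}. (y has_vector_derivative a (r *\<^sub>R x) x ** y r) (at r within {0..1}))" by blast
  then obtain Y where Y: "\<And>x. x \<in> D \<Longrightarrow> Y x 0 = mat 1"
    "\<And>x r. x \<in> D \<Longrightarrow> r \<in> {0..1} \<Longrightarrow> (Y x has_vector_derivative a (r *\<^sub>R x) x ** Y x r) (at r within {0..1})"
    unfolding choice_iff by blast
  define \<phi> where "\<phi> = (\<lambda>x. Y x 1)"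
  have uni: "ct (Y x r) ** Y x r = mat 1" if x: "x \<in> D" and r: "r \<in> {0..1}" for x r
    by (rule ode_unitary[where S="{0..1}" and y="Y x" and M="\<lambda>r. a (r *\<^sub>R x) x"])
      (use Y x r skew star in auto)
  show thesis
  proof (rule that[of \<phi>])
    show "ct (\<phi> x) ** \<phi> x = mat 1" if "x \<in> D" for x using uni[OF that, of 1] by (simp add: \<phi>_def)
    have "Y 0 1 = mat 1"
    proof (rule ode_unique[where S="{0..1}" and y="\<lambda>r. mat 1" and z="Y 0" and M="\<lambda>r. a (r *\<^sub>R 0) 0" and t=1])
      have "a 0 0 = 0" by (rule linear_0[OF lin[OF D(2)]])
      then show "((\<lambda>r. mat 1) has_vector_derivative a (r *\<^sub>R 0) 0 ** mat 1) (at r within {0..1})" for r by simp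
      show "ct (a (r *\<^sub>R 0) 0) = - a (r *\<^sub>R 0) 0" for r using skew D(2) by simp
      show "(Y 0 has_vector_derivative a (r *\<^sub>R 0) 0 ** Y 0 r) (at r within {0..1})" if "r \<in> {0..1}" for r
        by (rule Y(2)[OF D(2) that])
    qed (use Y D in auto)
    then show "\<phi> 0 = mat 1" by (simp add: \<phi>_def)
    fix x assume x: "x \<in> D"
    obtain \<delta> where \<delta>: "\<delta> > 0" "ball x \<delta> \<subseteq> D" using D(1) x open_contains_ball by blast
    have near: "x + v \<in> D" if "norm v < \<delta>" for v using \<delta>(2) that by (auto simp: subset_iff dist_norm)
    have ray: "r *\<^sub>R x \<in> D" if "r \<in> {0..1}" for r by (rule star[OF x that])
    define F where "F = (\<lambda>p. \<Sum>b\<in>Basis. (snd p \<bullet> b) *\<^sub>R a (fst p) b)"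
    have F: "smooth_on (D \<times> UNIV) F" "\<And>y v. y \<in> D \<Longrightarrow> F (y, v) = a y v"
      "\<And>y v z1 z2. y \<in> D \<Longrightarrow> frechet_derivative F (at (y, v)) (z1, z2)
        = frechet_derivative (\<lambda>x. a x v) (at y) z1 + a y z2"
      unfolding F_def by (rule smooth_on_combination(1-3)[OF D(1)], rule lin, assumption, rule sm, assumption?)+
    have oD: "open (D \<times> (UNIV :: 'e set))" using D by (intro open_Times) auto
    \<comment> \<open>Outside the ball of radius \<delta> the vector \<open>x + v\<close> may leave
      \<open>D\<close>; the constant value there only secures the initial condition for every
      \<open>v\<close>.\<close>
    define P where "P = (\<lambda>v r. if norm v < \<delta> then Y (x + v) r else mat 1)"
    define M where "M = (\<lambda>v r. a (r *\<^sub>R (x + v)) (x + v))"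
    define N where "N = (\<lambda>v r. frechet_derivative (\<lambda>y. a y x) (at (r *\<^sub>R x)) (r *\<^sub>R v) + a (r *\<^sub>R x) v)"
    \<comment> \<open>Moving the end point by \<open>v\<close> moves the point at time
      \<open>r\<close> by \<open>r *\<^sub>R v\<close>, which explains the factor \<open>r\<close>.
      That the transported value of the form solves the variational equation is exactly what
      flatness provides; at \<open>r = 1\<close> it yields the desired derivative.\<close>
    define Z where "Z = (\<lambda>v r. r *\<^sub>R (ct (P 0 r) ** a (r *\<^sub>R x) v ** P 0 r))"
    have P0: "P 0 r = Y x r" for r using \<delta>(1) by (simp add: P_def)
    have derx: "((\<lambda>y. a y v) has_derivative frechet_derivative (\<lambda>y. a y v) (at (r *\<^sub>R x))) (at (r *\<^sub>R x))"
      if "r \<in> {0..1}" for r v by (rule smooth_on_has_derivative[OF D(1) sm ray[OF that]])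
    have "((\<lambda>v. P v 1) has_derivative (\<lambda>v. P 0 1 ** Z v 1)) (at 0)"
    proof (rule ode_parameter_derivative[where \<delta>=\<delta> and M=M and N=N])
      show "P v 0 = mat 1" for v using near Y(1) by (simp add: P_def)
      show "(P v has_vector_derivative M v r ** P v r) (at r within {0..1})"
        if "norm v < \<delta>" "r \<in> {0..1}" for v r
        using Y(2)[OF near[OF that(1)] that(2)] that by (simp add: P_def[abs_def] M_def)
      show "ct (M v r) = - M v r" if "norm v < \<delta>" "r \<in> {0..1}" for v r
        unfolding M_def by (intro skew star near that)
      show "linear (\<lambda>v. N v r)" if "r \<in> {0..1}" for r
        unfolding N_def
        using linear_compose[OF linear_scaleR_left has_derivative_linear[OF derx[OF that]]]
          linear_compose[OF linear_scale_self has_derivative_linear[OF derx[OF that]]]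
        by (intro linear_compose_add lin ray that) (auto simp: o_def linear_iff linear_add[OF has_derivative_linear[OF derx[OF that]]] linear_scale[OF has_derivative_linear[OF derx[OF that]]] scaleR_add_right)
      have Ncont: "continuous_on {0..1} (\<lambda>r. r *\<^sub>R frechet_derivative (\<lambda>y. a y x) (at (r *\<^sub>R x)) v + a (r *\<^sub>R x) v)" for v
        by (intro continuous_intros
            continuous_on_compose2[OF smooth_on_continuous_on[OF D(1) smooth_on_deriv[OF D(1) sm]]]
            continuous_on_compose2[OF acont]) (auto intro: ray)
      show "continuous_on {0..1} (N v)" for v
        by (rule continuous_on_eq[OF Ncont[of v]])
          (simp add: N_def linear_scale[OF has_derivative_linear[OF derx]])
      show "Z v 0 = 0" for v by (simp add: Z_def)
      show "linear (\<lambda>v. Z v 1)"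
        using linear_add[OF lin[OF x]] linear_scale[OF lin[OF x]]
        by (auto simp: Z_def linear_iff matrix_distribs)
      show "(Z v has_vector_derivative ct (P 0 r) ** N v r ** P 0 r) (at r within {0..1})"
        if r: "r \<in> {0..1}" for v r
      proof -
        let ?A = "a (r *\<^sub>R x) x" and ?B = "a (r *\<^sub>R x) v" and ?y = "Y x r"
        let ?D = "frechet_derivative (\<lambda>y. a y v) (at (r *\<^sub>R x)) x"
        have y: "(Y x has_vector_derivative ?A ** ?y) (at r within {0..1})" by (rule Y(2)[OF x r])
        have cy: "((\<lambda>r. ct (Y x r)) has_vector_derivative ct (?A ** ?y)) (at r within {0..1})"
          by (rule bounded_linear.has_vector_derivative[OF bounded_linear_ct y])
        have "((\<lambda>r. a (r *\<^sub>R x) v) has_vector_derivative ?D) (at r within {0..1})"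
          using has_vector_derivative_line[of "\<lambda>y. a y v" _ 0 r x] derx[OF r, of v]
          by (simp add: has_vector_derivative_at_within)
        from bounded_bilinear.has_vector_derivative[OF bounded_bilinear_mat2
            bounded_bilinear.has_vector_derivative[OF bounded_bilinear_mat2 cy this] y]
        have "((\<lambda>r. ct (Y x r) ** a (r *\<^sub>R x) v ** Y x r) has_vector_derivative
            ct ?y ** (?D + ?B ** ?A - ?A ** ?B) ** ?y) (at r within {0..1})"
          by (simp add: ct_mult skew[OF ray[OF r]] matrix_distribs matrix_mul_assoc add_diff_eq add.commute)
        from bounded_bilinear.has_vector_derivative[OF bounded_bilinear_scaleR has_vector_derivative_id this]
        have "((\<lambda>r. r *\<^sub>R (ct (Y x r) ** a (r *\<^sub>R x) v ** Y x r)) has_vector_derivative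
            ct ?y ** (r *\<^sub>R (?D + ?B ** ?A - ?A ** ?B) + ?B) ** ?y) (at r within {0..1})"
          by (simp add: matrix_distribs)
        \<comment> \<open>Flatness trades the derivative along the ray of the form in direction
          \<open>v\<close>, corrected by the commutator, for the derivative in direction
          \<open>v\<close> of the form along the ray.\<close>
        also have "?D + ?B ** ?A - ?A ** ?B = frechet_derivative (\<lambda>y. a y x) (at (r *\<^sub>R x)) v"
          using flat[OF ray[OF r], of x v] by (simp add: bracket_def algebra_simps)
        finally show ?thesis
          by (simp add: Z_def[abs_def] N_def P0 linear_scale[OF has_derivative_linear[OF derx[OF r]]])
      qed
      fix e :: real assume "e > 0"
      \<comment> \<open>The coefficient \<open>M v r\<close> depends on \<open>v\<close> through its
        base point and through its argument, so the uniform expansion is applied to pairs of a point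
        and a vector.\<close>
      have "compact ((\<lambda>r. (r *\<^sub>R x, x)) ` {0..1})"
        by (intro compact_continuous_image continuous_intros compact_Icc)
      moreover have "(\<lambda>r. (r *\<^sub>R x, x)) ` {0..1} \<subseteq> D \<times> UNIV" using ray by auto
      ultimately obtain d where d: "d > 0"
        "\<And>p z. p \<in> (\<lambda>r. (r *\<^sub>R x, x)) ` {0..1} \<Longrightarrow> norm z < d \<Longrightarrow> p + z \<in> D \<times> UNIV"
        "\<And>p z. p \<in> (\<lambda>r. (r *\<^sub>R x, x)) ` {0..1} \<Longrightarrow> norm z < d \<Longrightarrow>
          norm (F (p + z) - F p - frechet_derivative F (at p) z) \<le> (e / 2) * norm z"
        using smooth_on_uniformly_differentiable[OF oD F(1), of _ "e / 2"] \<open>e > 0\<close> by (metis half_gt_zero)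
      \<comment> \<open>The displacement of the pair has norm at most \<open>2 * norm v\<close>,
        whence the halved radius here and the halved tolerance above.\<close>
      have "norm (M v r - M 0 r - N v r) \<le> e * norm v" if v: "norm v < d / 2" and r: "r \<in> {0..1}" for v r
      proof -
        let ?z = "(r *\<^sub>R v, v)"
        have "norm ?z \<le> norm (r *\<^sub>R v) + norm v" by (rule norm_Pair_le)
        also have "\<dots> \<le> norm v + norm v" using r by (auto intro!: mult_left_le_one_le)
        finally have z: "norm ?z \<le> 2 * norm v" by simp
        then have zd: "norm ?z < d" using v by simp
        have p: "(r *\<^sub>R x, x) \<in> (\<lambda>r. (r *\<^sub>R x, x)) ` {0..1}" using r by blast
        have "r *\<^sub>R x + r *\<^sub>R v \<in> D" using d(2)[OF p zd] by simp
        then have "M v r = F ((r *\<^sub>R x, x) + ?z)" by (simp add: M_def F(2) scaleR_add_right)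
        moreover have "M 0 r = F (r *\<^sub>R x, x)" by (simp add: M_def F(2) ray[OF r])
        moreover have "N v r = frechet_derivative F (at (r *\<^sub>R x, x)) ?z" by (simp add: N_def F(3) ray[OF r])
        ultimately have "norm (M v r - M 0 r - N v r) \<le> (e / 2) * norm ?z" using d(3)[OF p zd] by simp
        also have "\<dots> \<le> (e / 2) * (2 * norm v)" using z \<open>e > 0\<close> by (intro mult_left_mono) auto
        finally show ?thesis by simp
      qed
      with d(1) show "\<exists>d>0. \<forall>v r. norm v < d \<longrightarrow> r \<in> {0..1} \<longrightarrow> norm (M v r - M 0 r - N v r) \<le> e * norm v"
        by (intro exI[of _ "d / 2"]) auto
    qed (rule \<delta>)
    also have "(\<lambda>v. P 0 1 ** Z v 1) = (\<lambda>v. a x v ** \<phi> x)"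
      using unitary_cancel[OF uni[OF x, of 1]] by (simp add: Z_def P0 \<phi>_def matrix_mul_assoc)
    finally have "((\<lambda>v. \<phi> (x + v)) has_derivative (\<lambda>v. a x v ** \<phi> x)) (at 0)"
      by (rule has_derivative_transform_within_open[OF _ open_ball[of 0 \<delta>]])
        (use \<delta>(1) in \<open>auto simp: P_def \<phi>_def\<close>)
    moreover have "((\<lambda>y. y - x) has_derivative (\<lambda>h. h)) (at x)" by (auto intro!: derivative_eq_intros)
    ultimately show "(\<phi> has_derivative (\<lambda>v. a x v ** \<phi> x)) (at x)"
      using diff_chain_at[of "\<lambda>y. y - x" "\<lambda>h. h" x "\<lambda>v. \<phi> (x + v)"] by (simp add: o_def)
  qed
qed

section \<open>The cylinder in coordinates\<close>

lemma frechet_derivative_cong_open: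
  assumes "open S" "x \<in> S" "\<And>y. y \<in> S \<Longrightarrow> f y = g y"
  shows "frechet_derivative f (at x) = frechet_derivative g (at x)"
proof -
  have "(f has_derivative L) (at x) \<longleftrightarrow> (g has_derivative L) (at x)" for L
    using has_derivative_transform_within_open[OF _ assms(1,2), of f L UNIV g]
      has_derivative_transform_within_open[OF _ assms(1,2), of g L UNIV f] assms(3) by auto
  then show ?thesis by (simp add: frechet_derivative_def)
qed

lemma
  assumes "\<omega> \<in> Omega1 atl"
  shows Omega1_zero: "c \<notin> atl \<or> p \<notin> cdom c \<Longrightarrow> \<omega> c p v = 0"
    and Omega1_linear: "c \<in> atl \<Longrightarrow> p \<in> cdom c \<Longrightarrow> linear (\<omega> c p)"
    and Omega1_su2: "c \<in> atl \<Longrightarrow> p \<in> cdom c \<Longrightarrow> \<omega> c p v \<in> su2"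
    and Omega1_transition: "c \<in> atl \<Longrightarrow> d \<in> atl \<Longrightarrow> p \<in> cdom c \<Longrightarrow> p \<in> cdom d \<Longrightarrow>
      \<omega> c p v = \<omega> d p (frechet_derivative (cmap d \<circ> cinv c) (at (cmap c p)) v)"
    and Omega1_smooth: "c \<in> atl \<Longrightarrow> smooth_on (cmap c ` cdom c) (\<lambda>x. \<omega> c (cinv c x) v)"
  using assms unfolding Omega1_def by blast+

lemma Omega1I:
  assumes "\<And>c p v. c \<notin> atl \<or> p \<notin> cdom c \<Longrightarrow> \<omega> c p v = 0"
    "\<And>c p. c \<in> atl \<Longrightarrow> p \<in> cdom c \<Longrightarrow> linear (\<omega> c p)"
    "\<And>c p v. c \<in> atl \<Longrightarrow> p \<in> cdom c \<Longrightarrow> \<omega> c p v \<in> su2"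
    "\<And>c d p v. c \<in> atl \<Longrightarrow> d \<in> atl \<Longrightarrow> p \<in> cdom c \<Longrightarrow> p \<in> cdom d \<Longrightarrow>
      \<omega> c p v = \<omega> d p (frechet_derivative (cmap d \<circ> cinv c) (at (cmap c p)) v)"
    "\<And>c v. c \<in> atl \<Longrightarrow> smooth_on (cmap c ` cdom c) (\<lambda>x. \<omega> c (cinv c x) v)"
  shows "\<omega> \<in> Omega1 atl"
  unfolding Omega1_def using assms by blast

locale cylinder =
  fixes atl :: "'a::{t2_space,second_countable_topology} chart set"
    and u :: "real \<times> real \<Rightarrow> 'a"
  assumes surface: "smooth_surface atl" and embedded: "embedded_cylinder atl u"
begin

text \<open>The universal cover of the open cylinder. It is open, so derivatives within
  \<open>strip\<close> are full derivatives on it, and convex, so vanishing derivatives force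
  constancy.\<close>

definition D :: "(real \<times> real) set" where "D = UNIV \<times> {-1<..<1}"

definition U :: "'a set" where "U = u ` D"

definition Dc :: "'a chart \<Rightarrow> (real \<times> real) set" where "Dc c = {x \<in> D. u x \<in> cdom c}"

abbreviation dk :: "'a chart \<Rightarrow> real \<times> real \<Rightarrow> real \<times> real \<Rightarrow> real \<times> real" where
  "dk c x \<equiv> frechet_derivative (cmap c \<circ> u) (at x)"

lemma
  assumes "c \<in> atl"
  shows open_cdom: "open (cdom c)" and open_cimage: "open (cmap c ` cdom c)"
    and cinv_cmap: "p \<in> cdom c \<Longrightarrow> cinv c (cmap c p) = p"
    and cinv_in: "y \<in> cmap c ` cdom c \<Longrightarrow> cinv c y \<in> cdom c"
    and continuous_cmap: "continuous_on (cdom c) (cmap c)"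
    and continuous_cinv: "continuous_on (cmap c ` cdom c) (cinv c)"
proof -
  have "open (cdom c)" "open (cmap c ` cdom c)" and h: "homeomorphism (cdom c) (cmap c ` cdom c) (cmap c) (cinv c)"
    using surface assms unfolding smooth_surface_def by auto
  then show "open (cdom c)" "open (cmap c ` cdom c)" by auto
  show "p \<in> cdom c \<Longrightarrow> cinv c (cmap c p) = p" "y \<in> cmap c ` cdom c \<Longrightarrow> cinv c y \<in> cdom c" "continuous_on (cdom c) (cmap c)"
    "continuous_on (cmap c ` cdom c) (cinv c)"
    using h unfolding homeomorphism_def by auto
qed

lemma open_chart_image:
  assumes "c \<in> atl" "open S"
  shows "open (cmap c ` (cdom c \<inter> S))"
proof -
  have "cmap c ` (cdom c \<inter> S) = cmap c ` cdom c \<inter> cinv c -` S"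
    using cinv_cmap[OF assms(1)] by (auto simp: image_iff)
  then show ?thesis
    using continuous_open_preimage[OF continuous_cinv[OF assms(1)] open_cimage[OF assms(1)] assms(2)] by simp
qed

lemma ex_chart: "\<exists>c\<in>atl. p \<in> cdom c"
  using surface unfolding smooth_surface_def by blast

lemma chart_at: "chart_at atl p \<in> atl" "p \<in> cdom (chart_at atl p)"
  using someI_ex[of "\<lambda>c. c \<in> atl \<and> p \<in> cdom c"] ex_chart[of p] unfolding chart_at_def by blast+

lemma transition_smooth:
  assumes "c \<in> atl" "d \<in> atl"
  shows "smooth_on (cmap c ` (cdom c \<inter> cdom d)) (cmap d \<circ> cinv c)"
  using surface assms unfolding smooth_surface_def by blast

section \<open>The parametrization as a local diffeomorphism\<close>

lemma open_D: "open D"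
  unfolding D_def by (intro open_Times) auto

lemma D_strip: "D \<subseteq> strip"
  by (auto simp: D_def strip_def)

lemma at_within_strip: "x \<in> D \<Longrightarrow> at x within strip = at x"
  using at_within_open_subset[OF _ open_D D_strip] by blast

lemma continuous_u: "continuous_on strip u"
  using embedded unfolding embedded_cylinder_def by blast

lemma u_eq_iff:
  "x \<in> strip \<Longrightarrow> y \<in> strip \<Longrightarrow> u x = u y \<longleftrightarrow> snd x = snd y \<and> (\<exists>k::int. fst y = fst x + 2 * pi * of_int k)"
  using embedded unfolding embedded_cylinder_def strip_def by (cases x; cases y) auto

lemma u_periodic: "s \<in> {-1..1} \<Longrightarrow> u (\<theta> + 2 * pi, s) = u (\<theta>, s)"
  by (subst u_eq_iff) (auto simp: strip_def intro!: exI[of _ "-1"])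

lemma open_Dc: "c \<in> atl \<Longrightarrow> open (Dc c)"
  using continuous_open_preimage[OF continuous_on_subset[OF continuous_u D_strip] open_D open_cdom, of c]
  by (simp add: Dc_def vimage_def Int_def)

lemma Dc_subset: "Dc c \<subseteq> D" by (auto simp: Dc_def)

lemma kappa_smooth: "c \<in> atl \<Longrightarrow> smooth_on (Dc c) (cmap c \<circ> u)"
proof (rule smooth_on_subset)
  assume "c \<in> atl"
  then show "smooth_on {x \<in> strip. u x \<in> cdom c} (cmap c \<circ> u)"
    using embedded unfolding embedded_cylinder_def by blast
  show "Dc c \<subseteq> {x \<in> strip. u x \<in> cdom c}" using D_strip unfolding Dc_def by blast
qed

lemma kappa_deriv: "c \<in> atl \<Longrightarrow> x \<in> Dc c \<Longrightarrow> ((cmap c \<circ> u) has_derivative dk c x) (at x)"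
  by (rule smooth_on_has_derivative[OF open_Dc kappa_smooth])

lemma dk_inj:
  assumes "c \<in> atl" "x \<in> Dc c"
  shows "inj (dk c x)"
proof -
  have x: "x \<in> D" "x \<in> strip" "u x \<in> cdom c" using assms(2) D_strip by (auto simp: Dc_def)
  have "\<forall>c\<in>atl. \<forall>x\<in>strip. u x \<in> cdom c \<longrightarrow>
      (\<exists>L. ((cmap c \<circ> u) has_derivative L) (at x within strip) \<and> inj L)"
    using embedded unfolding embedded_cylinder_def by blast
  with assms(1) x(2,3) obtain L where "((cmap c \<circ> u) has_derivative L) (at x within strip)" and inj: "inj L"
    by blast
  then have L: "((cmap c \<circ> u) has_derivative L) (at x)" using at_within_strip[OF x(1)] by simp
  from frechet_derivative_at[OF L] inj show ?thesis by simp
qed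

lemma dk_linear: "c \<in> atl \<Longrightarrow> x \<in> Dc c \<Longrightarrow> linear (dk c x)"
  using kappa_deriv by (rule has_derivative_linear)

lemma dk_surj:
  assumes "c \<in> atl" "x \<in> Dc c"
  obtains v where "z = dk c x v"
  using linear_injective_imp_surjective[OF dk_linear[OF assms] dk_inj[OF assms]] that by (metis surjD)

text \<open>A smooth local section of \<open>u\<close> in a chart, from the inverse function
  theorem. It shows that \<open>U\<close> is open in the surface, and it replaces the arbitrary
  \<open>lift\<close> wherever smoothness of a descended function is at stake.\<close>

lemma local_inverse:
  assumes c: "c \<in> atl" and x: "x \<in> Dc c"
  obtains V g where "open V" "cmap c (u x) \<in> V" "V \<subseteq> cmap c ` cdom c" "smooth_on V g"
    "g ` V \<subseteq> Dc c" "\<And>y. y \<in> V \<Longrightarrow> u (g y) = cinv c y"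
proof -
  obtain U' V g where *: "open U'" "U' \<subseteq> Dc c" "x \<in> U'" "open V" "(cmap c \<circ> u) x \<in> V"
    "homeomorphism U' V (cmap c \<circ> u) g" "smooth_on V g"
    by (rule smooth_inverse_function[OF open_Dc[OF c] kappa_smooth[OF c] x dk_inj[OF c x]])
  have g: "g y \<in> Dc c" "cmap c (u (g y)) = y" if "y \<in> V" for y
    using *(2,6) that unfolding homeomorphism_def by auto
  have "u (g y) = cinv c y" "y \<in> cmap c ` cdom c" if "y \<in> V" for y
    using g[OF that] cinv_cmap[OF c, of "u (g y)"] by (auto simp: Dc_def intro!: image_eqI[of y _ "u (g y)"])
  moreover have "V \<subseteq> cmap c ` cdom c" "g ` V \<subseteq> Dc c" using calculation(2) g(1) by blast+
  ultimately show thesis using that[of V g] *(4,5,7) by simp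
qed

lemma open_U: "open U"
proof (rule Topological_Spaces.openI)
  fix p assume "p \<in> U"
  then obtain x where x: "x \<in> D" "p = u x" by (auto simp: U_def)
  obtain c where c: "c \<in> atl" "p \<in> cdom c" using ex_chart by blast
  then have xc: "x \<in> Dc c" using x by (simp add: Dc_def)
  obtain V g where V: "open V" "cmap c (u x) \<in> V" "V \<subseteq> cmap c ` cdom c"
    "g ` V \<subseteq> Dc c" "\<And>y. y \<in> V \<Longrightarrow> u (g y) = cinv c y"
    by (rule local_inverse[OF c(1) xc], rule that, auto)
  have "open (cdom c \<inter> cmap c -` V)"
    by (rule continuous_open_preimage[OF continuous_cmap[OF c(1)] open_cdom[OF c(1)] V(1)])
  moreover have "cdom c \<inter> cmap c -` V \<subseteq> U"
  proof
    fix q assume q: "q \<in> cdom c \<inter> cmap c -` V"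
    then have "q = u (g (cmap c q))" using V(5)[of "cmap c q"] cinv_cmap[OF c(1), of q] by auto
    moreover have "g (cmap c q) \<in> D" using q V(4) Dc_subset by blast
    ultimately show "q \<in> U" unfolding U_def by blast
  qed
  ultimately show "\<exists>T. open T \<and> p \<in> T \<and> T \<subseteq> U" using c x V(2) by blast
qed

text \<open>An arbitrary, possibly discontinuous section of \<open>u\<close>; only periodic functions of it are used.\<close>

definition lift :: "'a \<Rightarrow> real \<times> real" where "lift p = (SOME x. x \<in> D \<and> u x = p)"

definition periodic :: "(real \<times> real \<Rightarrow> 'b) \<Rightarrow> bool" where
  "periodic F \<longleftrightarrow> (\<forall>\<theta>. \<forall>s\<in>{-1<..<1}. F (\<theta> + 2 * pi, s) = F (\<theta>, s))"

lemma lift: "p \<in> U \<Longrightarrow> lift p \<in> D" "p \<in> U \<Longrightarrow> u (lift p) = p"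
  using someI_ex[of "\<lambda>x. x \<in> D \<and> u x = p"] unfolding U_def lift_def by blast+

lemma u_in_U: "x \<in> D \<Longrightarrow> u x \<in> U" by (simp add: U_def)

lemma periodic_int:
  assumes "periodic F" "s \<in> {-1<..<1}"
  shows "F (\<theta> + 2 * pi * of_int k, s) = F (\<theta>, s)"
proof -
  have nat: "F (\<theta> + 2 * pi * real n, s) = F (\<theta>, s)" for n \<theta>
  proof (induction n)
    case (Suc n)
    have "F (\<theta> + 2 * pi * real (Suc n), s) = F ((\<theta> + 2 * pi * real n) + 2 * pi, s)" by (simp add: algebra_simps)
    also have "\<dots> = F (\<theta> + 2 * pi * real n, s)" using assms by (simp add: periodic_def)
    finally show ?case using Suc by simp
  qed simp
  show ?thesis
  proof (cases k rule: int_cases2)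
    case (nonneg n)
    then show ?thesis using nat[of \<theta> n] by simp
  next
    case (nonpos n)
    then show ?thesis using nat[of "\<theta> + 2 * pi * of_int k" n] by simp
  qed
qed

lemma periodic_lift:
  assumes "periodic F" "x \<in> D"
  shows "F (lift (u x)) = F x"
proof -
  have "lift (u x) \<in> D" "u (lift (u x)) = u x" using lift u_in_U[OF assms(2)] by auto
  then obtain k :: int where k: "snd (lift (u x)) = snd x" "fst x = fst (lift (u x)) + 2 * pi * of_int k"
    using u_eq_iff[of "lift (u x)" x] assms(2) D_strip by blast
  have "F x = F (fst (lift (u x)) + 2 * pi * of_int k, snd x)" using k by (metis prod.collapse)
  also have "\<dots> = F (fst (lift (u x)), snd x)"
    using assms by (intro periodic_int) (auto simp: D_def)
  finally show ?thesis using k by (metis prod.collapse)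
qed

lemma periodic_snd: "periodic snd" by (simp add: periodic_def)

lemma snd_lift: "x \<in> D \<Longrightarrow> snd (lift (u x)) = snd x" by (rule periodic_lift[OF periodic_snd])

text \<open>Near any point the possibly discontinuous \<open>lift\<close> may be exchanged for a
  smooth local section of \<open>u\<close>: both lie over the same point, and a periodic function
  does not see the difference.\<close>

lemma descend_smooth:
  assumes F: "smooth_on D F" "periodic F" and c: "c \<in> atl"
  shows "smooth_on (cmap c ` (cdom c \<inter> U)) (\<lambda>y. F (lift (cinv c y)))"
proof (rule smooth_on_local)
  fix y assume "y \<in> cmap c ` (cdom c \<inter> U)"
  then obtain x where x: "x \<in> D" "u x \<in> cdom c" "y = cmap c (u x)" by (auto simp: U_def)
  then have xc: "x \<in> Dc c" by (simp add: Dc_def)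
  obtain V g where V: "open V" "cmap c (u x) \<in> V" "V \<subseteq> cmap c ` cdom c" "smooth_on V g"
    "g ` V \<subseteq> Dc c" "\<And>y. y \<in> V \<Longrightarrow> u (g y) = cinv c y"
    by (rule local_inverse[OF c(1) xc], rule that, auto)
  have "smooth_on V (\<lambda>y. F (g y))"
    by (rule smooth_on_compose[OF V(1) open_D order_trans[OF V(5) Dc_subset] F(1) V(4)])
  then have "smooth_on V (\<lambda>y. F (lift (cinv c y)))"
  proof (rule smooth_on_cong)
    show "F (g y) = F (lift (cinv c y))" if "y \<in> V" for y
    proof -
      have "g y \<in> D" using that V(5) Dc_subset by blast
      then show ?thesis using periodic_lift[OF F(2), of "g y"] V(6)[OF that] by simp
    qed
  qed
  then show "\<exists>V. open V \<and> y \<in> V \<and> smooth_on (cmap c ` (cdom c \<inter> U) \<inter> V) (\<lambda>y. F (lift (cinv c y)))"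
    using V x by (intro exI[of _ V]) (auto intro: smooth_on_subset)
qed

lemma descend_deriv:
  assumes F: "smooth_on D F" "periodic F" and c: "c \<in> atl" and x: "x \<in> Dc c"
  shows "frechet_derivative (\<lambda>y. F (lift (cinv c y))) (at (cmap c (u x))) (dk c x v)
      = frechet_derivative F (at x) v"
proof -
  let ?G = "\<lambda>y. F (lift (cinv c y))"
  have xD: "x \<in> D" "u x \<in> cdom c" using x by (auto simp: Dc_def)
  have "(?G has_derivative frechet_derivative ?G (at (cmap c (u x)))) (at (cmap c (u x)))"
    by (rule smooth_on_has_derivative[OF open_chart_image[OF c open_U] descend_smooth[OF F c]])
      (use xD u_in_U in auto)
  then have "((\<lambda>x. ?G ((cmap c \<circ> u) x)) has_derivative
      (\<lambda>v. frechet_derivative ?G (at (cmap c (u x))) (dk c x v))) (at x)"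
    using diff_chain_at[OF kappa_deriv[OF c x], of ?G] by (simp add: o_def)
  then have "(F has_derivative (\<lambda>v. frechet_derivative ?G (at (cmap c (u x))) (dk c x v))) (at x)"
  proof (rule has_derivative_transform_within_open[OF _ open_Dc[OF c] x])
    show "?G ((cmap c \<circ> u) z) = F z" if "z \<in> Dc c" for z
      using that cinv_cmap[OF c, of "u z"] periodic_lift[OF F(2), of z] by (auto simp: Dc_def)
  qed
  from frechet_derivative_at[OF this] show ?thesis by (metis)
qed

subsection \<open>Pull-backs to the strip\<close>

text \<open>The transition rule of \<open>Omega1\<close> on its own; it is what permits evaluating a
  pull-back in any chart instead of the chosen one.\<close>

definition covariant :: "('a, mat2) form1 \<Rightarrow> bool" where
  "covariant \<omega> \<longleftrightarrow>
     (\<forall>c\<in>atl. \<forall>d\<in>atl. \<forall>p\<in>cdom c \<inter> cdom d. \<forall>v.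
        \<omega> c p v = \<omega> d p (frechet_derivative (cmap d \<circ> cinv c) (at (cmap c p)) v))"

lemma Omega1_covariant: "\<omega> \<in> Omega1 atl \<Longrightarrow> covariant \<omega>"
  unfolding Omega1_def covariant_def by blast

abbreviation pb :: "('a, mat2) form1 \<Rightarrow> real \<times> real \<Rightarrow> real \<times> real \<Rightarrow> mat2" where
  "pb \<omega> \<equiv> pullback1 atl u strip \<omega>"

lemma dk_transition:
  assumes c: "c \<in> atl" "x \<in> Dc c" and d: "d \<in> atl" "x \<in> Dc d"
  shows "dk d x v = frechet_derivative (cmap d \<circ> cinv c) (at (cmap c (u x))) (dk c x v)"
proof -
  let ?T = "cmap d \<circ> cinv c"
  have "(?T has_derivative frechet_derivative ?T (at (cmap c (u x)))) (at (cmap c (u x)))"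
    by (rule smooth_on_has_derivative[OF open_chart_image[OF c(1) open_cdom[OF d(1)]] transition_smooth[OF c(1) d(1)]])
      (use c d in \<open>auto simp: Dc_def\<close>)
  then have "((\<lambda>x. ?T ((cmap c \<circ> u) x)) has_derivative
      (\<lambda>v. frechet_derivative ?T (at (cmap c (u x))) (dk c x v))) (at x)"
    using diff_chain_at[OF kappa_deriv[OF c], of ?T] by (simp add: o_def)
  then have "((cmap d \<circ> u) has_derivative (\<lambda>v. frechet_derivative ?T (at (cmap c (u x))) (dk c x v))) (at x)"
    by (rule has_derivative_transform_within_open[OF _ open_Dc[OF c(1)] c(2)])
      (use cinv_cmap[OF c(1)] in \<open>auto simp: Dc_def\<close>)
  from frechet_derivative_at[OF this] show ?thesis by metis
qed

lemma pb_chart_at: "x \<in> D \<Longrightarrow> pb \<omega> x v = \<omega> (chart_at atl (u x)) (u x) (dk (chart_at atl (u x)) x v)"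
  by (simp add: pullback1_def coord_deriv_def at_within_strip)

lemma pb_chart:
  assumes "covariant \<omega>" "c \<in> atl" "x \<in> Dc c"
  shows "pb \<omega> x v = \<omega> c (u x) (dk c x v)"
proof -
  let ?d = "chart_at atl (u x)"
  have x: "x \<in> D" "u x \<in> cdom c" using assms(3) by (auto simp: Dc_def)
  have d: "?d \<in> atl" "x \<in> Dc ?d" using chart_at[of "u x"] x by (auto simp: Dc_def)
  have "\<omega> c (u x) (dk c x v) = \<omega> ?d (u x) (frechet_derivative (cmap ?d \<circ> cinv c) (at (cmap c (u x))) (dk c x v))"
    using assms(1,2) d x chart_at[of "u x"] unfolding covariant_def by blast
  then show ?thesis using dk_transition[OF assms(2,3) d] pb_chart_at[OF x(1)] by simp
qed

lemma ex_Dc: assumes "x \<in> D" obtains c where "c \<in> atl" "x \<in> Dc c"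
  using assms ex_chart[of "u x"] by (auto simp: Dc_def)

lemma pb_linear:
  assumes "\<And>c p. c \<in> atl \<Longrightarrow> p \<in> cdom c \<Longrightarrow> linear (\<omega> c p)" "x \<in> D"
  shows "linear (pb \<omega> x)"
proof -
  have c: "chart_at atl (u x) \<in> atl" "x \<in> Dc (chart_at atl (u x))"
    using chart_at[of "u x"] assms(2) by (auto simp: Dc_def)
  from linear_compose[OF dk_linear[OF c] assms(1)[OF chart_at]] show ?thesis
    using pb_chart_at[OF assms(2)] by (simp add: o_def linear_iff)
qed

text \<open>Translation by \<open>2 * pi\<close> has the identity as derivative and leaves
  \<open>u\<close> unchanged, so the coordinate derivatives of \<open>u\<close> at the two points
  agree.\<close>

lemma pb_periodic:
  assumes "covariant \<omega>"
  shows "periodic (\<lambda>x. pb \<omega> x v)"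
  unfolding periodic_def
proof (intro allI ballI)
  fix \<theta> s :: real assume s: "s \<in> {-1<..<1}"
  let ?x = "(\<theta>, s)" and ?y = "(\<theta> + 2 * pi, s)"
  have x: "?x \<in> D" "?y \<in> D" using s by (auto simp: D_def)
  obtain c where c: "c \<in> atl" "?x \<in> Dc c" by (rule ex_Dc[OF x(1)])
  have e: "u ?y = u ?x" using s by (intro u_periodic) auto
  then have cy: "?y \<in> Dc c" using c x by (simp add: Dc_def)
  have "((\<lambda>z. (cmap c \<circ> u) (z + (2 * pi, 0))) has_derivative dk c ?y) (at ?x)"
  proof -
    have "((\<lambda>z. z + (2 * pi, 0)) has_derivative (\<lambda>v. v)) (at ?x)" by (auto intro!: derivative_eq_intros)
    from diff_chain_at[OF this, of "cmap c \<circ> u"] kappa_deriv[OF c(1) cy] show ?thesis by (simp add: o_def)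
  qed
  then have "((cmap c \<circ> u) has_derivative dk c ?y) (at ?x)"
  proof (rule has_derivative_transform_within_open[OF _ open_D x(1)])
    show "(cmap c \<circ> u) (z + (2 * pi, 0)) = (cmap c \<circ> u) z" if "z \<in> D" for z
      using that u_periodic[of "snd z" "fst z"] by (auto simp: D_def)
  qed
  from frechet_derivative_at[OF this] have "dk c ?y = dk c ?x" by simp
  then show "pb \<omega> ?y v = pb \<omega> ?x v" by (simp add: pb_chart[OF assms c(1)] c cy e)
qed

lemma pb_su2: "\<omega> \<in> Omega1 atl \<Longrightarrow> x \<in> D \<Longrightarrow> pb \<omega> x v \<in> su2"
  by (simp add: pb_chart_at Omega1_su2[OF _ chart_at])

text \<open>Pull-back commutes with the exterior derivative: differentiating the pulled-back
  coefficient produces, besides the expected term, the form applied to a second derivative of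
  \<open>cmap c \<circ> u\<close>, and this cancels under antisymmetrization.\<close>

lemma
  assumes \<omega>: "\<omega> \<in> Omega1 atl"
  shows pb_smooth: "smooth_on D (\<lambda>x. pb \<omega> x v)"
    and pb_ext_deriv: "c \<in> atl \<Longrightarrow> x \<in> Dc c \<Longrightarrow>
      frechet_derivative (\<lambda>x. pb \<omega> x z) (at x) v - frechet_derivative (\<lambda>x. pb \<omega> x v) (at x) z
      = ext_deriv \<omega> c (u x) (dk c x v) (dk c x z)"
proof -
  have *: "smooth_on (Dc c) (\<lambda>x. pb \<omega> x v)"
    "\<And>x z. x \<in> Dc c \<Longrightarrow> frechet_derivative (\<lambda>x. pb \<omega> x v) (at x) z
      = frechet_derivative (\<lambda>y. \<omega> c (cinv c y) (dk c x v)) (at (cmap c (u x))) (dk c x z)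
      + \<omega> c (u x) (frechet_derivative (\<lambda>x. dk c x v) (at x) z)" if c: "c \<in> atl" for c v
  proof -
    let ?E = "cmap c ` cdom c"
    define F where "F = (\<lambda>p. \<Sum>b\<in>Basis. (snd p \<bullet> b) *\<^sub>R \<omega> c (cinv c (fst p)) b)"
    have lin: "linear (\<omega> c (cinv c y))" if "y \<in> ?E" for y
      using Omega1_linear[OF \<omega> c] cinv_in[OF c that] by blast
    have F: "smooth_on (?E \<times> UNIV) F" "\<And>y v. y \<in> ?E \<Longrightarrow> F (y, v) = \<omega> c (cinv c y) v"
      "\<And>y v z1 z2. y \<in> ?E \<Longrightarrow> frechet_derivative F (at (y, v)) (z1, z2)
        = frechet_derivative (\<lambda>x. \<omega> c (cinv c x) v) (at y) z1 + \<omega> c (cinv c y) z2"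
      unfolding F_def
      by (rule smooth_on_combination(1-3)[OF open_cimage[OF c]], rule lin, assumption,
          rule Omega1_smooth[OF \<omega> c], assumption?)+
    let ?k = "\<lambda>x. (cmap c (u x), dk c x v)"
    have k: "smooth_on (Dc c) ?k"
      by (intro smooth_on_Pair open_Dc c smooth_on_deriv[OF _ kappa_smooth]
          kappa_smooth[unfolded o_def])
    have kE: "cmap c (u x) \<in> ?E" if "x \<in> Dc c" for x using that by (auto simp: Dc_def)
    have pbF: "F (?k x) = pb \<omega> x v" if "x \<in> Dc c" for x
      using F(2)[OF kE[OF that]] pb_chart[OF Omega1_covariant[OF \<omega>] c that] that cinv_cmap[OF c, of "u x"]
      by (simp add: Dc_def)
    have oE: "open (?E \<times> (UNIV :: (real \<times> real) set))" by (intro open_Times open_cimage c open_UNIV)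
    have sF: "smooth_on (?E \<times> UNIV) F" using F(1) by blast
    show "smooth_on (Dc c) (\<lambda>x. pb \<omega> x v)"
      by (rule smooth_on_cong[OF smooth_on_compose[OF open_Dc[OF c] oE _ sF k]])
        (use kE pbF in auto)
    fix x z assume x: "x \<in> Dc c"
    have "(?k has_derivative (\<lambda>z. (dk c x z, frechet_derivative (\<lambda>x. dk c x v) (at x) z))) (at x)"
      using has_derivative_Pair[OF kappa_deriv[OF c x]
          smooth_on_has_derivative[OF open_Dc[OF c] smooth_on_deriv[OF open_Dc[OF c] kappa_smooth[OF c]] x]]
      by (simp add: o_def)
    from diff_chain_at[OF this smooth_on_has_derivative[OF oE sF]] kE[OF x]
    have "((\<lambda>x. F (?k x)) has_derivative (\<lambda>z. frechet_derivative F (at (?k x))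
        (dk c x z, frechet_derivative (\<lambda>x. dk c x v) (at x) z))) (at x)" by (simp add: o_def)
    then have "((\<lambda>x. pb \<omega> x v) has_derivative (\<lambda>z. frechet_derivative F (at (?k x))
        (dk c x z, frechet_derivative (\<lambda>x. dk c x v) (at x) z))) (at x)"
      by (rule has_derivative_transform_within_open[OF _ open_Dc[OF c] x]) (rule pbF)
    note 1 = fun_cong[OF frechet_derivative_at[OF this], of z, symmetric]
    show "frechet_derivative (\<lambda>x. pb \<omega> x v) (at x) z
      = frechet_derivative (\<lambda>y. \<omega> c (cinv c y) (dk c x v)) (at (cmap c (u x))) (dk c x z)
      + \<omega> c (u x) (frechet_derivative (\<lambda>x. dk c x v) (at x) z)"
      unfolding 1 using F(3)[OF kE[OF x]] x cinv_cmap[OF c, of "u x"] by (simp add: Dc_def)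
  qed
  show "smooth_on D (\<lambda>x. pb \<omega> x v)"
  proof (rule smooth_on_local)
    fix x assume "x \<in> D"
    then obtain c where "c \<in> atl" "x \<in> Dc c" by (rule ex_Dc)
    then show "\<exists>V. open V \<and> x \<in> V \<and> smooth_on (D \<inter> V) (\<lambda>x. pb \<omega> x v)"
      by (intro exI[of _ "Dc c"] conjI open_Dc smooth_on_subset[OF *(1) Int_lower2])
  qed
  assume c: "c \<in> atl" and x: "x \<in> Dc c"
  show "frechet_derivative (\<lambda>x. pb \<omega> x z) (at x) v - frechet_derivative (\<lambda>x. pb \<omega> x v) (at x) z
      = ext_deriv \<omega> c (u x) (dk c x v) (dk c x z)"
    unfolding *(2)[OF c x] ext_deriv_def
    using symmetric_second_derivative[OF open_Dc[OF c] kappa_smooth[OF c] x, of v z] by simp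
qed

lemma pb_curvature:
  assumes A: "A \<in> Omega1 atl" and c: "c \<in> atl" "x \<in> Dc c"
  shows "curvature A c (u x) (dk c x v) (dk c x z)
      = frechet_derivative (\<lambda>x. pb A x z) (at x) v - frechet_derivative (\<lambda>x. pb A x v) (at x) z
        - bracket (pb A x v) (pb A x z)"
proof -
  \<comment> \<open>On a pair of vectors the wedge bracket of a form with itself is twice the
    bracket of its values; the factor 1/2 in the curvature compensates.\<close>
  have half: "(1/2) *\<^sub>R (X - Y - (Y - X)) = X - Y" for X Y :: mat2
  proof -
    have "X - Y - (Y - X) = 2 *\<^sub>R (X - Y)" by (simp only: scaleR_2) simp
    then show ?thesis by simp
  qed
  show ?thesis
    unfolding curvature_def wedge_bracket_def bracket_def pb_ext_deriv[OF A c]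
      pb_chart[OF Omega1_covariant[OF A] c] half ..
qed

lemma pb_flat:
  assumes "A \<in> A_flat atl" "x \<in> D"
  shows "frechet_derivative (\<lambda>x. pb A x z) (at x) v - frechet_derivative (\<lambda>x. pb A x v) (at x) z
      = bracket (pb A x v) (pb A x z)"
proof -
  have A: "A \<in> Omega1 atl" using assms by (simp add: A_flat_def)
  obtain c where c: "c \<in> atl" "x \<in> Dc c" by (rule ex_Dc[OF assms(2)])
  have "\<forall>c\<in>atl. \<forall>p\<in>cdom c. \<forall>v z. curvature A c p v z = 0" using assms(1) unfolding A_flat_def by blast
  moreover have "u x \<in> cdom c" using c(2) by (simp add: Dc_def)
  ultimately have "curvature A c (u x) (dk c x v) (dk c x z) = 0" using c(1) by blast
  then show ?thesis using pb_curvature[OF A c] by simp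
qed

lemma pb_T_flat:
  assumes A: "A \<in> Omega1 atl" and B: "B \<in> T_flat atl A" and "x \<in> D"
  shows "frechet_derivative (\<lambda>x. pb B x z) (at x) v - frechet_derivative (\<lambda>x. pb B x v) (at x) z
      = bracket (pb A x v) (pb B x z) - bracket (pb A x z) (pb B x v)"
proof -
  have B1: "B \<in> Omega1 atl" using B by (simp add: T_flat_def)
  obtain c where c: "c \<in> atl" "x \<in> Dc c" by (rule ex_Dc[OF assms(3)])
  have "\<forall>c\<in>atl. \<forall>p\<in>cdom c. \<forall>v z. ext_deriv B c p v z - wedge_bracket A B c p v z = 0"
    using B unfolding T_flat_def by blast
  moreover have "u x \<in> cdom c" using c(2) by (simp add: Dc_def)
  ultimately have "ext_deriv B c (u x) (dk c x v) (dk c x z) - wedge_bracket A B c (u x) (dk c x v) (dk c x z) = 0"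
    using c(1) by blast
  then show ?thesis
    using pb_ext_deriv[OF B1 c] by (simp add: wedge_bracket_def pb_chart[OF Omega1_covariant[OF A] c]
        pb_chart[OF Omega1_covariant[OF B1] c])
qed

end

section \<open>Holonomy and its axis\<close>

lemma su2_skew: "X \<in> su2 \<Longrightarrow> ct X = - X" and su2_trace: "X \<in> su2 \<Longrightarrow> trace X = 0"
  by (auto simp: su2_def)

lemma su2_add: "X \<in> su2 \<Longrightarrow> Y \<in> su2 \<Longrightarrow> X + Y \<in> su2"
  and su2_scaleR: "X \<in> su2 \<Longrightarrow> r *\<^sub>R X \<in> su2"
  and su2_zero: "0 \<in> su2"
  by (auto simp: su2_def) (simp add: trace_def)

lemma su2_conj:
  assumes "X \<in> su2" "ct U ** U = mat 1"
  shows "U ** X ** ct U \<in> su2"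
proof -
  have "trace (U ** X ** ct U) = trace (ct U ** (U ** X))" by (rule trace_mult_commute)
  also have "\<dots> = trace X" using assms(2) by (simp add: unitary_cancel)
  finally show ?thesis using assms by (simp add: su2_def ct_mult matrix_mul_assoc)
qed

lemma bounded_bilinear_bracket: "bounded_bilinear bracket"
  by (subst bilinear_conv_bounded_bilinear[symmetric])
    (auto simp: bilinear_def bracket_def matrix_distribs algebra_simps intro!: linearI)

text \<open>If H = cos f + sin f X with f strictly between 0 and \<pi>, then cos f is half the trace
  and the positive root is sin f, so the formula returns X. The range of arccos thus fixes the sign
  of the axis.\<close>

definition hol_axis :: "mat2 \<Rightarrow> mat2" where
  "hol_axis H = (1 / sqrt (1 - (Re (trace H) / 2)\<^sup>2)) *\<^sub>R (H - (Re (trace H) / 2) *\<^sub>R mat 1)"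

lemma SU2_entries:
  assumes "H \<in> SU2"
  shows "H $ 2 $ 2 = cnj (H $ 1 $ 1)" "H $ 2 $ 1 = - cnj (H $ 1 $ 2)"
    "H $ 1 $ 1 * cnj (H $ 1 $ 1) + H $ 1 $ 2 * cnj (H $ 1 $ 2) = 1"
proof -
  define p q r t where pqrt: "p = H $ 1 $ 1" "q = H $ 1 $ 2" "r = H $ 2 $ 1" "t = H $ 2 $ 2"
  have 1: "p * cnj p + q * cnj q = 1" and 2: "r * cnj p + t * cnj q = 0" and 3: "p * t - q * r = 1"
    using assms unfolding SU2_def pqrt by (auto simp: mat2_simps det_2)
  show "p * cnj p + q * cnj q = 1" by (rule 1)
  have "t = t * (p * cnj p + q * cnj q)" using 1 by simp
  also have "\<dots> = cnj p * (p * t - q * r) + q * (r * cnj p + t * cnj q)" by (simp add: algebra_simps)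
  finally show "t = cnj p" using 2 3 by simp
  have "r = r * (p * cnj p + q * cnj q)" using 1 by simp
  also have "\<dots> = p * (r * cnj p + t * cnj q) - cnj q * (p * t - q * r)" by (simp add: algebra_simps)
  finally show "r = - cnj q" using 2 3 by simp
qed

text \<open>Unit quaternions: \<open>c\<close> is the real part of \<open>H\<close>, the rest is
  imaginary with square \<open>-(1 - c\<^sup>2)\<close>, and \<open>c\<^sup>2 = 1\<close> would
  force the imaginary part to vanish, leaving only the two excluded values.\<close>

lemma SU2_hol_axis:
  assumes H: "H \<in> SU2" "H \<noteq> mat 1" "H \<noteq> - mat 1"
  defines "c \<equiv> Re (trace H) / 2"
  shows "c\<^sup>2 < 1" and "hol_axis H \<in> su2" and "hol_axis H ** hol_axis H = - mat 1"
    and "H = c *\<^sub>R mat 1 + sqrt (1 - c\<^sup>2) *\<^sub>R hol_axis H"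
proof -
  define p q where pq: "p = H $ 1 $ 1" "q = H $ 1 $ 2"
  have e: "H $ 2 $ 2 = cnj p" "H $ 2 $ 1 = - cnj q" "H $ 1 $ 1 = p" "H $ 1 $ 2 = q"
    using SU2_entries[OF H(1)] by (auto simp: pq)
  have n: "(Re p)\<^sup>2 + (Im p)\<^sup>2 + (Re q)\<^sup>2 + (Im q)\<^sup>2 = 1"
    using arg_cong[OF SU2_entries(3)[OF H(1)], of Re] by (simp add: e power2_eq_square)
  have c: "c = Re p" by (simp add: c_def trace_def sum_2 e)
  have "c\<^sup>2 \<noteq> 1"
  proof
    assume "c\<^sup>2 = 1"
    then have "(Im p)\<^sup>2 + ((Re q)\<^sup>2 + (Im q)\<^sup>2) = 0" "Re p = 1 \<or> Re p = - 1"
      using n by (auto simp: c power2_eq_1_iff)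
    then have "Im p = 0" "q = 0" "Re p = 1 \<or> Re p = - 1"
      by (auto simp: add_nonneg_eq_0_iff complex_eq_iff)
    then have "p = 1 \<or> p = - 1" "q = 0" by (auto simp: complex_eq_iff)
    then have "H = mat 1 \<or> H = - mat 1" by (auto simp: mat2_simps e)
    then show False using H by simp
  qed
  moreover have "c\<^sup>2 \<le> 1" using n unfolding c
    by (smt (verit) zero_le_power2)
  ultimately show c1: "c\<^sup>2 < 1" by simp
  define s where "s = sqrt (1 - c\<^sup>2)"
  have s: "s > 0" "s\<^sup>2 = 1 - c\<^sup>2" using c1 by (auto simp: s_def)
  define Y where "Y = H - c *\<^sub>R mat 1"
  have ax: "hol_axis H = (1 / s) *\<^sub>R Y" by (simp add: hol_axis_def s_def Y_def c_def)
  have "Y \<in> su2"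
    by (simp add: su2_def Y_def mat2_simps e trace_def c complex_eq_iff)
  then show "hol_axis H \<in> su2" unfolding ax by (rule su2_scaleR)
  have "Y ** Y = - ((1 - c\<^sup>2) *\<^sub>R mat 1)"
    using n by (simp add: Y_def mat2_simps e c complex_eq_iff power2_eq_square algebra_simps)
  moreover have "hol_axis H ** hol_axis H = (1 / s\<^sup>2) *\<^sub>R (Y ** Y)" by (simp add: ax power2_eq_square)
  ultimately have "hol_axis H ** hol_axis H = (1 / s\<^sup>2) *\<^sub>R - (s\<^sup>2 *\<^sub>R mat 1)" by (simp only: s(2))
  then show "hol_axis H ** hol_axis H = - mat 1" using s(1) by simp
  show "H = c *\<^sub>R mat 1 + sqrt (1 - c\<^sup>2) *\<^sub>R hol_axis H"
    using s by (simp add: ax flip: s_def) (simp add: Y_def)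
qed

lemma trace_conj: "ct U ** U = mat 1 \<Longrightarrow> trace (U ** X ** ct U) = trace X"
  using trace_mult_commute[of "U ** X" "ct U"] by (simp add: unitary_cancel)

lemma hol_axis_conj: "ct U ** U = mat 1 \<Longrightarrow> hol_axis (U ** H ** ct U) = U ** hol_axis H ** ct U"
  by (simp add: hol_axis_def trace_conj matrix_distribs unitary_cancel)

text \<open>Liouville's formula in the traceless case; it supplies the determinant condition that
  places the holonomy in \<open>SU2\<close>.\<close>

lemma det_ode_const:
  assumes S: "convex S" "s \<in> S" "t \<in> S"
    and y: "\<And>t. t \<in> S \<Longrightarrow> (y has_vector_derivative M t ** y t) (at t within S)"
    and M: "\<And>t. t \<in> S \<Longrightarrow> trace (M t :: mat2) = 0"
  shows "det (y t) = det (y s)"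
proof (rule has_derivative_zero_unique[OF S(1) _ S(3,2)])
  fix t assume t: "t \<in> S"
  have e: "((\<lambda>t. y t $ i $ j) has_vector_derivative (M t ** y t) $ i $ j) (at t within S)" for i j
    by (rule bounded_linear.has_vector_derivative[OF
          bounded_linear_compose[OF bounded_linear_vec_nth bounded_linear_vec_nth] y[OF t]])
  have "M t $ 2 $ 2 = - (M t $ 1 $ 1)" using M[OF t] by (simp add: trace_def sum_2 add_eq_0_iff)
  then have z: "(y t $ 1 $ 1 * (M t ** y t) $ 2 $ 2 + (M t ** y t) $ 1 $ 1 * y t $ 2 $ 2)
      - (y t $ 1 $ 2 * (M t ** y t) $ 2 $ 1 + (M t ** y t) $ 1 $ 2 * y t $ 2 $ 1) = 0"
    by (simp add: matrix_matrix_mult_def sum_2 algebra_simps)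
  have "((\<lambda>t. det (y t)) has_vector_derivative 0) (at t within S)"
    unfolding det_2 z[symmetric]
    by (intro has_vector_derivative_diff has_vector_derivative_mult e)
  then show "((\<lambda>t. det (y t)) has_derivative (\<lambda>h. 0)) (at t within S)"
    by (simp add: has_vector_derivative_def)
qed

context cylinder
begin

section \<open>Parallel frames on the strip and their monodromy\<close>

lemma convex_D: "convex D"
  unfolding D_def by (intro convex_Times) auto

lemma origin_in_D: "(0, 0) \<in> D" and central_in_D: "(\<theta>, 0) \<in> D"
  by (auto simp: D_def)

text \<open>The curve runs through \<open>2 * pi * r\<close>, hence the factor. At the end points
  only one-sided derivatives are available, and these are unique on a closed interval.\<close>

lemma pullback_central:
  assumes A: "\<And>c p. c \<in> atl \<Longrightarrow> p \<in> cdom c \<Longrightarrow> linear (A c p)" and r: "r \<in> {0..1}"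
  shows "pullback1 atl (central_curve u) {0..1} A r 1 = (2 * pi) *\<^sub>R pb A (2 * pi * r, 0) (1, 0)"
proof -
  let ?x = "(2 * pi * r, 0) :: real \<times> real"
  let ?c = "chart_at atl (u ?x)"
  have x: "?x \<in> D" by (rule central_in_D)
  have c: "?c \<in> atl" "?x \<in> Dc ?c" using chart_at[of "u ?x"] x by (auto simp: Dc_def)
  have "((\<lambda>r. (2 * pi * r, 0::real)) has_derivative (\<lambda>h. (2 * pi * h, 0))) (at r within {0..1})"
    by (auto intro!: derivative_eq_intros)
  from diff_chain_within[OF this has_derivative_at_withinI[OF kappa_deriv[OF c]]]
  have d: "((cmap ?c \<circ> central_curve u) has_derivative (\<lambda>h. dk ?c ?x (2 * pi * h, 0))) (at r within {0..1})"
    by (simp add: o_def central_curve_def)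
  then have "((cmap ?c \<circ> central_curve u) has_derivative
      frechet_derivative (cmap ?c \<circ> central_curve u) (at r within {0..1})) (at r within {0..1})"
    using frechet_derivative_works differentiable_def by blast
  then have "frechet_derivative (cmap ?c \<circ> central_curve u) (at r within {0..1}) = (\<lambda>h. dk ?c ?x (2 * pi * h, 0))"
    using frechet_derivative_unique_within_closed_interval[of 0 1 r] d r by (simp add: cbox_interval)
  then have "coord_deriv atl (central_curve u) {0..1} r 1 = dk ?c ?x (2 * pi, 0)"
    by (simp add: coord_deriv_def central_curve_def)
  then have "pullback1 atl (central_curve u) {0..1} A r 1 = A ?c (u ?x) (dk ?c ?x (2 * pi, 0))"
    by (simp add: pullback1_def central_curve_def)
  also have "\<dots> = pb A ?x (2 * pi, 0)" by (rule pb_chart_at[OF x, symmetric])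
  also have "\<dots> = pb A ?x ((2 * pi) *\<^sub>R (1, 0))" by simp
  also have "\<dots> = (2 * pi) *\<^sub>R pb A ?x (1, 0)" by (rule linear_scale[OF pb_linear[OF A x]])
  finally show ?thesis .
qed

text \<open>Antihermitian coefficients make the solution unique and unitary, so the definite
  description denotes and the inverse is the adjoint. The hypotheses do not mention flatness: the
  lemma also has to serve A + \<epsilon>B.\<close>

lemma hol_eq:
  assumes A: "\<And>c p. c \<in> atl \<Longrightarrow> p \<in> cdom c \<Longrightarrow> linear (A c p)"
    and skew: "\<And>\<theta> v. ct (pb A (\<theta>, 0) v) = - pb A (\<theta>, 0) v"
    and h: "h 0 = mat 1" "\<And>r. r \<in> {0..1} \<Longrightarrow>
      (h has_vector_derivative ((2 * pi) *\<^sub>R pb A (2 * pi * r, 0) (1, 0)) ** h r) (at r within {0..1})"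
  shows "hol atl (central_curve u) A = ct (h 1)"
proof -
  let ?M = "\<lambda>r. (2 * pi) *\<^sub>R pb A (2 * pi * r, 0) (1, 0)"
  have M: "ct (?M r) = - ?M r" for r using skew by simp
  have inv: "matrix_inv (h 1) = ct (h 1)"
    by (rule matrix_inv_unitary, rule ode_unitary[where S="{0..1}" and M="?M"]) (use h M in auto)
  have uniq: "k 1 = h 1" if "k 0 = mat 1"
    "\<And>r. r \<in> {0..1} \<Longrightarrow> (k has_vector_derivative ?M r ** k r) (at r within {0..1})" for k
    by (rule ode_unique[where S="{0..1}" and M="?M" and y=h and z=k]) (use h that M in auto)
  show ?thesis
    unfolding hol_def
  proof (rule the_equality)
    show "\<exists>k. k 0 = mat 1 \<and> (\<forall>r\<in>{0..1}. (k has_vector_derivative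
        pullback1 atl (central_curve u) {0..1} A r 1 ** k r) (at r within {0..1})) \<and> ct (h 1) = matrix_inv (k 1)"
      using h inv pullback_central[of A, OF A] by (intro exI[of _ h]) simp
    fix g assume "\<exists>k. k 0 = mat 1 \<and> (\<forall>r\<in>{0..1}. (k has_vector_derivative
        pullback1 atl (central_curve u) {0..1} A r 1 ** k r) (at r within {0..1})) \<and> g = matrix_inv (k 1)"
    then obtain k where k: "k 0 = mat 1" "\<forall>r\<in>{0..1}. (k has_vector_derivative
        pullback1 atl (central_curve u) {0..1} A r 1 ** k r) (at r within {0..1})" "g = matrix_inv (k 1)"
      by blast
    have "k 1 = h 1" by (rule uniq[of k, OF k(1)]) (use k(2) pullback_central[of A, OF A] in simp)
    then show "g = ct (h 1)" using k inv by simp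
  qed
qed

lemma flat_Omega1: "A \<in> A_flat atl \<Longrightarrow> A \<in> Omega1 atl"
  by (simp add: A_flat_def)

lemma S_gamma_flat: "A \<in> S_gamma atl u \<Longrightarrow> A \<in> A_flat atl"
  and S_gamma_Omega1: "A \<in> S_gamma atl u \<Longrightarrow> A \<in> Omega1 atl"
  by (simp_all add: S_gamma_def flat_Omega1)

lemma pb_skew: "A \<in> Omega1 atl \<Longrightarrow> x \<in> D \<Longrightarrow> ct (pb A x v) = - pb A x v"
  using pb_su2 su2_skew by blast

lemma frame_line:
  assumes lin: "\<And>c p. c \<in> atl \<Longrightarrow> p \<in> cdom c \<Longrightarrow> linear (\<omega> c p)"
    and \<phi>: "\<And>x. x \<in> D \<Longrightarrow> (\<phi> has_derivative (\<lambda>v. pb \<omega> x v ** \<phi> x)) (at x)"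
  shows "((\<lambda>r. \<phi> (2 * pi * r, 0)) has_vector_derivative
      ((2 * pi) *\<^sub>R pb \<omega> (2 * pi * r, 0) (1, 0)) ** \<phi> (2 * pi * r, 0)) (at r within S)"
proof -
  have "(\<phi> has_derivative (\<lambda>v. pb \<omega> (2 * pi * r, 0) v ** \<phi> (2 * pi * r, 0))) (at ((0, 0) + r *\<^sub>R (2 * pi, 0)))"
    using \<phi>[OF central_in_D[of "2 * pi * r"]] by (simp add: mult.commute)
  from has_vector_derivative_line[OF this]
  have "((\<lambda>r. \<phi> (2 * pi * r, 0)) has_vector_derivative pb \<omega> (2 * pi * r, 0) (2 * pi, 0) ** \<phi> (2 * pi * r, 0)) (at r)"
    by (simp add: mult.commute)
  moreover have "pb \<omega> (2 * pi * r, 0) ((2 * pi) *\<^sub>R (1, 0)) = (2 * pi) *\<^sub>R pb \<omega> (2 * pi * r, 0) (1, 0)"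
    by (rule linear_scale[OF pb_linear[OF lin central_in_D]])
  ultimately show ?thesis using has_vector_derivative_at_within by fastforce
qed

lemma frame_hol:
  assumes lin: "\<And>c p. c \<in> atl \<Longrightarrow> p \<in> cdom c \<Longrightarrow> linear (\<omega> c p)"
    and skew: "\<And>x v. x \<in> D \<Longrightarrow> ct (pb \<omega> x v) = - pb \<omega> x v"
    and \<phi>: "\<phi> (0, 0) = mat 1" "\<And>x. x \<in> D \<Longrightarrow> (\<phi> has_derivative (\<lambda>v. pb \<omega> x v ** \<phi> x)) (at x)"
  shows "hol atl (central_curve u) \<omega> = ct (\<phi> (2 * pi, 0))"
  using hol_eq[of \<omega> "\<lambda>r. \<phi> (2 * pi * r, 0)", OF lin skew[OF central_in_D] _ frame_line[of \<omega> \<phi>, OF lin \<phi>(2)]] \<phi>(1)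
  by simp

text \<open>The strip is star-shaped about the origin, so the pulled-back flat connection has a
  global frame there, although on the cylinder itself the frame is multivalued. The last property
  identifies the multivaluedness: a full turn is right multiplication by the inverse
  holonomy.\<close>

lemma frame_exists:
  assumes A: "A \<in> A_flat atl"
  obtains \<phi> where "\<phi> (0, 0) = mat 1" "\<And>x. x \<in> D \<Longrightarrow> (\<phi> has_derivative (\<lambda>v. pb A x v ** \<phi> x)) (at x)"
    "\<And>x. x \<in> D \<Longrightarrow> ct (\<phi> x) ** \<phi> x = mat 1" "hol atl (central_curve u) A = ct (\<phi> (2 * pi, 0))"
    "hol atl (central_curve u) A \<in> SU2"
    "\<And>\<theta> s. s \<in> {-1<..<1} \<Longrightarrow> \<phi> (\<theta> + 2 * pi, s) = \<phi> (\<theta>, s) ** \<phi> (2 * pi, 0)"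
proof -
  note A1 = flat_Omega1[OF A]
  have star: "r *\<^sub>R x \<in> D" if "x \<in> D" "r \<in> {0..1}" for x and r :: real
  proof -
    have "\<bar>r\<bar> * \<bar>snd x\<bar> \<le> 1 * \<bar>snd x\<bar>" using that(2) by (intro mult_right_mono) auto
    moreover have "\<bar>snd x\<bar> < 1" using that(1) by (auto simp: D_def)
    ultimately have "\<bar>r * snd x\<bar> < 1" by (simp add: abs_mult)
    then show ?thesis by (cases x) (auto simp: D_def)
  qed
  obtain \<phi> where \<phi>: "\<phi> 0 = mat 1" "\<And>x. x \<in> D \<Longrightarrow> (\<phi> has_derivative (\<lambda>v. pb A x v ** \<phi> x)) (at x)"
    "\<And>x. x \<in> D \<Longrightarrow> ct (\<phi> x) ** \<phi> x = mat 1"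
  proof (rule flat_parallel_frame[of D "pb A"])
    show "0 \<in> D" using origin_in_D by (simp add: zero_prod_def)
    show "linear (pb A x)" if "x \<in> D" for x by (rule pb_linear[OF Omega1_linear[OF A1] that])
    show "smooth_on D (\<lambda>x. pb A x v)" for v by (rule pb_smooth[OF A1])
    show "frechet_derivative (\<lambda>x. pb A x w) (at x) v - frechet_derivative (\<lambda>x. pb A x v) (at x) w
        = bracket (pb A x v) (pb A x w)" if "x \<in> D" for x v w by (rule pb_flat[OF A that])
  qed (auto intro: open_D star pb_skew[OF A1])
  let ?h = "\<lambda>r. \<phi> (2 * pi * r, 0)"
  note h = frame_line[of A \<phi>, OF Omega1_linear[OF A1] \<phi>(2)]
  have \<phi>0: "\<phi> (0, 0) = mat 1" using \<phi>(1) by (simp add: zero_prod_def)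
  have hol: "hol atl (central_curve u) A = ct (\<phi> (2 * pi, 0))"
    by (rule frame_hol[OF Omega1_linear[OF A1] pb_skew[OF A1] \<phi>0 \<phi>(2)])
  have "det (?h 1) = det (?h 0)"
    by (rule det_ode_const[where S="{0..1}", OF _ _ _ h])
      (use su2_trace[OF pb_su2[OF A1 central_in_D]] in auto)
  then have "det (\<phi> (2 * pi, 0)) = 1" using \<phi>0 by (simp add: det_2 mat_def)
  then have "det (ct (\<phi> (2 * pi, 0))) = 1"
    by (simp add: det_2 conj_transpose_def) (metis (no_types, lifting) complex_cnj_diff complex_cnj_mult complex_cnj_one mult.commute)
  then have SU2: "hol atl (central_curve u) A \<in> SU2"
    using \<phi>(3)[OF central_in_D] by (simp add: hol SU2_def)
  have per: "\<phi> (\<theta> + 2 * pi, s) = \<phi> (\<theta>, s) ** \<phi> (2 * pi, 0)" if s: "s \<in> {-1<..<1}" for \<theta> s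
  proof -
    have shift: "x + (2 * pi, 0) \<in> D" if "x \<in> D" for x using that by (auto simp: D_def)
    \<comment> \<open>The pulled-back connection is periodic, so the translated frame solves the
      same equation and differs from \<phi> by a constant right factor, which is read off at the
      origin.\<close>
    let ?Y = "\<lambda>x. \<phi> (x + (2 * pi, 0))"
    have Y: "(?Y has_derivative (\<lambda>v. pb A x v ** ?Y x)) (at x)" if x: "x \<in> D" for x
    proof -
      have "((\<lambda>z. z + (2 * pi, 0)) has_derivative (\<lambda>v. v)) (at x)" by (auto intro!: derivative_eq_intros)
      from diff_chain_at[OF this \<phi>(2)[OF shift[OF x]]]
      have "(?Y has_derivative (\<lambda>v. pb A (x + (2 * pi, 0)) v ** ?Y x)) (at x)" by (simp add: o_def)
      moreover have "pb A (x + (2 * pi, 0)) v = pb A x v" for v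
        using pb_periodic[OF Omega1_covariant[OF A1]] x by (cases x) (auto simp: periodic_def D_def)
      ultimately show ?thesis by simp
    qed
    have x: "(\<theta>, s) \<in> D" using s by (simp add: D_def)
    have "ct (\<phi> (\<theta>, s)) ** ?Y (\<theta>, s) = ct (\<phi> (0, 0)) ** ?Y (0, 0)"
    proof (rule has_derivative_zero_unique[OF convex_D _ x origin_in_D])
      fix x assume x: "x \<in> D"
      have "((\<lambda>x. ct (\<phi> x) ** ?Y x) has_derivative
          (\<lambda>v. ct (\<phi> x) ** (pb A x v ** ?Y x) + ct (pb A x v ** \<phi> x) ** ?Y x)) (at x within D)"
        by (rule has_derivative_at_withinI[OF bounded_bilinear.FDERIV[OF bounded_bilinear_mat2
              bounded_linear.has_derivative[OF bounded_linear_ct \<phi>(2)[OF x]] Y[OF x]]])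
      then show "((\<lambda>x. ct (\<phi> x) ** ?Y x) has_derivative (\<lambda>v. 0)) (at x within D)"
        by (simp add: ct_mult pb_skew[OF A1 x] matrix_mul_assoc)
    qed
    then have "\<phi> (\<theta>, s) ** (ct (\<phi> (\<theta>, s)) ** ?Y (\<theta>, s)) = \<phi> (\<theta>, s) ** ?Y (0, 0)" by (simp add: \<phi>0)
    then show ?thesis by (simp add: unitary_cancel[OF \<phi>(3)[OF x]])
  qed
  show thesis
    by (rule that[of \<phi>]) (fact \<phi>0 \<phi>(2) \<phi>(3) hol SU2 per)+
qed

text \<open>The axis is specified by its equation and its value at the base point rather than by the
  holonomies of all circles. In this form it can be verified directly for shifted and for
  gauge-transformed connections.\<close>

definition cov_const :: "('a, mat2) form1 \<Rightarrow> (real \<times> real \<Rightarrow> mat2) \<Rightarrow> bool" where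
  "cov_const A X \<longleftrightarrow> (\<forall>x\<in>D. (X has_derivative (\<lambda>v. bracket (pb A x v) (X x))) (at x)) \<and>
     X (0, 0) = hol_axis (hol atl (central_curve u) A)"

text \<open>The difference of two solutions satisfies the same linear equation, so its length is
  constant, and it vanishes at the origin.\<close>

lemma cov_const_unique:
  assumes skew: "\<And>x v. x \<in> D \<Longrightarrow> ct (pb A x v) = - pb A x v"
    and X: "cov_const A X" and Y: "cov_const A Y" and x: "x \<in> D"
  shows "X x = Y x"
proof -
  let ?Z = "\<lambda>x. X x - Y x"
  have "?Z x \<bullet> ?Z x = ?Z (0, 0) \<bullet> ?Z (0, 0)"
  proof (rule has_derivative_zero_unique[OF convex_D _ x origin_in_D])
    fix x assume x: "x \<in> D"
    have Z: "(?Z has_derivative (\<lambda>v. bracket (pb A x v) (?Z x))) (at x within D)"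
    proof (rule has_derivative_at_withinI)
      have "(X has_derivative (\<lambda>v. bracket (pb A x v) (X x))) (at x)"
        "(Y has_derivative (\<lambda>v. bracket (pb A x v) (Y x))) (at x)"
        using X Y x unfolding cov_const_def by blast+
      from has_derivative_diff[OF this]
      show "(?Z has_derivative (\<lambda>v. bracket (pb A x v) (?Z x))) (at x)"
        by (simp add: bounded_bilinear.diff_right[OF bounded_bilinear_bracket])
    qed
    from has_derivative_inner[OF Z Z]
    show "((\<lambda>x. ?Z x \<bullet> ?Z x) has_derivative (\<lambda>v. 0)) (at x within D)"
      using bracket_inner_self[OF skew[OF x]] by (simp add: inner_commute)
  qed
  then show ?thesis using X Y by (simp add: cov_const_def)
qed

text \<open>Determined on \<open>D\<close> only; the values elsewhere are junk and never used.\<close>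

definition ax :: "('a, mat2) form1 \<Rightarrow> real \<times> real \<Rightarrow> mat2" where
  "ax A = (SOME X. cov_const A X)"

lemma ax_eq:
  assumes "\<And>x v. x \<in> D \<Longrightarrow> ct (pb A x v) = - pb A x v" "cov_const A X" "x \<in> D"
  shows "ax A x = X x"
  using cov_const_unique[OF assms(1) _ assms(2,3)] someI[of "cov_const A", OF assms(2)]
  by (simp add: ax_def)

text \<open>Existence comes from conjugating the base axis by the frame; periodicity holds because
  the inverse holonomy commutes with the axis of the holonomy. Smoothness is bootstrapped from the
  equation of the axis, as the frame itself is only known to be differentiable.\<close>

lemma
  assumes A: "A \<in> S_gamma atl u"
  shows cov_const_ax: "cov_const A (ax A)"
    and hol_SU2: "hol atl (central_curve u) A \<in> SU2"
    and ax_su2: "x \<in> D \<Longrightarrow> ax A x \<in> su2"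
    and ax_square: "x \<in> D \<Longrightarrow> ax A x ** ax A x = - mat 1"
    and ax_periodic: "periodic (ax A)"
    and ax_smooth: "smooth_on D (ax A)"
proof -
  note A1 = S_gamma_Omega1[OF A]
  let ?H = "hol atl (central_curve u) A"
  obtain \<phi> where \<phi>: "\<phi> (0, 0) = mat 1" "\<And>x. x \<in> D \<Longrightarrow> (\<phi> has_derivative (\<lambda>v. pb A x v ** \<phi> x)) (at x)"
    "\<And>x. x \<in> D \<Longrightarrow> ct (\<phi> x) ** \<phi> x = mat 1" "?H = ct (\<phi> (2 * pi, 0))" "?H \<in> SU2"
    "\<And>\<theta> s. s \<in> {-1<..<1} \<Longrightarrow> \<phi> (\<theta> + 2 * pi, s) = \<phi> (\<theta>, s) ** \<phi> (2 * pi, 0)"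
    using frame_exists[OF S_gamma_flat[OF A]] by blast
  show "?H \<in> SU2" by fact
  have "?H \<noteq> mat 1" "?H \<noteq> - mat 1" using A by (auto simp: S_gamma_def)
  note ax0 = SU2_hol_axis(2,3)[OF \<phi>(5) this]
  let ?X = "\<lambda>x. \<phi> x ** hol_axis ?H ** ct (\<phi> x)"
  have "(?X has_derivative (\<lambda>v. bracket (pb A x v) (?X x))) (at x)" if x: "x \<in> D" for x
  proof -
    have "(?X has_derivative (\<lambda>v. (\<phi> x ** hol_axis ?H) ** ct (pb A x v ** \<phi> x)
        + (\<phi> x ** 0 + (pb A x v ** \<phi> x) ** hol_axis ?H) ** ct (\<phi> x))) (at x)"
      by (intro bounded_bilinear.FDERIV[OF bounded_bilinear_mat2] has_derivative_const
          bounded_linear.has_derivative[OF bounded_linear_ct] \<phi>(2) x)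
    then show ?thesis
      by (simp add: bracket_def ct_mult pb_skew[OF A1 x] matrix_mul_assoc)
  qed
  then have X: "cov_const A ?X" by (simp add: cov_const_def \<phi>(1))
  then show cc: "cov_const A (ax A)" unfolding ax_def by (rule someI[of "cov_const A"])
  have eq: "ax A x = ?X x" if "x \<in> D" for x
    by (rule cov_const_unique[OF pb_skew[OF A1] cc X that])
  show "ax A x \<in> su2" if "x \<in> D"
    using eq[OF that] su2_conj[OF ax0(1) \<phi>(3)[OF that]] by simp
  show "ax A x ** ax A x = - mat 1" if "x \<in> D"
  proof -
    have "?X x ** ?X x = \<phi> x ** hol_axis ?H ** (ct (\<phi> x) ** \<phi> x) ** hol_axis ?H ** ct (\<phi> x)"
      by (simp only: matrix_mul_assoc)
    also have "\<dots> = \<phi> x ** (hol_axis ?H ** hol_axis ?H) ** ct (\<phi> x)"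
      by (simp add: \<phi>(3)[OF that] matrix_mul_assoc)
    also have "\<dots> = - mat 1" by (simp add: ax0 unitary_cancel(1)[OF \<phi>(3)[OF that]])
    finally show ?thesis by (simp add: eq[OF that])
  qed
  show "periodic (ax A)"
    unfolding periodic_def
  proof (intro allI ballI)
    fix \<theta> s :: real assume s: "s \<in> {-1<..<1}"
    then have D: "(\<theta> + 2 * pi, s) \<in> D" "(\<theta>, s) \<in> D" by (auto simp: D_def)
    let ?C = "\<phi> (2 * pi, 0)"
    have C: "ct ?C ** ?C = mat 1" by (rule \<phi>(3)[OF central_in_D])
    have "?C ** hol_axis ?H ** ct ?C = hol_axis (?C ** ?H ** ct ?C)" by (rule hol_axis_conj[OF C, symmetric])
    also have "\<dots> = hol_axis ?H" by (simp add: \<phi>(4) unitary_cancel(1)[OF C])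
    finally have "\<phi> (\<theta>, s) ** (?C ** hol_axis ?H ** ct ?C) ** ct (\<phi> (\<theta>, s)) = ?X (\<theta>, s)" by simp
    then have "?X (\<theta> + 2 * pi, s) = ?X (\<theta>, s)" by (simp add: \<phi>(6)[OF s] ct_mult matrix_mul_assoc)
    then show "ax A (\<theta> + 2 * pi, s) = ax A (\<theta>, s)" by (simp add: eq[OF D(1)] eq[OF D(2)])
  qed
  show "smooth_on D (ax A)"
  proof (rule smooth_on_bootstrap[OF open_D])
    show "(ax A has_derivative (\<lambda>v. bracket (pb A x v) (ax A x))) (at x)" if "x \<in> D" for x
      using cc that by (simp add: cov_const_def)
    fix k v assume "Ck_on k D (ax A)"
    then show "Ck_on k D (\<lambda>x. bracket (pb A x v) (ax A x))"
      using pb_smooth[OF A1, of v] open_D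
      by (intro Ck_on_bilinear[OF _ bounded_bilinear_bracket]) (auto simp: smooth_on_open)
  qed
qed

lemma ax_deriv: "A \<in> S_gamma atl u \<Longrightarrow> x \<in> D \<Longrightarrow>
    (ax A has_derivative (\<lambda>v. bracket (pb A x v) (ax A x))) (at x)"
  using cov_const_ax by (simp add: cov_const_def)

end

section \<open>Shifting a connection along the axis of its holonomy\<close>

text \<open>Functions of the coordinate \<open>s\<close> whose multiples of \<open>ds\<close> extend by zero to the surface.\<close>

definition tame :: "(real \<Rightarrow> real) \<Rightarrow> bool" where
  "tame \<alpha> \<longleftrightarrow> smooth_on UNIV \<alpha> \<and> (\<forall>s. s < - (3/4) \<or> 3/4 < s \<longrightarrow> \<alpha> s = 0)"

lemma tame_smooth_snd:
  assumes "tame \<alpha>" "open S"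
  shows "smooth_on S (\<lambda>x :: real \<times> real. \<alpha> (snd x))"
proof (rule smooth_on_compose[where f=\<alpha> and g=snd, OF assms(2) open_UNIV])
  show "smooth_on UNIV \<alpha>" using assms(1) by (simp add: tame_def)
  show "smooth_on S (snd :: real \<times> real \<Rightarrow> real)"
    using smooth_on_snd[OF assms(2) smooth_on_id[OF assms(2)]] by simp
qed simp

lemma Omega1_add:
  assumes A: "A \<in> Omega1 atl" and B: "B \<in> Omega1 atl"
    and op: "\<And>c. c \<in> atl \<Longrightarrow> open (cmap c ` cdom c)"
  shows "(\<lambda>c p v. A c p v + B c p v) \<in> Omega1 atl"
proof (rule Omega1I)
  fix c d p v assume "c \<in> atl" "d \<in> atl" "p \<in> cdom c" "p \<in> cdom d"
  then show "A c p v + B c p v = A d p (frechet_derivative (cmap d \<circ> cinv c) (at (cmap c p)) v)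
      + B d p (frechet_derivative (cmap d \<circ> cinv c) (at (cmap c p)) v)"
    by (intro arg_cong2[where f="(+)"] Omega1_transition[OF A] Omega1_transition[OF B])
qed (intro linear_compose_add su2_add smooth_on_add op Omega1_linear[OF A] Omega1_linear[OF B]
      Omega1_su2[OF A] Omega1_su2[OF B] Omega1_smooth[OF A] Omega1_smooth[OF B]
    | simp add: Omega1_zero[OF A] Omega1_zero[OF B])+

lemma Omega1_scaleR:
  assumes A: "A \<in> Omega1 atl" and op: "\<And>c. c \<in> atl \<Longrightarrow> open (cmap c ` cdom c)"
  shows "(\<lambda>c p v. r *\<^sub>R A c p v) \<in> Omega1 atl"
proof (rule Omega1I)
  fix c d p v assume "c \<in> atl" "d \<in> atl" "p \<in> cdom c" "p \<in> cdom d"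
  then show "r *\<^sub>R A c p v = r *\<^sub>R A d p (frechet_derivative (cmap d \<circ> cinv c) (at (cmap c p)) v)"
    by (intro arg_cong2[where f="(*\<^sub>R)"] refl Omega1_transition[OF A])
qed (intro linear_compose_scale_right su2_scaleR smooth_on_scaleR smooth_on_const op Omega1_linear[OF A]
      Omega1_su2[OF A] Omega1_smooth[OF A] | simp add: Omega1_zero[OF A])+

context cylinder
begin

text \<open>Compact, hence closed in the Hausdorff surface, and contained in the open set
  \<open>U\<close>. Thus \<open>U\<close> and the complement of \<open>K\<close> cover the surface,
  and objects given by a formula on \<open>U\<close> and trivial off \<open>K\<close> are smooth
  everywhere.\<close>

definition K :: "'a set" where "K = u ` (UNIV \<times> {-(3/4)..3/4})"

lemma compact_u_band:
  assumes "a \<le> b" "-1 \<le> a" "b \<le> 1"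
  shows "compact (u ` (UNIV \<times> {a..b}))"
proof -
  have "u ` (UNIV \<times> {a..b}) = u ` ({0..2 * pi} \<times> {a..b})"
  proof
    show "u ` (UNIV \<times> {a..b}) \<subseteq> u ` ({0..2 * pi} \<times> {a..b})"
    proof (rule image_subsetI)
      fix x :: "real \<times> real" assume x: "x \<in> UNIV \<times> {a..b}"
      define k where "k = \<lfloor>fst x / (2 * pi)\<rfloor>"
      have "of_int k \<le> fst x / (2 * pi)" "fst x / (2 * pi) \<le> of_int k + 1"
        unfolding k_def by linarith+
      then have "2 * pi * of_int k \<le> fst x" "fst x \<le> 2 * pi * of_int k + 2 * pi"
        by (auto simp: field_simps)
      then have "(fst x - 2 * pi * of_int k, snd x) \<in> {0..2 * pi} \<times> {a..b}" using x by auto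
      moreover have "u x = u (fst x - 2 * pi * of_int k, snd x)"
        using x assms by (subst u_eq_iff) (auto simp: strip_def intro!: exI[of _ "- k"])
      ultimately show "u x \<in> u ` ({0..2 * pi} \<times> {a..b})" by blast
    qed
  qed auto
  also have "compact \<dots>"
    by (rule compact_continuous_image[OF continuous_on_subset[OF continuous_u]])
      (use assms in \<open>auto simp: strip_def intro: compact_Times\<close>)
  finally show ?thesis .
qed

lemma closed_K: "closed K"
  using compact_u_band[of "-(3/4)" "3/4"] by (simp add: K_def compact_imp_closed)

lemma K_subset_U: "K \<subseteq> U"
  unfolding K_def U_def D_def by (intro image_mono Sigma_mono) auto

text \<open>The differential of the coordinate s, read in a chart; s is a genuine function on
  \<open>U\<close> since the ambiguity of \<open>lift\<close> affects the angle only.\<close>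

definition ds :: "'a chart \<Rightarrow> 'a \<Rightarrow> real \<times> real \<Rightarrow> real" where
  "ds c p = frechet_derivative (\<lambda>y. snd (lift (cinv c y))) (at (cmap c p))"

definition axial :: "(real \<Rightarrow> real) \<Rightarrow> ('a, mat2) form1 \<Rightarrow> ('a, mat2) form1" where
  "axial \<alpha> A c p v = (if c \<in> atl \<and> p \<in> cdom c \<and> p \<in> U
     then (\<alpha> (snd (lift p)) * ds c p v) *\<^sub>R ax A (lift p) else 0)"

definition shift :: "(real \<Rightarrow> real) \<Rightarrow> ('a, mat2) form1 \<Rightarrow> ('a, mat2) form1" where
  "shift \<alpha> A = (\<lambda>c p v. A c p v + axial \<alpha> A c p v)"

lemma smooth_snd_D: "smooth_on D (snd :: real \<times> real \<Rightarrow> real)"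
  using smooth_on_snd[OF open_D smooth_on_id[OF open_D]] by simp

lemma ds_smooth: "c \<in> atl \<Longrightarrow> smooth_on (cmap c ` (cdom c \<inter> U)) (\<lambda>y. snd (lift (cinv c y)))"
  by (rule descend_smooth[OF smooth_snd_D periodic_snd])

lemma ds_dk:
  assumes "c \<in> atl" "x \<in> Dc c"
  shows "ds c (u x) (dk c x v) = snd v"
proof -
  have "frechet_derivative (snd :: real \<times> real \<Rightarrow> real) (at x) = snd"
    by (rule frechet_derivative_at[symmetric]) (rule bounded_linear_imp_has_derivative[OF bounded_linear_snd])
  then show ?thesis
    using descend_deriv[OF smooth_snd_D periodic_snd assms] by (simp add: ds_def)
qed

lemma ds_linear: "c \<in> atl \<Longrightarrow> p \<in> cdom c \<Longrightarrow> p \<in> U \<Longrightarrow> linear (ds c p)"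
  unfolding ds_def
  by (rule has_derivative_linear[OF smooth_on_has_derivative[OF open_chart_image[OF _ open_U] ds_smooth]]) auto

lemma lift_Dc: "p \<in> cdom c \<Longrightarrow> p \<in> U \<Longrightarrow> lift p \<in> Dc c"
  using lift by (simp add: Dc_def)

lemma axial_off_K:
  assumes \<alpha>: "tame \<alpha>" and p: "p \<notin> K"
  shows "axial \<alpha> A c p v = 0"
proof (cases "p \<in> U")
  case True
  have "\<alpha> (snd (lift p)) = 0" if "p \<in> U"
  proof (rule ccontr)
    assume "\<alpha> (snd (lift p)) \<noteq> 0"
    then have "- (3/4) \<le> snd (lift p) \<and> snd (lift p) \<le> 3/4" using \<alpha> unfolding tame_def by (meson not_le)
    then have "lift p \<in> UNIV \<times> {-(3/4)..3/4}" by (simp add: mem_Times_iff)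
    then have "u (lift p) \<in> K" unfolding K_def by (rule imageI)
    then show False using p lift(2)[OF that] by simp
  qed
  then show ?thesis using True by (simp add: axial_def)
qed (simp add: axial_def)

lemma pb_axial:
  assumes A: "A \<in> S_gamma atl u" and x: "x \<in> D"
  shows "pb (axial \<alpha> A) x v = (\<alpha> (snd x) * snd v) *\<^sub>R ax A x"
proof -
  have c: "chart_at atl (u x) \<in> atl" "u x \<in> cdom (chart_at atl (u x))" by (rule chart_at)+
  then have "x \<in> Dc (chart_at atl (u x))" using x by (simp add: Dc_def)
  then show ?thesis
    using c u_in_U[OF x] snd_lift[OF x] periodic_lift[OF ax_periodic[OF A] x] ds_dk
    by (simp add: pb_chart_at[OF x] axial_def)
qed

lemma pb_shift:
  "A \<in> S_gamma atl u \<Longrightarrow> x \<in> D \<Longrightarrow> pb (shift \<alpha> A) x v = pb A x v + (\<alpha> (snd x) * snd v) *\<^sub>R ax A x"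
  using pb_axial by (simp add: pb_chart_at shift_def)

lemma axial_Omega1:
  assumes A: "A \<in> S_gamma atl u" and \<alpha>: "tame \<alpha>"
  shows "axial \<alpha> A \<in> Omega1 atl"
proof -
  have "linear (axial \<alpha> A c p)" if "c \<in> atl" "p \<in> cdom c" for c p
    using ds_linear[OF that] by (cases "p \<in> U")
      (auto simp: axial_def linear_iff distrib_left scaleR_add_left mult.left_commute)
  moreover have "axial \<alpha> A c p v \<in> su2" for c p v
    by (simp add: axial_def su2_zero su2_scaleR[OF ax_su2[OF A lift(1)]])
  moreover have "axial \<alpha> A c p v = axial \<alpha> A d p (frechet_derivative (cmap d \<circ> cinv c) (at (cmap c p)) v)"
    if c: "c \<in> atl" and d: "d \<in> atl" and p: "p \<in> cdom c" "p \<in> cdom d" for c d p v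
  proof (cases "p \<in> U")
    case True
    have x: "lift p \<in> Dc c" "lift p \<in> Dc d" "u (lift p) = p" using lift_Dc lift(2) True p by auto
    obtain v' where v: "v = dk c (lift p) v'" by (rule dk_surj[OF c x(1)])
    have "frechet_derivative (cmap d \<circ> cinv c) (at (cmap c p)) v = dk d (lift p) v'"
      using dk_transition[OF c x(1) d x(2), of v'] by (simp add: v x(3))
    moreover have "ds c p v = ds d p (dk d (lift p) v')"
      using ds_dk[OF c x(1)] ds_dk[OF d x(2)] by (simp add: v x(3))
    ultimately show ?thesis using c d p by (simp add: axial_def)
  qed (simp add: axial_def)
  moreover have "smooth_on (cmap c ` cdom c) (\<lambda>y. axial \<alpha> A c (cinv c y) v)" if c: "c \<in> atl" for c v
  proof (rule smooth_on_local)
    fix y assume "y \<in> cmap c ` cdom c"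
    then obtain p where p: "p \<in> cdom c" "y = cmap c p" by blast
    show "\<exists>V. open V \<and> y \<in> V \<and> smooth_on (cmap c ` cdom c \<inter> V) (\<lambda>y. axial \<alpha> A c (cinv c y) v)"
    proof (cases "p \<in> U")
      case True
      let ?V = "cmap c ` (cdom c \<inter> U)"
      have V: "open ?V" by (rule open_chart_image[OF c open_U])
      have "smooth_on ?V (\<lambda>y. (\<alpha> (snd (lift (cinv c y))) * frechet_derivative (\<lambda>y. snd (lift (cinv c y))) (at y) v)
          *\<^sub>R ax A (lift (cinv c y)))"
        by (intro smooth_on_scaleR smooth_on_mult V smooth_on_deriv[OF V ds_smooth[OF c]]
            descend_smooth[OF ax_smooth[OF A] ax_periodic[OF A] c]
            descend_smooth[OF tame_smooth_snd[OF \<alpha> open_D] _ c]) (simp add: periodic_def)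
      then have "smooth_on ?V (\<lambda>y. axial \<alpha> A c (cinv c y) v)"
        by (rule smooth_on_cong) (use c cinv_cmap[OF c] in \<open>auto simp: axial_def ds_def\<close>)
      then show ?thesis using V True p by (intro exI[of _ ?V]) (auto intro: smooth_on_subset)
    next
      case False
      let ?V = "cmap c ` (cdom c \<inter> - K)"
      have V: "open ?V" by (rule open_chart_image[OF c open_Compl[OF closed_K]])
      have "smooth_on ?V (\<lambda>y. axial \<alpha> A c (cinv c y) v)"
        by (rule smooth_on_cong[OF smooth_on_const[OF V, of 0]])
          (auto simp: axial_off_K[OF \<alpha>] cinv_cmap[OF c])
      then show ?thesis using V False K_subset_U p by (intro exI[of _ ?V]) (auto intro: smooth_on_subset)
    qed
  qed
  moreover have "axial \<alpha> A c p v = 0" if "c \<notin> atl \<or> p \<notin> cdom c" for c p v using that by (auto simp: axial_def)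
  ultimately show ?thesis by (intro Omega1I)
qed

lemma shift_Omega1: "A \<in> S_gamma atl u \<Longrightarrow> tame \<alpha> \<Longrightarrow> shift \<alpha> A \<in> Omega1 atl"
  unfolding shift_def by (intro Omega1_add S_gamma_Omega1 axial_Omega1 open_cimage)

text \<open>The linear change of the curvature vanishes by the equation of the axis, and the
  quadratic one because X commutes with itself. So the straight line of connections stays flat
  exactly and not just to first order.\<close>

lemma shift_flat:
  assumes A: "A \<in> S_gamma atl u" and \<alpha>: "tame \<alpha>"
  shows "shift \<alpha> A \<in> A_flat atl"
proof -
  note S1 = shift_Omega1[OF A \<alpha>] and A1 = S_gamma_Omega1[OF A]
  have "curvature (shift \<alpha> A) c p v z = 0" if c: "c \<in> atl" and p: "p \<in> cdom c" for c p v z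
  proof (cases "p \<in> U")
    case True
    define x where "x = lift p"
    have x: "x \<in> Dc c" "u x = p" "x \<in> D" using lift_Dc lift True p by (auto simp: x_def)
    obtain v' z' where vz: "v = dk c x v'" "z = dk c x z'" using dk_surj[OF c x(1)] by metis
    define \<alpha>' where "\<alpha>' s = frechet_derivative \<alpha> (at s) 1" for s
    have \<alpha>': "(\<alpha> has_real_derivative \<alpha>' s) (at s)" for s
      unfolding \<alpha>'_def by (rule smooth_on_has_real_derivative) (use \<alpha> in \<open>simp add: tame_def\<close>)
    \<comment> \<open>The term with \<alpha>' is symmetric in \<open>v\<close> and \<open>z\<close>
      and disappears in the exterior derivative; it is the vanishing of ds \<and> ds.\<close>
    have d: "frechet_derivative (\<lambda>x. pb (shift \<alpha> A) x z) (at x) v = frechet_derivative (\<lambda>x. pb A x z) (at x) v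
        + ((\<alpha> (snd x) * snd z) *\<^sub>R bracket (pb A x v) (ax A x) + (\<alpha>' (snd x) * snd v * snd z) *\<^sub>R ax A x)" for v z
    proof -
      have "((\<lambda>x. \<alpha> (snd x)) has_derivative (\<lambda>v. \<alpha>' (snd x) * snd v)) (at x)"
        using diff_chain_at[OF bounded_linear_imp_has_derivative[OF bounded_linear_snd], of \<alpha>] \<alpha>'[of "snd x"]
        by (simp add: o_def has_field_derivative_def)
      from has_derivative_mult_left[OF this, of "snd z"]
      have "((\<lambda>x. \<alpha> (snd x) * snd z) has_derivative (\<lambda>v. \<alpha>' (snd x) * snd v * snd z)) (at x)" .
      from has_derivative_add[OF smooth_on_has_derivative[OF open_D pb_smooth[OF A1] x(3)]
          has_derivative_scaleR[OF this ax_deriv[OF A x(3)]]]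
      have "((\<lambda>x. pb A x z + (\<alpha> (snd x) * snd z) *\<^sub>R ax A x) has_derivative
        (\<lambda>v. frechet_derivative (\<lambda>x. pb A x z) (at x) v + ((\<alpha> (snd x) * snd z) *\<^sub>R bracket (pb A x v) (ax A x)
          + (\<alpha>' (snd x) * snd v * snd z) *\<^sub>R ax A x))) (at x)" by simp
      then have "((\<lambda>x. pb (shift \<alpha> A) x z) has_derivative
        (\<lambda>v. frechet_derivative (\<lambda>x. pb A x z) (at x) v + ((\<alpha> (snd x) * snd z) *\<^sub>R bracket (pb A x v) (ax A x)
          + (\<alpha>' (snd x) * snd v * snd z) *\<^sub>R ax A x))) (at x)"
        by (rule has_derivative_transform_within_open[OF _ open_D x(3)]) (simp add: pb_shift[OF A])
      from frechet_derivative_at[OF this, symmetric] show ?thesis by simp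
    qed
    have "curvature (shift \<alpha> A) c (u x) (dk c x v') (dk c x z') = 0"
      unfolding pb_curvature[OF S1 c x(1)] d pb_shift[OF A x(3)]
      using pb_flat[OF S_gamma_flat[OF A] x(3), of z' v']
      by (simp add: bracket_def matrix_distribs algebra_simps)
    then show ?thesis by (simp add: vz x(2))
  next
    case False
    then have pK: "p \<notin> K" using K_subset_U by blast
    let ?V = "cmap c ` (cdom c \<inter> - K)"
    have V: "open ?V" by (rule open_chart_image[OF c open_Compl[OF closed_K]])
    have y: "cmap c p \<in> ?V" using p pK by blast
    have eq: "shift \<alpha> A c (cinv c y) z = A c (cinv c y) z" if "y \<in> ?V" for y z
      using that by (auto simp: shift_def axial_off_K[OF \<alpha>] cinv_cmap[OF c])
    have "ext_deriv (shift \<alpha> A) c p v z = ext_deriv A c p v z"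
      unfolding ext_deriv_def using frechet_derivative_cong_open[OF V y eq] by simp
    moreover have "wedge_bracket (shift \<alpha> A) (shift \<alpha> A) c p v z = wedge_bracket A A c p v z"
      using axial_off_K[OF \<alpha> pK] by (simp add: wedge_bracket_def shift_def)
    ultimately have "curvature (shift \<alpha> A) c p v z = curvature A c p v z" by (simp add: curvature_def)
    moreover have "\<forall>c\<in>atl. \<forall>p\<in>cdom c. \<forall>v z. curvature A c p v z = 0"
      using S_gamma_flat[OF A] unfolding A_flat_def by blast
    ultimately show ?thesis using c p by simp
  qed
  then show ?thesis unfolding A_flat_def using S1 by blast
qed

text \<open>The added form vanishes at every point of the central curve, so the differential
  equation that defines the holonomy is literally the same.\<close>

lemma hol_shift:
  assumes A: "A \<in> S_gamma atl u" and \<alpha>: "\<alpha> 0 = 0"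
  shows "hol atl (central_curve u) (shift \<alpha> A) = hol atl (central_curve u) A"
proof -
  have "axial \<alpha> A c (central_curve u r) v = 0" for c r v
    using snd_lift[OF central_in_D] \<alpha> by (simp add: axial_def central_curve_def)
  then have "pullback1 atl (central_curve u) {0..1} (shift \<alpha> A) r v
      = pullback1 atl (central_curve u) {0..1} A r v" for r v
    by (simp add: pullback1_def shift_def)
  then show ?thesis by (simp add: hol_def)
qed

lemma shift_S_gamma:
  "A \<in> S_gamma atl u \<Longrightarrow> tame \<alpha> \<Longrightarrow> \<alpha> 0 = 0 \<Longrightarrow> shift \<alpha> A \<in> S_gamma atl u"
  using shift_flat hol_shift unfolding S_gamma_def by simp

text \<open>Adding a multiple of X to the connection does not alter dX = [A, X], and the base
  holonomy is unchanged. Consequently successive shifts simply add, which makes the flows actions of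
  the additive group.\<close>

lemma ax_shift:
  assumes A: "A \<in> S_gamma atl u" and \<alpha>: "tame \<alpha>" "\<alpha> 0 = 0" and x: "x \<in> D"
  shows "ax (shift \<alpha> A) x = ax A x"
proof (rule ax_eq[OF _ _ x])
  show "ct (pb (shift \<alpha> A) x v) = - pb (shift \<alpha> A) x v" if "x \<in> D" for x v
    by (rule pb_skew[OF shift_Omega1[OF A \<alpha>(1)] that])
  have "bracket (pb (shift \<alpha> A) x v) (ax A x) = bracket (pb A x v) (ax A x)" if "x \<in> D" for x v
    by (simp add: pb_shift[OF A that] bracket_def matrix_distribs)
  then show "cov_const (shift \<alpha> A) (ax A)"
    using cov_const_ax[OF A] by (simp add: cov_const_def hol_shift[of A \<alpha>, OF A \<alpha>(2)])
qed

lemma shift_shift: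
  assumes A: "A \<in> S_gamma atl u" and \<alpha>: "tame \<alpha>" "\<alpha> 0 = 0"
  shows "shift \<beta> (shift \<alpha> A) = shift (\<lambda>s. \<beta> s + \<alpha> s) A"
proof -
  have "axial \<beta> (shift \<alpha> A) c p v + axial \<alpha> A c p v = axial (\<lambda>s. \<beta> s + \<alpha> s) A c p v" for c p v
    using ax_shift[OF A \<alpha> lift(1)[of p]] by (auto simp: axial_def scaleR_add_left distrib_right)
  then show ?thesis by (simp add: shift_def fun_eq_iff add.assoc add.commute[of "axial \<alpha> A _ _ _"])
qed

lemma shift_zero: "shift (\<lambda>s. 0) A = A"
  by (simp add: shift_def axial_def fun_eq_iff)

end

section \<open>Gauge transformations\<close>

lemma SU2_mult: "X \<in> SU2 \<Longrightarrow> Y \<in> SU2 \<Longrightarrow> X ** Y \<in> SU2"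
proof -
  assume X: "X \<in> SU2" and Y: "Y \<in> SU2"
  have "X ** Y ** ct (X ** Y) = X ** (Y ** ct Y) ** ct X" by (simp only: ct_mult matrix_mul_assoc)
  also have "\<dots> = mat 1" using X Y by (simp add: SU2_def)
  finally show "X ** Y \<in> SU2" using X Y by (simp add: SU2_def det_mul)
qed

lemma SU2_ct: "X \<in> SU2 \<Longrightarrow> ct X \<in> SU2"
proof -
  assume X: "X \<in> SU2"
  have "det (ct X) = cnj (det X)" by (simp add: det_2 conj_transpose_def mult.commute)
  then show "ct X \<in> SU2" using X SU2_unitary[OF X] by (simp add: SU2_def)
qed

lemma SU2_one: "mat 1 \<in> SU2" and SU2_minus_one: "- mat 1 \<in> SU2"
  by (simp_all add: SU2_def mat2_simps det_2)

text \<open>This is exp (r X), by Euler's formula, when the square of \<open>X\<close> is minus the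
  identity.\<close>

definition rot :: "real \<Rightarrow> mat2 \<Rightarrow> mat2" where
  "rot r X = cos r *\<^sub>R mat 1 + sin r *\<^sub>R X"

lemma rot_SU2:
  assumes X: "X \<in> su2" "X ** X = - mat 1"
  shows "rot r X \<in> SU2"
proof -
  have "rot r X ** ct (rot r X) = (cos r * cos r) *\<^sub>R mat 1 + (sin r * sin r) *\<^sub>R mat 1"
    using su2_skew[OF X(1)] by (simp add: rot_def matrix_distribs X(2) algebra_simps)
  then have 1: "rot r X ** ct (rot r X) = mat 1"
    by (simp only: scaleR_left_distrib[symmetric] sin_cos_squared_add3 scaleR_one)
  have t: "X $ 2 $ 2 = - (X $ 1 $ 1)" using su2_trace[OF X(1)] by (simp add: trace_def sum_2 add_eq_0_iff)
  have sq: "X $ 1 $ 1 * X $ 1 $ 1 + X $ 1 $ 2 * X $ 2 $ 1 = - 1"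
    using X(2) by (simp add: mat2_simps)
  have e: "rot r X $ i $ j = of_real (cos r) * (mat 1 $ i $ j) + of_real (sin r) * (X $ i $ j)" for i j
    by (simp only: rot_def vector_add_component vector_scaleR_component) (simp only: scaleR_conv_of_real)
  have "det (rot r X) = (of_real (cos r))\<^sup>2 - (of_real (sin r))\<^sup>2 * (X $ 1 $ 1 * X $ 1 $ 1 + X $ 1 $ 2 * X $ 2 $ 1)"
    by (simp add: det_2 e mat_def t algebra_simps power2_eq_square)
  also have "\<dots> = of_real ((cos r)\<^sup>2 + (sin r)\<^sup>2)" by (simp only: sq of_real_add of_real_power) simp
  finally show ?thesis using 1 by (simp add: SU2_def)
qed

lemma tame_add: "tame \<alpha> \<Longrightarrow> tame \<beta> \<Longrightarrow> tame (\<lambda>s. \<alpha> s + \<beta> s)"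
  unfolding tame_def using smooth_on_add[OF open_UNIV, of \<alpha> \<beta>] by simp

lemma tame_cmult: "tame \<alpha> \<Longrightarrow> tame (\<lambda>s. r * \<alpha> s)"
  unfolding tame_def using smooth_on_mult[OF open_UNIV smooth_on_const[OF open_UNIV], of \<alpha> r] by simp

context cylinder
begin

section \<open>Behaviour of pull-backs, holonomy and axis under gauge transformations\<close>

lemma gauge_SU2: "\<psi> \<in> gauge_group atl \<Longrightarrow> \<psi> p \<in> SU2"
  and gauge_smooth: "\<psi> \<in> gauge_group atl \<Longrightarrow> c \<in> atl \<Longrightarrow> smooth_on (cmap c ` cdom c) (\<psi> \<circ> cinv c)"
  unfolding gauge_group_def by blast+

lemma gauge_unitary: "\<psi> \<in> gauge_group atl \<Longrightarrow> ct (\<psi> p) ** \<psi> p = mat 1"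
  using gauge_SU2 SU2_unitary by blast

lemma gauge_deriv:
  assumes "\<psi> \<in> gauge_group atl" "c \<in> atl" "p \<in> cdom c"
  shows "((\<psi> \<circ> cinv c) has_derivative frechet_derivative (\<psi> \<circ> cinv c) (at (cmap c p))) (at (cmap c p))"
  by (rule smooth_on_has_derivative[OF open_cimage gauge_smooth]) (use assms in auto)

lemma gauge_act_eq:
  assumes "\<psi> \<in> gauge_group atl" "c \<in> atl" "p \<in> cdom c"
  shows "gauge_act atl \<psi> A c p v = \<psi> p ** A c p v ** ct (\<psi> p)
      + frechet_derivative (\<psi> \<circ> cinv c) (at (cmap c p)) v ** ct (\<psi> p)"
  using assms matrix_inv_unitary[OF gauge_unitary[OF assms(1)]] by (simp add: gauge_act_def)

lemma gauge_u_deriv: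
  assumes \<psi>: "\<psi> \<in> gauge_group atl" and c: "c \<in> atl" "x \<in> Dc c"
  shows "((\<psi> \<circ> u) has_derivative (\<lambda>v. frechet_derivative (\<psi> \<circ> cinv c) (at (cmap c (u x))) (dk c x v))) (at x)"
proof -
  have p: "u x \<in> cdom c" using c(2) by (simp add: Dc_def)
  have "((\<lambda>x. (\<psi> \<circ> cinv c) ((cmap c \<circ> u) x)) has_derivative
      (\<lambda>v. frechet_derivative (\<psi> \<circ> cinv c) (at (cmap c (u x))) (dk c x v))) (at x)"
    using diff_chain_at[OF kappa_deriv[OF c], of "\<psi> \<circ> cinv c"] gauge_deriv[OF \<psi> c(1) p] by (simp add: o_def)
  then show ?thesis
    by (rule has_derivative_transform_within_open[OF _ open_Dc[OF c(1)] c(2)])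
      (auto simp: Dc_def cinv_cmap[OF c(1)])
qed

lemma gauge_u_frechet:
  assumes \<psi>: "\<psi> \<in> gauge_group atl" and c: "c \<in> atl" "x \<in> Dc c"
  shows "frechet_derivative (\<psi> \<circ> cinv c) (at (cmap c (u x))) (dk c x v) = frechet_derivative (\<psi> \<circ> u) (at x) v"
  using fun_cong[OF frechet_derivative_at[OF gauge_u_deriv[OF assms]], of v] .

lemma gauge_u_has_derivative:
  assumes \<psi>: "\<psi> \<in> gauge_group atl" and x: "x \<in> D"
  shows "((\<psi> \<circ> u) has_derivative frechet_derivative (\<psi> \<circ> u) (at x)) (at x)"
proof -
  obtain c where "c \<in> atl" "x \<in> Dc c" by (rule ex_Dc[OF x])
  from gauge_u_deriv[OF \<psi> this] show ?thesis
    using frechet_derivative_works differentiable_def by blast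
qed

lemma pb_gauge:
  assumes \<psi>: "\<psi> \<in> gauge_group atl" and x: "x \<in> D"
  shows "pb (gauge_act atl \<psi> A) x v = \<psi> (u x) ** pb A x v ** ct (\<psi> (u x))
      + frechet_derivative (\<psi> \<circ> u) (at x) v ** ct (\<psi> (u x))"
proof -
  have c: "chart_at atl (u x) \<in> atl" "u x \<in> cdom (chart_at atl (u x))" by (rule chart_at)+
  then have "x \<in> Dc (chart_at atl (u x))" using x by (simp add: Dc_def)
  from gauge_u_frechet[OF \<psi> c(1) this] show ?thesis
    by (simp add: pb_chart_at[OF x] gauge_act_eq[OF \<psi> c])
qed

text \<open>Differentiating \<psi> ct \<psi> = 1 shows that the inhomogeneous term of the gauge
  action is antihermitian. Together with linearity this is what \<open>frame_hol\<close> and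
  \<open>ax_eq\<close> ask of the transformed connection.\<close>

lemma pb_gauge_skew:
  assumes \<psi>: "\<psi> \<in> gauge_group atl" and A: "A \<in> Omega1 atl" and x: "x \<in> D"
  shows "ct (pb (gauge_act atl \<psi> A) x v) = - pb (gauge_act atl \<psi> A) x v"
proof -
  let ?d = "frechet_derivative (\<psi> \<circ> u) (at x)" and ?p = "\<psi> (u x)"
  note d = gauge_u_has_derivative[OF \<psi> x]
  have "((\<lambda>x. (\<psi> \<circ> u) x ** ct ((\<psi> \<circ> u) x)) has_derivative (\<lambda>v. ?p ** ct (?d v) + ?d v ** ct ?p)) (at x)"
    using bounded_bilinear.FDERIV[OF bounded_bilinear_mat2 d bounded_linear.has_derivative[OF bounded_linear_ct d]]
    by (simp add: o_def)
  moreover have "(\<lambda>x. (\<psi> \<circ> u) x ** ct ((\<psi> \<circ> u) x)) = (\<lambda>x. mat 1)"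
    using unitary_cancel(1)[OF gauge_unitary[OF \<psi>]] by simp
  ultimately have "((\<lambda>x. mat 1 :: mat2) has_derivative (\<lambda>v. ?p ** ct (?d v) + ?d v ** ct ?p)) (at x)" by simp
  from has_derivative_unique[OF this has_derivative_const]
  have "(\<lambda>v. ?p ** ct (?d v) + ?d v ** ct ?p) = (\<lambda>v. 0)" .
  then have "?p ** ct (?d v) + ?d v ** ct ?p = 0" by (rule fun_cong)
  then have "?p ** ct (?d v) = - (?d v ** ct ?p)" by (simp add: eq_neg_iff_add_eq_0)
  then show ?thesis
    by (simp add: pb_gauge[OF \<psi> x] ct_mult pb_skew[OF A x] matrix_mul_assoc)
qed

lemma gauge_act_linear:
  assumes \<psi>: "\<psi> \<in> gauge_group atl" and A: "A \<in> Omega1 atl" and c: "c \<in> atl" "p \<in> cdom c"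
  shows "linear (gauge_act atl \<psi> A c p)"
  using has_derivative_linear[OF gauge_deriv[OF \<psi> c]] Omega1_linear[OF A c]
  by (simp add: linear_iff gauge_act_eq[OF \<psi> c] matrix_distribs scaleR_add_right)

text \<open>Multiplying the frame by \<psi> on the left and by the inverse of its base value on the
  right gives a normalized frame of the transformed connection. After a full turn \<psi> returns to
  its base value, so the holonomy is conjugated.\<close>

lemma hol_gauge:
  assumes \<psi>: "\<psi> \<in> gauge_group atl" and A: "A \<in> S_gamma atl u"
  shows "hol atl (central_curve u) (gauge_act atl \<psi> A)
      = \<psi> (u (0, 0)) ** hol atl (central_curve u) A ** ct (\<psi> (u (0, 0)))"
proof -
  note A1 = S_gamma_Omega1[OF A]
  obtain \<phi> where \<phi>: "\<phi> (0, 0) = mat 1" "\<And>x. x \<in> D \<Longrightarrow> (\<phi> has_derivative (\<lambda>v. pb A x v ** \<phi> x)) (at x)"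
    "hol atl (central_curve u) A = ct (\<phi> (2 * pi, 0))"
    by (rule frame_exists[OF S_gamma_flat[OF A]], rule that, assumption+)
  let ?p = "\<lambda>x. \<psi> (u x)" and ?B = "gauge_act atl \<psi> A"
  let ?F = "\<lambda>x. ?p x ** \<phi> x ** ct (?p (0, 0))"
  have F0: "?F (0, 0) = mat 1" by (simp add: \<phi>(1) unitary_cancel(1)[OF gauge_unitary[OF \<psi>]])
  have "(?F has_derivative (\<lambda>v. pb ?B x v ** ?F x)) (at x)" if x: "x \<in> D" for x
  proof -
    let ?d = "frechet_derivative (\<psi> \<circ> u) (at x)"
    have d: "(?p has_derivative ?d) (at x)" using gauge_u_has_derivative[OF \<psi> x] by (simp add: o_def)
    have "(?F has_derivative (\<lambda>v. (?p x ** \<phi> x) ** 0 + (?p x ** (pb A x v ** \<phi> x) + ?d v ** \<phi> x) ** ct (?p (0, 0)))) (at x)"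
      by (intro bounded_bilinear.FDERIV[OF bounded_bilinear_mat2] has_derivative_const d \<phi>(2) x)
    moreover have "pb ?B x v ** ?F x = (?p x ** (pb A x v ** \<phi> x) + ?d v ** \<phi> x) ** ct (?p (0, 0))" for v
    proof -
      have "pb ?B x v ** ?p x = ?p x ** pb A x v + ?d v"
        by (simp add: pb_gauge[OF \<psi> x] matrix_distribs unitary_cancel[OF gauge_unitary[OF \<psi>]])
      then have "pb ?B x v ** ?p x ** \<phi> x ** ct (?p (0, 0)) = (?p x ** pb A x v + ?d v) ** \<phi> x ** ct (?p (0, 0))"
        by simp
      then show ?thesis by (simp add: matrix_mul_assoc matrix_distribs)
    qed
    ultimately show ?thesis by simp
  qed
  from frame_hol[of ?B ?F, OF gauge_act_linear[OF \<psi> A1] pb_gauge_skew[OF \<psi> A1] F0 this]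
  have "hol atl (central_curve u) ?B = ct (?F (2 * pi, 0))" by blast
  moreover have "u (2 * pi, 0) = u (0, 0)" using u_periodic[of 0 0] by simp
  ultimately show ?thesis by (simp add: \<phi>(3) ct_mult matrix_mul_assoc)
qed

text \<open>The conjugated axis satisfies the equation of the transformed connection and has the
  right base value, because taking the axis commutes with conjugation; uniqueness does the
  rest.\<close>

lemma ax_gauge:
  assumes \<psi>: "\<psi> \<in> gauge_group atl" and A: "A \<in> S_gamma atl u" and x: "x \<in> D"
  shows "ax (gauge_act atl \<psi> A) x = \<psi> (u x) ** ax A x ** ct (\<psi> (u x))"
proof (rule ax_eq[OF pb_gauge_skew[OF \<psi> S_gamma_Omega1[OF A]] _ x])
  let ?p = "\<lambda>x. \<psi> (u x)" and ?B = "gauge_act atl \<psi> A"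
  let ?F = "\<lambda>x. ?p x ** ax A x ** ct (?p x)"
  have "(?F has_derivative (\<lambda>v. bracket (pb ?B x v) (?F x))) (at x)" if x: "x \<in> D" for x
  proof -
    let ?d = "frechet_derivative (\<psi> \<circ> u) (at x)"
    have d: "(?p has_derivative ?d) (at x)" using gauge_u_has_derivative[OF \<psi> x] by (simp add: o_def)
    have "(?F has_derivative (\<lambda>v. (?p x ** ax A x) ** ct (?d v)
        + (?p x ** bracket (pb A x v) (ax A x) + ?d v ** ax A x) ** ct (?p x))) (at x)"
      by (intro bounded_bilinear.FDERIV[OF bounded_bilinear_mat2]
          bounded_linear.has_derivative[OF bounded_linear_ct] d ax_deriv[OF A x])
    moreover have "bracket (pb ?B x v) (?F x) = (?p x ** ax A x) ** ct (?d v)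
        + (?p x ** bracket (pb A x v) (ax A x) + ?d v ** ax A x) ** ct (?p x)" for v
    proof -
      have 1: "pb ?B x v ** ?p x = ?p x ** pb A x v + ?d v"
        by (simp add: pb_gauge[OF \<psi> x] matrix_distribs unitary_cancel[OF gauge_unitary[OF \<psi>]])
      have "ct (?p x) ** pb ?B x v = - ct (pb ?B x v ** ?p x)"
        using pb_gauge_skew[OF \<psi> S_gamma_Omega1[OF A] x, of v] by (simp add: ct_mult)
      also have "\<dots> = pb A x v ** ct (?p x) - ct (?d v)"
        unfolding 1 by (simp add: ct_mult pb_skew[OF S_gamma_Omega1[OF A] x])
      finally have 2: "ct (?p x) ** pb ?B x v = pb A x v ** ct (?p x) - ct (?d v)" .
      have "bracket (pb ?B x v) (?F x) = (pb ?B x v ** ?p x) ** ax A x ** ct (?p x)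
          - ?p x ** ax A x ** (ct (?p x) ** pb ?B x v)" by (simp add: bracket_def matrix_mul_assoc)
      then show ?thesis unfolding 1 2 by (simp add: bracket_def matrix_distribs matrix_mul_assoc algebra_simps)
    qed
    ultimately show ?thesis by simp
  qed
  then show "cov_const ?B ?F"
    using cov_const_ax[OF A]
    by (simp add: cov_const_def hol_gauge[OF \<psi> A] hol_axis_conj[OF gauge_unitary[OF \<psi>]])
qed

lemma shift_gauge:
  assumes \<psi>: "\<psi> \<in> gauge_group atl" and A: "A \<in> S_gamma atl u"
  shows "shift \<alpha> (gauge_act atl \<psi> A) = gauge_act atl \<psi> (shift \<alpha> A)"
proof (intro ext)
  fix c p v
  show "shift \<alpha> (gauge_act atl \<psi> A) c p v = gauge_act atl \<psi> (shift \<alpha> A) c p v"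
  proof (cases "c \<in> atl \<and> p \<in> cdom c")
    case True
    have "axial \<alpha> (gauge_act atl \<psi> A) c p v = \<psi> p ** axial \<alpha> A c p v ** ct (\<psi> p)"
      using ax_gauge[OF \<psi> A lift(1)[of p]] lift(2)[of p] by (simp add: axial_def)
    then show ?thesis using True by (simp add: shift_def gauge_act_eq[OF \<psi>] matrix_distribs)
  next
    case False
    then show ?thesis by (auto simp: shift_def axial_def gauge_act_def)
  qed
qed

lemma gauge_mult:
  assumes \<psi>: "\<psi> \<in> gauge_group atl" and \<rho>: "\<rho> \<in> gauge_group atl"
  shows "(\<lambda>p. \<rho> p ** \<psi> p) \<in> gauge_group atl"
    and "gauge_act atl \<rho> (gauge_act atl \<psi> A) = gauge_act atl (\<lambda>p. \<rho> p ** \<psi> p) A"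
proof -
  let ?m = "\<lambda>p. \<rho> p ** \<psi> p"
  have "smooth_on (cmap c ` cdom c) (?m \<circ> cinv c)" if "c \<in> atl" for c
    using smooth_on_bilinear[OF open_cimage[OF that] bounded_bilinear_mat2 gauge_smooth[OF \<rho> that] gauge_smooth[OF \<psi> that]]
    by (simp add: o_def)
  then show m: "?m \<in> gauge_group atl"
    using SU2_mult[OF gauge_SU2[OF \<rho>] gauge_SU2[OF \<psi>]] by (auto simp: gauge_group_def)
  show "gauge_act atl \<rho> (gauge_act atl \<psi> A) = gauge_act atl ?m A"
  proof (intro ext)
    fix c p v
    show "gauge_act atl \<rho> (gauge_act atl \<psi> A) c p v = gauge_act atl ?m A c p v"
    proof (cases "c \<in> atl \<and> p \<in> cdom c")
      case True
      then have c: "c \<in> atl" "p \<in> cdom c" by auto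
      let ?dp = "frechet_derivative (\<psi> \<circ> cinv c) (at (cmap c p))"
        and ?dc = "frechet_derivative (\<rho> \<circ> cinv c) (at (cmap c p))"
      have "((?m \<circ> cinv c) has_derivative (\<lambda>v. \<rho> p ** ?dp v + ?dc v ** \<psi> p)) (at (cmap c p))"
        using bounded_bilinear.FDERIV[OF bounded_bilinear_mat2 gauge_deriv[OF \<rho> c] gauge_deriv[OF \<psi> c]]
        by (simp add: o_def cinv_cmap[OF c])
      then have d: "frechet_derivative (?m \<circ> cinv c) (at (cmap c p)) v = \<rho> p ** ?dp v + ?dc v ** \<psi> p"
        by (rule fun_cong[OF frechet_derivative_at[symmetric]])
      show ?thesis
        unfolding gauge_act_eq[OF \<rho> c] gauge_act_eq[OF \<psi> c] gauge_act_eq[OF m c] d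
        by (simp add: ct_mult matrix_distribs matrix_mul_assoc unitary_cancel[OF gauge_unitary[OF \<psi>]])
    next
      case False
      then show ?thesis by (auto simp: gauge_act_def)
    qed
  qed
qed

lemma gauge_inverse:
  assumes \<psi>: "\<psi> \<in> gauge_group atl"
  shows "(\<lambda>p. ct (\<psi> p)) \<in> gauge_group atl"
proof -
  have "smooth_on (cmap c ` cdom c) ((\<lambda>p. ct (\<psi> p)) \<circ> cinv c)" if "c \<in> atl" for c
    using smooth_on_linear[OF open_cimage[OF that] bounded_linear_ct gauge_smooth[OF \<psi> that]] by (simp add: o_def)
  then show ?thesis using SU2_ct[OF gauge_SU2[OF \<psi>]] by (auto simp: gauge_group_def)
qed

lemma gauge_one: "(\<lambda>p. mat 1) \<in> gauge_group atl"
  using SU2_one smooth_on_const[OF open_cimage] by (auto simp: gauge_group_def o_def)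

lemma gauge_act_one: "A \<in> Omega1 atl \<Longrightarrow> gauge_act atl (\<lambda>p. mat 1) A = A"
proof (intro ext)
  fix c :: "'a chart" and p v assume A: "A \<in> Omega1 atl"
  have "frechet_derivative ((\<lambda>p. mat 1 :: mat2) \<circ> cinv c) (at (cmap c p)) = (\<lambda>v. 0)"
    by (rule frechet_derivative_at[symmetric]) (simp add: o_def)
  then show "gauge_act atl (\<lambda>p. mat 1) A c p v = A c p v"
    using Omega1_zero[OF A, of c p v] gauge_act_eq[OF gauge_one, of c p A v]
    by (cases "c \<in> atl \<and> p \<in> cdom c") (auto simp: gauge_act_def)
qed

lemma gauge_act_inverse:
  assumes \<psi>: "\<psi> \<in> gauge_group atl" and A: "A \<in> Omega1 atl"
  shows "gauge_act atl (\<lambda>p. ct (\<psi> p)) (gauge_act atl \<psi> A) = A"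
  using gauge_mult(2)[OF \<psi> gauge_inverse[OF \<psi>], of A] gauge_act_one[OF A] gauge_unitary[OF \<psi>] by simp

text \<open>The gauge transformation \<open>exp (g X)\<close>, where \<open>X\<close> is the covariantly constant axis, changes the
  connection by \<open>g' X ds\<close>.\<close>

lemma gauge_rot:
  assumes A: "A \<in> S_gamma atl u" and \<alpha>: "tame \<alpha>"
    and g: "smooth_on UNIV g" "\<And>s. (g has_real_derivative g' s) (at s)" "tame g'"
    and on: "\<And>x. x \<in> D \<Longrightarrow> \<psi> (u x) = rot (g (snd x)) (ax A x)"
    and off: "\<And>p. p \<notin> K \<Longrightarrow> \<exists>N \<epsilon>. open N \<and> p \<in> N \<and> (\<epsilon> = mat 1 \<or> \<epsilon> = - mat 1) \<and> (\<forall>q\<in>N. \<psi> q = \<epsilon>)"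
  shows "\<psi> \<in> gauge_group atl" and "gauge_act atl \<psi> (shift \<alpha> A) = shift (\<lambda>s. \<alpha> s + g' s) A"
proof -
  let ?R = "\<lambda>x. rot (g (snd x)) (ax A x)"
  have smg: "smooth_on D (\<lambda>x. g (snd x))"
    by (rule smooth_on_compose[where f=g and g=snd, OF open_D open_UNIV _ g(1) smooth_snd_D]) simp
  have smR: "smooth_on D ?R"
    unfolding rot_def
    by (intro smooth_on_add smooth_on_scaleR open_D smooth_on_const ax_smooth[OF A]
        smooth_on_compose[where f=cos and g="\<lambda>x. g (snd x)", OF open_D open_UNIV _ smooth_on_cos smg]
        smooth_on_compose[where f=sin and g="\<lambda>x. g (snd x)", OF open_D open_UNIV _ smooth_on_sin smg]) auto
  have perR: "periodic ?R" using ax_periodic[OF A] by (simp add: periodic_def)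
  have SU2: "\<psi> p \<in> SU2" for p
  proof (cases "p \<in> U")
    case True
    then show ?thesis
      using on[OF lift(1)[OF True]] rot_SU2[OF ax_su2[OF A lift(1)[OF True]] ax_square[OF A lift(1)[OF True]]]
      by (simp add: lift(2)[OF True])
  next
    case False
    then have "p \<notin> K" using K_subset_U by blast
    from off[OF this] show ?thesis using SU2_one SU2_minus_one by auto
  qed
  have "smooth_on (cmap c ` cdom c) (\<psi> \<circ> cinv c)" if c: "c \<in> atl" for c
  proof (rule smooth_on_local)
    fix y assume "y \<in> cmap c ` cdom c"
    then obtain p where p: "p \<in> cdom c" "y = cmap c p" by blast
    show "\<exists>V. open V \<and> y \<in> V \<and> smooth_on (cmap c ` cdom c \<inter> V) (\<psi> \<circ> cinv c)"
    proof (cases "p \<in> U")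
      case True
      let ?V = "cmap c ` (cdom c \<inter> U)"
      have "smooth_on ?V (\<psi> \<circ> cinv c)"
      proof (rule smooth_on_cong[OF descend_smooth[OF smR perR c]])
        fix y assume "y \<in> ?V"
        then have "cinv c y \<in> U" by (auto simp: cinv_cmap[OF c])
        then show "?R (lift (cinv c y)) = (\<psi> \<circ> cinv c) y"
          using on[OF lift(1)[of "cinv c y"]] lift(2)[of "cinv c y"] by simp
      qed
      then show ?thesis using open_chart_image[OF c open_U] True p
        by (intro exI[of _ ?V]) (auto intro: smooth_on_subset)
    next
      case False
      then have "p \<notin> K" using K_subset_U by blast
      then obtain N \<epsilon> where N: "open N" "p \<in> N" "\<forall>q\<in>N. \<psi> q = \<epsilon>" using off by blast
      let ?V = "cmap c ` (cdom c \<inter> N)"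
      have V: "open ?V" by (rule open_chart_image[OF c N(1)])
      have "smooth_on ?V (\<psi> \<circ> cinv c)"
        by (rule smooth_on_cong[OF smooth_on_const[OF V, of \<epsilon>]]) (auto simp: cinv_cmap[OF c] N(3))
      then show ?thesis using V N p by (intro exI[of _ ?V]) (auto intro: smooth_on_subset)
    qed
  qed
  then show \<psi>: "\<psi> \<in> gauge_group atl" using SU2 by (auto simp: gauge_group_def)
  have t: "tame (\<lambda>s. \<alpha> s + g' s)" by (rule tame_add[OF \<alpha> g(3)])
  show "gauge_act atl \<psi> (shift \<alpha> A) = shift (\<lambda>s. \<alpha> s + g' s) A"
  proof (intro ext)
    fix c p v
    consider "\<not> (c \<in> atl \<and> p \<in> cdom c)" | "c \<in> atl" "p \<in> cdom c" "p \<in> U" | "c \<in> atl" "p \<in> cdom c" "p \<notin> U"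
      by blast
    then show "gauge_act atl \<psi> (shift \<alpha> A) c p v = shift (\<lambda>s. \<alpha> s + g' s) A c p v"
    proof cases
      case 1
      then show ?thesis using Omega1_zero[OF shift_Omega1[OF A t], of c p v] by (auto simp: gauge_act_def)
    next
      case 2
      define x where "x = lift p"
      have x: "x \<in> D" "x \<in> Dc c" "u x = p" using lift[OF 2(3)] lift_Dc[OF 2(2,3)] by (auto simp: x_def)
      obtain v' where v: "v = dk c x v'" by (rule dk_surj[OF 2(1) x(2)])
      let ?a = "pb A x v'" and ?X = "ax A x" and ?k = "g' (snd x) * snd v'"
      let ?Q = "rot (g (snd x)) ?X"
      have gs: "((\<lambda>x. g (snd x)) has_derivative (\<lambda>v. g' (snd x) * snd v)) (at x)"
        using diff_chain_at[OF bounded_linear_imp_has_derivative[OF bounded_linear_snd], of g] g(2)[of "snd x"]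
        by (simp add: o_def has_field_derivative_def)
      have "((\<lambda>x. cos (g (snd x)) *\<^sub>R mat 1 + sin (g (snd x)) *\<^sub>R ax A x) has_derivative
          (\<lambda>v. (cos (g (snd x)) *\<^sub>R 0 + (- sin (g (snd x)) * (g' (snd x) * snd v)) *\<^sub>R mat 1)
            + (sin (g (snd x)) *\<^sub>R bracket (pb A x v) ?X + (cos (g (snd x)) * (g' (snd x) * snd v)) *\<^sub>R ?X))) (at x)"
        by (intro has_derivative_add has_derivative_scaleR has_derivative_const ax_deriv[OF A x(1)]
            DERIV_compose_FDERIV[OF DERIV_sin gs, simplified mult.commute[of "_ * _" "cos _"]]
            DERIV_compose_FDERIV[OF DERIV_cos gs, simplified mult.commute[of "_ * _" "- sin _"]])
      then have "((\<psi> \<circ> u) has_derivative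
          (\<lambda>v. (cos (g (snd x)) *\<^sub>R 0 + (- sin (g (snd x)) * (g' (snd x) * snd v)) *\<^sub>R mat 1)
            + (sin (g (snd x)) *\<^sub>R bracket (pb A x v) ?X + (cos (g (snd x)) * (g' (snd x) * snd v)) *\<^sub>R ?X))) (at x)"
        by (rule has_derivative_transform_within_open[OF _ open_D x(1)]) (simp add: on rot_def)
      \<comment> \<open>With Q = cos g + sin g X and X X = -1, the derivative of Q in g is X Q; the
        scalar part of Q commutes with everything, so sin g [a, X] = [a, Q].\<close>
      from fun_cong[OF frechet_derivative_at[OF this], of v', symmetric]
      have d: "frechet_derivative (\<psi> \<circ> u) (at x) v' = ?k *\<^sub>R (?X ** ?Q) + ?a ** ?Q - ?Q ** ?a"
        by (simp add: rot_def matrix_distribs ax_square[OF A x(1)] bracket_def algebra_simps)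
      have U: "ct ?Q ** ?Q = mat 1"
        by (rule SU2_unitary[OF rot_SU2[OF ax_su2[OF A x(1)] ax_square[OF A x(1)]]])
      have comm: "?Q ** ?X = ?X ** ?Q" by (simp add: rot_def matrix_distribs)
      have "gauge_act atl \<psi> (shift \<alpha> A) c p v
          = ?Q ** pb (shift \<alpha> A) x v' ** ct ?Q + frechet_derivative (\<psi> \<circ> u) (at x) v' ** ct ?Q"
        using gauge_act_eq[OF \<psi> 2(1,2)] gauge_u_frechet[OF \<psi> 2(1) x(2)]
          pb_chart[OF Omega1_covariant[OF shift_Omega1[OF A \<alpha>]] 2(1) x(2)] on[OF x(1)]
        by (simp add: v x(3))
      \<comment> \<open>Q commutes with X, so the added multiple of X survives conjugation, while Q
        a ct Q cancels against the commutator part of the derivative.\<close>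
      also have "\<dots> = ?a + ((\<alpha> (snd x) + g' (snd x)) * snd v') *\<^sub>R ?X"
        unfolding d pb_shift[OF A x(1)]
        by (simp add: matrix_distribs comm unitary_cancel[OF U] algebra_simps)
      also have "\<dots> = shift (\<lambda>s. \<alpha> s + g' s) A c p v"
        using pb_chart[OF Omega1_covariant[OF shift_Omega1[OF A t]] 2(1) x(2)]
        by (simp add: v x(3) pb_shift[OF A x(1), of "\<lambda>s. \<alpha> s + g' s" v', symmetric])
      finally show ?thesis .
    next
      case 3
      then have p: "p \<notin> K" using K_subset_U by blast
      obtain N \<epsilon> where N: "open N" "p \<in> N" "\<epsilon> = mat 1 \<or> \<epsilon> = - mat 1" "\<forall>q\<in>N. \<psi> q = \<epsilon>" using off[OF p] by blast
      have "frechet_derivative (\<psi> \<circ> cinv c) (at (cmap c p)) = frechet_derivative (\<lambda>y. \<epsilon>) (at (cmap c p))"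
        by (rule frechet_derivative_cong_open[OF open_chart_image[OF 3(1) N(1)]])
          (use 3(2) N(2,4) in \<open>auto simp: cinv_cmap[OF 3(1)]\<close>)
      moreover have "frechet_derivative (\<lambda>y::real \<times> real. \<epsilon>) (at (cmap c p)) = (\<lambda>v. 0)"
        by (rule frechet_derivative_at[symmetric]) simp
      moreover have "\<psi> p ** A c p v ** ct (\<psi> p) = A c p v" using N by auto
      ultimately show ?thesis
        by (simp add: gauge_act_eq[OF \<psi> 3(1,2)] shift_def axial_off_K[OF \<alpha> p] axial_off_K[OF t p])
    qed
  qed
qed

end

section \<open>The differential of the holonomy angle\<close>

lemma bounded_bilinear_su2_inner: "bounded_bilinear su2_inner"
  by (subst bilinear_conv_bounded_bilinear[symmetric])
    (auto simp: bilinear_def su2_inner_def matrix_distribs algebra_simps intro!: linearI)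

lemma su2_inner_invariant: "su2_inner (bracket a X) b = - su2_inner X (bracket a b)"
  using trace_mult_commute[of "a" "X ** b"]
  by (simp add: su2_inner_def bracket_def matrix_distribs matrix_mul_assoc field_simps)

lemma su2_inner_conj: "su2_inner (U ** X ** ct U) Y = su2_inner X (ct U ** Y ** U)"
  using trace_mult_commute[of "U" "X ** ct U ** Y"]
  by (simp add: su2_inner_def matrix_mul_assoc)

context cylinder
begin

lemma central_continuous:
  assumes "\<omega> \<in> Omega1 atl"
  shows "continuous_on UNIV (\<lambda>r. (2 * pi) *\<^sub>R pb \<omega> (2 * pi * r, 0) (1, 0))"
  by (intro continuous_intros continuous_on_compose2[OF smooth_on_continuous_on[OF open_D pb_smooth[OF assms]]])
    (auto simp: D_def)

text \<open>First-order perturbation of the equation along the curve: the end value changes by the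
  integral \<open>Z\<close> of B transported to the base point. Pairing with the base axis and
  moving the transport from B to the axis turns this into the integral of \<langle>X, B\<rangle>.
  Since A + \<epsilon>B may fail to be flat, no frame on the strip is used for it.\<close>

lemma df_gamma:
  assumes A: "A \<in> S_gamma atl u" and B: "B \<in> Omega1 atl"
  obtains I where "has_df_gamma atl u A B (- I)"
    "((\<lambda>\<theta>. su2_inner (ax A (\<theta>, 0)) (pb B (\<theta>, 0) (1, 0))) has_integral I) {0..2 * pi}"
proof -
  note A1 = S_gamma_Omega1[OF A]
  let ?H = "hol atl (central_curve u) A"
  define C where "C = (\<lambda>\<epsilon>::real. \<lambda>c p v. A c p v + \<epsilon> *\<^sub>R B c p v)"
  define a where "a = (\<lambda>r. (2 * pi) *\<^sub>R pb A (2 * pi * r, 0) (1, 0))"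
  define n where "n = (\<lambda>r. (2 * pi) *\<^sub>R pb B (2 * pi * r, 0) (1, 0))"
  have C1: "C \<epsilon> \<in> Omega1 atl" for \<epsilon>
    unfolding C_def by (intro Omega1_add A1 Omega1_scaleR[OF B] open_cimage)
  have pbC: "pb (C \<epsilon>) x v = pb A x v + \<epsilon> *\<^sub>R pb B x v" if "x \<in> D" for \<epsilon> x v
    using that by (simp add: pb_chart_at C_def)
  have skew_a: "ct (a r) = - a r" and skew_n: "ct (n r) = - n r" for r
    using pb_skew[OF A1 central_in_D] pb_skew[OF B central_in_D] by (simp_all add: a_def n_def)
  have tr_n: "trace (n r) = 0" for r
    using su2_trace[OF pb_su2[OF B central_in_D]] by (simp add: n_def)
  have cont_a: "continuous_on UNIV a" and cont_n: "continuous_on UNIV n"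
    unfolding a_def n_def by (intro central_continuous A1 B)+
  have M: "(2 * pi) *\<^sub>R pb (C \<epsilon>) (2 * pi * r, 0) (1, 0) = a r + \<epsilon> *\<^sub>R n r" for \<epsilon> r
    by (simp add: pbC[OF central_in_D] a_def n_def scaleR_add_right)
  have "\<exists>y. y 0 = mat 1 \<and> (\<forall>r. (y has_vector_derivative (a r + \<epsilon> *\<^sub>R n r) ** y r) (at r))" for \<epsilon>
  proof -
    have "continuous_on UNIV (\<lambda>r. a r + \<epsilon> *\<^sub>R n r)" by (intro continuous_intros cont_a cont_n)
    then have "isCont (\<lambda>r. a r + \<epsilon> *\<^sub>R n r) r" for r by (simp add: continuous_on_eq_continuous_at)
    from linear_ode_exists[OF this] show ?thesis by blast
  qed
  then obtain h where h: "\<And>\<epsilon>. h \<epsilon> 0 = mat 1"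
    "\<And>\<epsilon> r. (h \<epsilon> has_vector_derivative (a r + \<epsilon> *\<^sub>R n r) ** h \<epsilon> r) (at r)" by metis
  have hol: "hol atl (central_curve u) (C \<epsilon>) = ct (h \<epsilon> 1)" for \<epsilon>
    by (rule hol_eq[of "C \<epsilon>" "h \<epsilon>", OF Omega1_linear[OF C1] pb_skew[OF C1 central_in_D] h(1)])
      (use h(2) M in \<open>auto intro: has_vector_derivative_at_within\<close>)
  have h0: "(h 0 has_vector_derivative a r ** h 0 r) (at r)" for r using h(2)[of 0 r] by simp
  have uni: "ct (h 0 r) ** h 0 r = mat 1" for r
    by (rule ode_unitary[where S=UNIV and M=a]) (use h(1) h0 skew_a in auto)
  have ct_h0: "((\<lambda>r. ct (h 0 r)) has_vector_derivative ct (a r ** h 0 r)) (at r)" for r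
    by (rule bounded_linear.has_vector_derivative[OF bounded_linear_ct h0])
  have "isCont (\<lambda>r. ct (h 0 r) ** n r ** h 0 r) r" for r
  proof -
    have "isCont n r" using cont_n by (simp add: continuous_on_eq_continuous_at)
    with has_vector_derivative_continuous[OF ct_h0] has_vector_derivative_continuous[OF h0]
    show ?thesis by (intro bounded_bilinear.continuous[OF bounded_bilinear_mat2]) auto
  qed
  from antiderivative_exists[OF this] obtain Z where Z: "Z 0 = 0"
    "\<And>r. (Z has_vector_derivative ct (h 0 r) ** n r ** h 0 r) (at r)" by blast
  have dh: "((\<lambda>\<epsilon>. h \<epsilon> 1) has_derivative (\<lambda>v. h 0 1 ** (v *\<^sub>R Z 1))) (at 0)"
  proof (rule ode_parameter_derivative[where \<delta>=1 and M="\<lambda>\<epsilon> r. a r + \<epsilon> *\<^sub>R n r" and N="\<lambda>v r. v *\<^sub>R n r"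
        and Z="\<lambda>v r. v *\<^sub>R Z r"])
    show "(h v has_vector_derivative (a r + v *\<^sub>R n r) ** h v r) (at r within {0..1})" for v r
      by (rule has_vector_derivative_at_within[OF h(2)])
    show "ct (a r + v *\<^sub>R n r) = - (a r + v *\<^sub>R n r)" for v r by (simp add: skew_a skew_n)
    show "\<exists>d>0. \<forall>v r. norm v < d \<longrightarrow> r \<in> {0..1} \<longrightarrow>
        norm ((a r + v *\<^sub>R n r) - (a r + 0 *\<^sub>R n r) - v *\<^sub>R n r) \<le> e * norm v" if "e > 0" for e
      using that by (intro exI[of _ 1]) simp
    show "linear (\<lambda>v. v *\<^sub>R n r)" for r by (rule linear_scaleR_left)
    show "continuous_on {0..1} (\<lambda>r. v *\<^sub>R n r)" for v
      by (intro continuous_intros continuous_on_subset[OF cont_n]) auto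
    show "((\<lambda>r. v *\<^sub>R Z r) has_vector_derivative ct (h 0 r) ** (v *\<^sub>R n r) ** h 0 r) (at r within {0..1})" for v r
      using bounded_linear.has_vector_derivative[OF bounded_linear_scaleR_right Z(2)[THEN has_vector_derivative_at_within]]
      by simp
    show "linear (\<lambda>v. v *\<^sub>R Z 1)" by (rule linear_scaleR_left)
  qed (use h(1) Z(1) in auto)
  define X0 where "X0 = hol_axis ?H"
  define c where "c = Re (trace ?H) / 2"
  define s where "s = sqrt (1 - c\<^sup>2)"
  have "?H \<noteq> mat 1" "?H \<noteq> - mat 1" using A by (auto simp: S_gamma_def)
  note ax = SU2_hol_axis[OF hol_SU2[OF A] this, folded X0_def c_def s_def]
  have s: "s > 0" using ax(1) by (simp add: s_def)
  have C0: "C 0 = A" by (simp add: C_def)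
  \<comment> \<open>The holonomy is the inverse of the end value, hence the minus sign;
    \<open>s\<close> is the sine of the holonomy angle and will cancel against the derivative of
    arccos.\<close>
  have h01: "h 0 1 = c *\<^sub>R mat 1 - s *\<^sub>R X0"
  proof -
    have "h 0 1 = ct ?H" using hol[of 0] by (simp add: C0)
    also have "\<dots> = ct (c *\<^sub>R mat 1 + s *\<^sub>R X0)" using ax(4) by simp
    finally show ?thesis by (simp add: su2_skew[OF ax(2)])
  qed
  \<comment> \<open>The integrand is conjugate to a traceless matrix, so the scalar part of the end
    value does not contribute to the derivative of the trace.\<close>
  have "Re (trace (Z 1)) = Re (trace (Z 0))"
  proof (rule has_derivative_zero_unique[of UNIV "\<lambda>r. Re (trace (Z r))"])
    fix r :: real
    have bl: "bounded_linear (\<lambda>X :: mat2. Re (trace X))"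
      by (intro linear_conv_bounded_linear[THEN iffD1] linearI) auto
    have "trace (ct (h 0 r) ** n r ** h 0 r) = 0"
      using trace_conj[of "ct (h 0 r)" "n r"] unitary_cancel(1)[OF uni] tr_n by simp
    then show "((\<lambda>r. Re (trace (Z r))) has_derivative (\<lambda>h. 0)) (at r within UNIV)"
      using bounded_linear.has_vector_derivative[OF bl Z(2)[of r]] by (simp add: has_vector_derivative_def)
  qed auto
  then have trZ: "Re (trace (Z 1)) = 0" using Z(1) by (simp add: trace_def)
  define g where "g = (\<lambda>\<epsilon>. Re (trace (h \<epsilon> 1)) / 2)"
  have bl: "bounded_linear (\<lambda>X :: mat2. Re (trace X) / 2)"
    by (intro linear_conv_bounded_linear[THEN iffD1] linearI) (auto simp: add_divide_distrib)
  have "(g has_derivative (\<lambda>v. Re (trace (h 0 1 ** (v *\<^sub>R Z 1))) / 2)) (at 0)"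
    unfolding g_def by (rule bounded_linear.has_derivative[OF bl dh])
  moreover have "(\<lambda>v. Re (trace (h 0 1 ** (v *\<^sub>R Z 1))) / 2) = (*) (s * su2_inner X0 (Z 1))"
    by (simp add: h01 matrix_distribs trZ su2_inner_def fun_eq_iff)
  ultimately have dg: "(g has_real_derivative s * su2_inner X0 (Z 1)) (at 0)"
    by (simp add: has_field_derivative_def)
  have g0: "g 0 = c" using hol[of 0] by (simp add: g_def c_def C0)
  have "\<bar>c\<bar> < 1" using ax(1) by (simp add: abs_square_less_1)
  then have "DERIV arccos (g 0) :> inverse (- s)" unfolding g0 s_def by (intro DERIV_arccos) auto
  from DERIV_chain2[OF this dg]
  have "((\<lambda>\<epsilon>. arccos (g \<epsilon>)) has_real_derivative - su2_inner X0 (Z 1)) (at 0)"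
    using s by (simp add: mult.assoc[symmetric])
  moreover have "f_gamma atl u (C \<epsilon>) = arccos (g \<epsilon>)" for \<epsilon>
    by (simp add: f_gamma_def hol g_def)
  ultimately have "has_df_gamma atl u A B (- su2_inner X0 (Z 1))"
    by (simp add: has_df_gamma_def C_def)
  moreover
  have ax0: "ax A (2 * pi * r, 0) = h 0 r ** X0 ** ct (h 0 r)" for r
  proof -
    let ?X = "\<lambda>r. ax A (2 * pi * r, 0)"
    have X: "(?X has_vector_derivative bracket (a r) (?X r)) (at r)" for r
    proof -
      have "(ax A has_derivative (\<lambda>v. bracket (pb A (2 * pi * r, 0) v) (?X r))) (at ((0, 0) + r *\<^sub>R (2 * pi, 0)))"
        using ax_deriv[OF A central_in_D[of "2 * pi * r"]] by (simp add: mult.commute)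
      from has_vector_derivative_line[OF this]
      have "(?X has_vector_derivative bracket (pb A (2 * pi * r, 0) (2 * pi, 0)) (?X r)) (at r)"
        by (simp add: mult.commute)
      moreover have "pb A (2 * pi * r, 0) ((2 * pi) *\<^sub>R (1, 0)) = a r"
        unfolding a_def by (rule linear_scale[OF pb_linear[OF Omega1_linear[OF A1] central_in_D]])
      ultimately show ?thesis by simp
    qed
    have "ct (h 0 r) ** ?X r ** h 0 r = ct (h 0 0) ** ?X 0 ** h 0 0"
    proof (rule has_derivative_zero_unique[of UNIV "\<lambda>r. ct (h 0 r) ** ?X r ** h 0 r"])
      fix r :: real
      have "((\<lambda>r. ct (h 0 r) ** ?X r ** h 0 r) has_vector_derivative 0) (at r)"
        using bounded_bilinear.has_vector_derivative[OF bounded_bilinear_mat2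
            bounded_bilinear.has_vector_derivative[OF bounded_bilinear_mat2 ct_h0 X] h0, of r]
        by (simp add: bracket_def ct_mult skew_a matrix_distribs matrix_mul_assoc)
      then show "((\<lambda>r. ct (h 0 r) ** ?X r ** h 0 r) has_derivative (\<lambda>h. 0)) (at r within UNIV)"
        by (simp add: has_vector_derivative_def)
    qed auto
    then have "ct (h 0 r) ** ?X r ** h 0 r = X0"
      using cov_const_ax[OF A] by (simp add: h(1) cov_const_def X0_def)
    then have "h 0 r ** (ct (h 0 r) ** ?X r ** h 0 r) ** ct (h 0 r) = h 0 r ** X0 ** ct (h 0 r)" by simp
    then show ?thesis by (simp add: matrix_mul_assoc unitary_cancel[OF uni])
  qed
  \<comment> \<open>Substituting \<theta> = 2 \<pi> r absorbs the factor in \<open>n\<close>; the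
    antiderivative is the pairing of the base axis with the rescaled \<open>Z\<close>.\<close>
  have "((\<lambda>\<theta>. su2_inner (ax A (\<theta>, 0)) (pb B (\<theta>, 0) (1, 0))) has_integral
      su2_inner X0 (Z (2 * pi / (2 * pi))) - su2_inner X0 (Z (0 / (2 * pi)))) {0..2 * pi}"
  proof (rule fundamental_theorem_of_calculus)
    fix \<theta> :: real
    let ?r = "\<theta> / (2 * pi)"
    have "((\<lambda>\<theta>. \<theta> / (2 * pi)) has_vector_derivative 1 / (2 * pi)) (at \<theta>)"
      by (auto intro!: derivative_eq_intros simp: has_real_derivative_iff_has_vector_derivative[symmetric])
    from vector_diff_chain_at[OF this Z(2)]
    have "((\<lambda>\<theta>. Z (\<theta> / (2 * pi))) has_vector_derivative (1 / (2 * pi)) *\<^sub>R (ct (h 0 ?r) ** n ?r ** h 0 ?r)) (at \<theta>)"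
      by (simp add: o_def)
    from bounded_linear.has_vector_derivative[OF
        bounded_bilinear.bounded_linear_right[OF bounded_bilinear_su2_inner, of X0] this]
    have "((\<lambda>\<theta>. su2_inner X0 (Z (\<theta> / (2 * pi)))) has_vector_derivative
        su2_inner X0 ((1 / (2 * pi)) *\<^sub>R (ct (h 0 ?r) ** n ?r ** h 0 ?r))) (at \<theta>)" .
    also have "su2_inner X0 ((1 / (2 * pi)) *\<^sub>R (ct (h 0 ?r) ** n ?r ** h 0 ?r))
        = su2_inner (ax A (2 * pi * ?r, 0)) (pb B (2 * pi * ?r, 0) (1, 0))"
      unfolding ax0 su2_inner_conj by (simp add: n_def)
    also have "2 * pi * ?r = \<theta>" by simp
    finally show "((\<lambda>\<theta>. su2_inner X0 (Z (\<theta> / (2 * pi)))) has_vector_derivative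
        su2_inner (ax A (\<theta>, 0)) (pb B (\<theta>, 0) (1, 0))) (at \<theta> within {0..2 * pi})"
      by (rule has_vector_derivative_at_within)
  qed simp
  then have "((\<lambda>\<theta>. su2_inner (ax A (\<theta>, 0)) (pb B (\<theta>, 0) (1, 0))) has_integral su2_inner X0 (Z 1)) {0..2 * pi}"
    by (simp add: Z(1) bounded_bilinear.zero_right[OF bounded_bilinear_su2_inner])
  ultimately show thesis by (rule that)
qed

text \<open>The 1-form \<open>\<langle>X, B\<rangle>\<close> is closed, so its integral does not depend on the parallel circle.\<close>

lemma circle_integral:
  assumes A: "A \<in> S_gamma atl u" and B: "B \<in> T_flat atl A" and s: "s \<in> {-1<..<1}"
  shows "integral {0..2 * pi} (\<lambda>\<theta>. su2_inner (ax A (\<theta>, s)) (pb B (\<theta>, s) (1, 0)))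
      = integral {0..2 * pi} (\<lambda>\<theta>. su2_inner (ax A (\<theta>, 0)) (pb B (\<theta>, 0) (1, 0)))"
proof -
  have B1: "B \<in> Omega1 atl" using B by (simp add: T_flat_def)
  define F where "F = (\<lambda>e x. su2_inner (ax A x) (pb B x e))"
  have sF: "smooth_on D (F e)" for e
    unfolding F_def by (intro smooth_on_bilinear[OF open_D bounded_bilinear_su2_inner] ax_smooth[OF A] pb_smooth[OF B1])
  note dF = smooth_on_has_derivative[OF open_D sF]
  have F': "frechet_derivative (F e) (at x) v = su2_inner (ax A x) (frechet_derivative (\<lambda>x. pb B x e) (at x) v)
      + su2_inner (bracket (pb A x v) (ax A x)) (pb B x e)" if x: "x \<in> D" for e x v
  proof -
    have "(F e has_derivative (\<lambda>v. su2_inner (ax A x) (frechet_derivative (\<lambda>x. pb B x e) (at x) v)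
      + su2_inner (bracket (pb A x v) (ax A x)) (pb B x e))) (at x)"
      unfolding F_def
      by (rule bounded_bilinear.FDERIV[OF bounded_bilinear_su2_inner ax_deriv[OF A x]
          smooth_on_has_derivative[OF open_D pb_smooth[OF B1] x]])
    from fun_cong[OF frechet_derivative_at[OF this], of v] show ?thesis by simp
  qed
  \<comment> \<open>Invariance of the inner product moves the bracket with A from X onto B; what
    then remains is the linearized flatness equation of B.\<close>
  have closed: "frechet_derivative (F (1, 0)) (at x) (0, 1) = frechet_derivative (F (0, 1)) (at x) (1, 0)"
    if x: "x \<in> D" for x
  proof -
    have "frechet_derivative (F (0, 1)) (at x) (1, 0) - frechet_derivative (F (1, 0)) (at x) (0, 1)
      = su2_inner (ax A x) ((frechet_derivative (\<lambda>x. pb B x (0, 1)) (at x) (1, 0)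
          - frechet_derivative (\<lambda>x. pb B x (1, 0)) (at x) (0, 1))
          - (bracket (pb A x (1, 0)) (pb B x (0, 1)) - bracket (pb A x (0, 1)) (pb B x (1, 0))))"
      unfolding F'[OF x] su2_inner_invariant bounded_bilinear.diff_right[OF bounded_bilinear_su2_inner] by simp
    then show ?thesis
      unfolding pb_T_flat[OF S_gamma_Omega1[OF A] B x]
      by (simp add: bounded_bilinear.zero_right[OF bounded_bilinear_su2_inner])
  qed
  have inD: "(\<theta>, s) \<in> D" if "s \<in> {-1<..<1}" for \<theta> s using that by (simp add: D_def)
  have per: "F (0, 1) (2 * pi, s) = F (0, 1) (0, s)" if "s \<in> {-1<..<1}" for s
    using ax_periodic[OF A] pb_periodic[OF Omega1_covariant[OF B1]] that
    unfolding periodic_def F_def by (metis add_0)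
  have cF: "continuous_on D (F e)" for e by (rule smooth_on_continuous_on[OF open_D sF])
  \<comment> \<open>The derivative of the circle integral in s is taken under the integral;
    closedness makes the new integrand a derivative in \<theta>.\<close>
  have J: "((\<lambda>s. integral (cbox 0 (2 * pi)) (\<lambda>\<theta>. F (1, 0) (\<theta>, s))) has_vector_derivative
      integral (cbox 0 (2 * pi)) (\<lambda>\<theta>. frechet_derivative (F (1, 0)) (at (\<theta>, s)) (0, 1))) (at s within {-1<..<1})"
    if s: "s \<in> {-1<..<1}" for s
  proof (rule leibniz_rule_vector_derivative[where U="{-1<..<1}" and f="\<lambda>s \<theta>. F (1, 0) (\<theta>, s)"
        and fx="\<lambda>s \<theta>. frechet_derivative (F (1, 0)) (at (\<theta>, s)) (0, 1)"])
    fix s \<theta> :: real assume s: "s \<in> {-1<..<1}"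
    have "(F (1, 0) has_derivative frechet_derivative (F (1, 0)) (at (\<theta>, s))) (at ((\<theta>, 0) + s *\<^sub>R (0, 1)))"
      using dF[OF inD[OF s]] by simp
    from has_vector_derivative_line[OF this]
    show "((\<lambda>s. F (1, 0) (\<theta>, s)) has_vector_derivative frechet_derivative (F (1, 0)) (at (\<theta>, s)) (0, 1))
        (at s within {-1<..<1})" by (simp add: has_vector_derivative_at_within)
  next
    fix s :: real assume "s \<in> {-1<..<1}"
    then show "(\<lambda>\<theta>. F (1, 0) (\<theta>, s)) integrable_on cbox 0 (2 * pi)"
      by (intro integrable_continuous continuous_on_compose2[OF cF] continuous_intros) (auto simp: inD)
  next
    have "continuous_on D (\<lambda>x. frechet_derivative (F (1, 0)) (at x) (0, 1))"
      by (rule smooth_on_continuous_on[OF open_D smooth_on_deriv[OF open_D sF]])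
    then show "continuous_on ({-1<..<1} \<times> cbox 0 (2 * pi))
        (\<lambda>(s, \<theta>). frechet_derivative (F (1, 0)) (at (\<theta>, s)) (0, 1))"
      unfolding split_beta by (rule continuous_on_compose2) (auto intro!: continuous_intros simp: D_def)
  qed (use s in auto)
  \<comment> \<open>The integral over a full period of the \<theta>-derivative of a periodic
    function.\<close>
  have zero: "integral (cbox 0 (2 * pi)) (\<lambda>\<theta>. frechet_derivative (F (1, 0)) (at (\<theta>, s)) (0, 1)) = 0"
    if s: "s \<in> {-1<..<1}" for s
  proof -
    have "((\<lambda>\<theta>. frechet_derivative (F (0, 1)) (at (\<theta>, s)) (1, 0)) has_integral
        F (0, 1) (2 * pi, s) - F (0, 1) (0, s)) {0..2 * pi}"
    proof (rule fundamental_theorem_of_calculus)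
      fix \<theta> :: real
      have "(F (0, 1) has_derivative frechet_derivative (F (0, 1)) (at (\<theta>, s))) (at ((0, s) + \<theta> *\<^sub>R (1, 0)))"
        using dF[OF inD[OF s]] by simp
      from has_vector_derivative_line[OF this]
      show "((\<lambda>\<theta>. F (0, 1) (\<theta>, s)) has_vector_derivative frechet_derivative (F (0, 1)) (at (\<theta>, s)) (1, 0))
          (at \<theta> within {0..2 * pi})" by (simp add: has_vector_derivative_at_within)
    qed simp
    then show ?thesis using closed[OF inD[OF s]] per[OF s] by (simp add: integral_unique cbox_interval)
  qed
  have "integral (cbox 0 (2 * pi)) (\<lambda>\<theta>. F (1, 0) (\<theta>, s)) = integral (cbox 0 (2 * pi)) (\<lambda>\<theta>. F (1, 0) (\<theta>, 0))"
  proof (rule has_derivative_zero_unique[of "{-1<..<1}" "\<lambda>s. integral (cbox 0 (2 * pi)) (\<lambda>\<theta>. F (1, 0) (\<theta>, s))"])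
    fix s :: real assume s: "s \<in> {-1<..<1}"
    from J[OF s] show "((\<lambda>s. integral (cbox 0 (2 * pi)) (\<lambda>\<theta>. F (1, 0) (\<theta>, s))) has_derivative (\<lambda>h. 0))
        (at s within {-1<..<1})"
      by (simp only: zero[OF s] has_vector_derivative_def scaleR_zero_right)
  qed (use s in auto)
  then show ?thesis by (simp add: F_def cbox_interval)
qed

text \<open>By Fubini: the circle at height s contributes \<alpha>(s) times the common circle
  integral \<open>I\<close>, and \<alpha> has integral 1. The sign arises because the axial form has
  only a ds component, which enters the wedge product in second place.\<close>

lemma axial_cylinder_integral:
  assumes A: "A \<in> S_gamma atl u" and B: "B \<in> T_flat atl A" and \<alpha>: "tame \<alpha>" "(\<alpha> has_integral 1) {-1..1}"
    and I: "((\<lambda>\<theta>. su2_inner (ax A (\<theta>, 0)) (pb B (\<theta>, 0) (1, 0))) has_integral I) {0..2 * pi}"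
  shows "has_cylinder_integral atl u (wedge_inner (axial \<alpha> A) B) (- I)"
proof -
  have B1: "B \<in> Omega1 atl" using B by (simp add: T_flat_def)
  define F where "F = (\<lambda>x. su2_inner (ax A x) (pb B x (1, 0)))"
  \<comment> \<open>Extended by 0 beyond the open strip, where the axis is meaningless; since
    \<alpha> vanishes near the boundary the result is continuous on the whole plane.\<close>
  define q where "q = (\<lambda>x. if x \<in> D then \<alpha> (snd x) * F x else 0)"
  have integrand: "pullback2 atl u strip (wedge_inner (axial \<alpha> A) B) x (1, 0) (0, 1) = - q x"
    if x: "x \<in> strip" for x
  proof (cases "x \<in> D")
    case True
    have "pullback2 atl u strip (wedge_inner (axial \<alpha> A) B) x (1, 0) (0, 1)
        = su2_inner (pb (axial \<alpha> A) x (1, 0)) (pb B x (0, 1)) - su2_inner (pb (axial \<alpha> A) x (0, 1)) (pb B x (1, 0))"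
      by (simp add: pullback2_def pullback1_def wedge_inner_def)
    then show ?thesis
      using True by (simp add: pb_axial[OF A True] q_def F_def bounded_bilinear.zero_left[OF bounded_bilinear_su2_inner]
          bounded_bilinear.scaleR_left[OF bounded_bilinear_su2_inner])
  next
    case False
    have "u x \<notin> U"
    proof
      assume "u x \<in> U"
      then obtain y where y: "y \<in> D" "u x = u y" by (auto simp: U_def)
      then have "snd x = snd y" using u_eq_iff[OF x, of y] D_strip by blast
      then show False using y(1) False by (auto simp: D_def mem_Times_iff)
    qed
    then show ?thesis
      using False by (simp add: pullback2_def wedge_inner_def axial_def q_def
          bounded_bilinear.zero_left[OF bounded_bilinear_su2_inner])
  qed
  have "continuous_on D (\<lambda>x. \<alpha> (snd x) * F x)"
    unfolding F_def
    by (intro smooth_on_continuous_on[OF open_D] smooth_on_mult[OF open_D] tame_smooth_snd[OF \<alpha>(1) open_D]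
        smooth_on_bilinear[OF open_D bounded_bilinear_su2_inner] ax_smooth[OF A] pb_smooth[OF B1])
  \<comment> \<open>The number 7/8 lies between the bound 3/4 on the support of \<alpha> and the
    boundary at 1, so the plane is covered by two closed sets, on one of which \<open>q\<close> is
    zero while the other lies within \<open>D\<close>.\<close>
  then have 1: "continuous_on (UNIV \<times> {-7/8..7/8}) q"
    by (rule continuous_on_eq[OF continuous_on_subset]) (auto simp: D_def q_def)
  have 2: "continuous_on (UNIV \<times> ({..-7/8} \<union> {7/8..})) q"
  proof (rule continuous_on_eq[OF continuous_on_const[of _ 0]])
    fix x :: "real \<times> real" assume "x \<in> UNIV \<times> ({..-7/8} \<union> {7/8..})"
    then have "snd x < - (3/4) \<or> 3/4 < snd x" by (auto simp: mem_Times_iff)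
    then have "\<alpha> (snd x) = 0" using \<alpha>(1) unfolding tame_def by blast
    then show "0 = q x" by (simp add: q_def)
  qed
  have "continuous_on ((UNIV \<times> {-7/8..7/8}) \<union> (UNIV \<times> ({..-7/8} \<union> {7/8..}))) q"
    by (rule continuous_on_closed_Un[OF _ _ 1 2]) (auto intro!: closed_Times)
  moreover have "(UNIV \<times> {-7/8..7/8}) \<union> (UNIV \<times> ({..-7/8} \<union> {7/8..})) = (UNIV :: (real \<times> real) set)" by auto
  ultimately have cq: "continuous_on S q" for S using continuous_on_subset by fastforce
  have inner: "integral (cbox 0 (2 * pi)) (\<lambda>\<theta>. q (\<theta>, s)) = \<alpha> s * I" if "s \<in> cbox (-1) 1" for s
  proof (cases "s \<in> {-1<..<1}")
    case True
    then have "integral (cbox 0 (2 * pi)) (\<lambda>\<theta>. q (\<theta>, s)) = \<alpha> s * integral {0..2 * pi} (\<lambda>\<theta>. F (\<theta>, s))"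
      by (simp add: q_def D_def cbox_interval)
    also have "\<dots> = \<alpha> s * I" using circle_integral[OF A B True] integral_unique[OF I] by (simp add: F_def)
    finally show ?thesis .
  next
    case False
    then have "\<alpha> s = 0" using that \<alpha>(1) by (auto simp: tame_def cbox_interval)
    then have "q (\<theta>, s) = 0" for \<theta> by (simp add: q_def)
    with \<open>\<alpha> s = 0\<close> show ?thesis by simp
  qed
  have "integral (cbox (0, -1) (2 * pi, 1)) q = integral (cbox 0 (2 * pi)) (\<lambda>\<theta>. integral (cbox (-1) 1) (\<lambda>s. q (\<theta>, s)))"
    by (rule integral_prod_continuous[OF cq])
  also have "\<dots> = integral (cbox (-1) 1) (\<lambda>s. integral (cbox 0 (2 * pi)) (\<lambda>\<theta>. q (\<theta>, s)))"
    by (rule integral_swap_continuous[of 0 "-1" "2 * pi" 1 "\<lambda>\<theta> s. q (\<theta>, s)"]) (simp add: cq)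
  also have "\<dots> = integral (cbox (-1) 1) (\<lambda>s. \<alpha> s * I)" by (rule integral_cong) (rule inner)
  also have "\<dots> = I" using integral_unique[OF has_integral_mult_left[OF \<alpha>(2), of I]] by (simp add: cbox_interval)
  finally have "(q has_integral I) (cbox (0, -1) (2 * pi, 1))"
    using integrable_integral[OF integrable_continuous[OF cq]] by metis
  from has_integral_neg[OF this]
  have "((\<lambda>x. - q x) has_integral - I) ({0..2 * pi} \<times> {-1..1})"
    unfolding cbox_Pair_eq by (simp only: cbox_interval)
  then show ?thesis
    unfolding has_cylinder_integral_def
  proof (rule has_integral_eq[rotated])
    fix x :: "real \<times> real" assume "x \<in> {0..2 * pi} \<times> {-1..1}"
    then have "x \<in> strip" by (auto simp: strip_def)
    from integrand[OF this] show "- q x = pullback2 atl u strip (wedge_inner (axial \<alpha> A) B) x (1, 0) (0, 1)"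
      by simp
  qed
qed

end

lemma bump_integrals:
  "(bump has_integral 1) {-1..1}" "((\<lambda>s. bump (s + 1)) has_integral 1) {-1..1}"
proof -
  note vec = has_vector_derivative_at_within[OF has_real_derivative_iff_has_vector_derivative[THEN iffD1]]
  have "(bump has_integral smooth_step 1 - smooth_step (-1)) {-1..1}"
    by (rule fundamental_theorem_of_calculus[OF _ vec[OF smooth_step_deriv]]) simp
  then show "(bump has_integral 1) {-1..1}" by (simp add: smooth_step_eq_0 smooth_step_eq_1)
  have "((\<lambda>s. bump (s + 1)) has_integral smooth_step (1 + 1) - smooth_step (-1 + 1)) {-1..1}"
    by (rule fundamental_theorem_of_calculus[OF _ vec[OF smooth_step_translate_deriv]]) simp
  then show "((\<lambda>s. bump (s + 1)) has_integral 1) {-1..1}" by (simp add: smooth_step_eq_0 smooth_step_eq_1)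
qed

section \<open>The flow\<close>

lemma smooth_on_translate:
  assumes "smooth_on UNIV (\<alpha> :: real \<Rightarrow> real)"
  shows "smooth_on UNIV (\<lambda>s. \<alpha> (s + 1))"
  by (rule smooth_on_compose[where f=\<alpha> and g="\<lambda>s. s + 1", OF open_UNIV open_UNIV _ assms])
    (auto intro!: smooth_on_add smooth_on_id smooth_on_const)

lemma tame_bump: "tame bump" "tame (\<lambda>s. bump (s + 1))"
  using smooth_on_bump smooth_on_translate[OF smooth_on_bump] by (auto simp: tame_def intro!: bump_eq_0)

lemma rot_values: "rot 0 X = mat 1" "rot pi X = - mat 1" "rot (2 * pi) X = mat 1"
  by (simp_all add: rot_def)

context cylinder
begin

section \<open>The flows on connections\<close>

definition flow :: "(real \<Rightarrow> real) \<Rightarrow> real \<Rightarrow> ('a, mat2) form1 \<Rightarrow> ('a, mat2) form1" where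
  "flow \<beta> t = shift (\<lambda>s. t * \<beta> s)"

lemma flow_S_gamma: "A \<in> S_gamma atl u \<Longrightarrow> tame \<beta> \<Longrightarrow> \<beta> 0 = 0 \<Longrightarrow> flow \<beta> t A \<in> S_gamma atl u"
  unfolding flow_def by (intro shift_S_gamma tame_cmult) auto

lemma flow_zero: "flow \<beta> 0 A = A"
  by (simp add: flow_def shift_zero)

lemma flow_add:
  assumes "A \<in> S_gamma atl u" "tame \<beta>" "\<beta> 0 = 0"
  shows "flow \<beta> (t + t') A = flow \<beta> t (flow \<beta> t' A)"
  using shift_shift[OF assms(1) tame_cmult[OF assms(2)], of t' "\<lambda>s. t * \<beta> s"] assms(3)
  by (simp add: flow_def distrib_right)

lemma flow_action: "tame \<beta> \<Longrightarrow> \<beta> 0 = 0 \<Longrightarrow> real_action (S_gamma atl u) (flow \<beta>)"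
  unfolding real_action_def using flow_S_gamma flow_zero flow_add by blast

lemma axial_cmult: "axial (\<lambda>s. t * \<beta> s) A c p v = t *\<^sub>R axial \<beta> A c p v"
  by (simp add: axial_def mult.assoc)

lemma flow_supported:
  assumes \<beta>: "\<And>s. s \<notin> {a..b} \<Longrightarrow> \<beta> s = 0" and ab: "-1 \<le> a" "a \<le> b" "b \<le> 1" "{a..b} \<subseteq> J"
  shows "supported_in (S_gamma atl u) (flow \<beta>) (u ` (UNIV \<times> J))"
proof -
  have "axial \<beta> A c p v = 0" if "p \<notin> u ` (UNIV \<times> {a..b})" for A c p v
  proof (cases "p \<in> U")
    case True
    have "\<beta> (snd (lift p)) = 0"
    proof (rule \<beta>, rule notI)
      assume "snd (lift p) \<in> {a..b}"
      then have "lift p \<in> UNIV \<times> {a..b}" by (simp add: mem_Times_iff)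
      then have "u (lift p) \<in> u ` (UNIV \<times> {a..b})" by (rule imageI)
      then show False using that lift(2)[OF True] by simp
    qed
    then show ?thesis by (simp add: axial_def)
  qed (simp add: axial_def)
  then have "flow \<beta> t A c p = A c p" if "p \<notin> u ` (UNIV \<times> {a..b})" for t A c p
    using that by (simp add: flow_def shift_def axial_cmult fun_eq_iff)
  moreover have "u ` (UNIV \<times> {a..b}) \<subseteq> u ` (UNIV \<times> J)" using ab(4) by blast
  ultimately show ?thesis
    unfolding supported_in_def using compact_u_band[OF ab(2,1,3)] by blast
qed

lemma flow_velocity: "has_velocity (flow \<beta>) A (axial \<beta> A)"
  unfolding has_velocity_def
proof (intro allI)
  fix c p v
  have "((\<lambda>t. A c p v + t *\<^sub>R axial \<beta> A c p v) has_vector_derivative axial \<beta> A c p v) (at 0)"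
    by (auto intro!: derivative_eq_intros)
  then show "((\<lambda>t. flow \<beta> t A c p v) has_vector_derivative axial \<beta> A c p v) (at 0)"
    by (simp add: flow_def shift_def axial_cmult)
qed

lemma flow_hamiltonian:
  assumes A: "A \<in> S_gamma atl u" and \<beta>: "tame \<beta>" "(\<beta> has_integral 1) {-1..1}"
  shows "\<exists>V\<in>Omega1 atl. has_velocity (flow \<beta>) A V \<and>
       (\<forall>B\<in>T_flat atl A. \<exists>D. has_df_gamma atl u A B D \<and> has_cylinder_integral atl u (wedge_inner V B) D)"
proof (intro bexI[of _ "axial \<beta> A"] conjI ballI)
  fix B assume B: "B \<in> T_flat atl A"
  then have "B \<in> Omega1 atl" by (simp add: T_flat_def)
  from df_gamma[OF A this] obtain I where "has_df_gamma atl u A B (- I)"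
    "((\<lambda>\<theta>. su2_inner (ax A (\<theta>, 0)) (pb B (\<theta>, 0) (1, 0))) has_integral I) {0..2 * pi}" .
  with axial_cylinder_integral[OF A B \<beta>]
  show "\<exists>D. has_df_gamma atl u A B D \<and> has_cylinder_integral atl u (wedge_inner (axial \<beta> A) B) D" by blast
qed (fact flow_velocity axial_Omega1[OF A \<beta>(1)])+

lemma flow_gauge:
  "\<psi> \<in> gauge_group atl \<Longrightarrow> A \<in> S_gamma atl u \<Longrightarrow>
    flow \<beta> t (gauge_act atl \<psi> A) = gauge_act atl \<psi> (flow \<beta> t A)"
  unfolding flow_def by (rule shift_gauge)

section \<open>Gauge transformations along the axis\<close>

lemma snd_lift_off_K:
  assumes "q \<in> U" "q \<notin> K"
  shows "snd (lift q) < - (3/4) \<or> 3/4 < snd (lift q)"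
proof (rule ccontr)
  assume "\<not> ?thesis"
  then have "lift q \<in> UNIV \<times> {-(3/4)..3/4}" by (simp add: mem_Times_iff)
  then have "u (lift q) \<in> K" unfolding K_def by (rule imageI)
  then show False using assms lift(2) by simp
qed

text \<open>Joins the rotation on the cylinder to prescribed values \<open>e\<close> elsewhere. The
  condition off \<open>K\<close> says that the combined map is locally one of the central elements 1
  and -1 there, so it is smooth and acts trivially.\<close>

lemma gauge_rot_exists:
  assumes A: "A \<in> S_gamma atl u" and \<alpha>: "tame \<alpha>"
    and g: "smooth_on UNIV g" "\<And>s. (g has_real_derivative g' s) (at s)" "tame g'"
    and off: "\<And>p. p \<notin> K \<Longrightarrow> \<exists>N \<epsilon>. open N \<and> p \<in> N \<and> (\<epsilon> = mat 1 \<or> \<epsilon> = - mat 1) \<and>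
      (\<forall>q\<in>N. (if q \<in> U then rot (g (snd (lift q))) (ax A (lift q)) else e q) = \<epsilon>)"
  shows "\<exists>\<psi>\<in>gauge_group atl. gauge_act atl \<psi> (shift \<alpha> A) = shift (\<lambda>s. \<alpha> s + g' s) A"
proof -
  let ?\<psi> = "\<lambda>q. if q \<in> U then rot (g (snd (lift q))) (ax A (lift q)) else e q"
  have "?\<psi> (u x) = rot (g (snd x)) (ax A x)" if "x \<in> D" for x
    using u_in_U[OF that] snd_lift[OF that] periodic_lift[OF ax_periodic[OF A] that] by simp
  from gauge_rot[of A \<alpha> g g' ?\<psi>, OF A \<alpha> g this off] show ?thesis by blast
qed

lemma flows_gauge_equivalent:
  assumes A: "A \<in> S_gamma atl u"
  shows "\<exists>\<psi>\<in>gauge_group atl. gauge_act atl \<psi> (flow (\<lambda>s. bump (s + 1)) t A) = flow bump t A"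
proof -
  \<comment> \<open>An antiderivative of the difference of the two bumps, scaled by the time. For s
    below -3/4 both steps are 0 and above 3/4 both are 1, so it vanishes near the ends and the
    rotation extends by the identity.\<close>
  let ?g = "\<lambda>s. t * (smooth_step s + - smooth_step (s + 1))" and ?g' = "\<lambda>s. t * (bump s + - 1 * bump (s + 1))"
  have "\<exists>\<psi>\<in>gauge_group atl. gauge_act atl \<psi> (shift (\<lambda>s. t * bump (s + 1)) A)
      = shift (\<lambda>s. t * bump (s + 1) + ?g' s) A"
  proof (rule gauge_rot_exists[where g="?g" and e="\<lambda>q. mat 1", OF A tame_cmult[OF tame_bump(2)]])
    show "smooth_on UNIV ?g"
      by (intro smooth_on_mult smooth_on_const smooth_on_add smooth_on_minus open_UNIV smooth_on_smooth_step
          smooth_on_translate)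
    show "(?g has_real_derivative ?g' s) (at s)" for s
      using DERIV_cmult[OF DERIV_add[OF smooth_step_deriv DERIV_minus[OF smooth_step_translate_deriv]]] by simp
    show "tame ?g'" by (intro tame_cmult tame_add tame_bump)
    fix p assume p: "p \<notin> K"
    have "(if q \<in> U then rot (?g (snd (lift q))) (ax A (lift q)) else mat 1) = mat 1" if "q \<in> - K" for q
    proof (cases "q \<in> U")
      case True
      from snd_lift_off_K[OF True] that have "?g (snd (lift q)) = 0"
        by (auto simp: smooth_step_eq_0 smooth_step_eq_1)
      then show ?thesis by (simp only: rot_values if_cancel)
    qed simp
    then show "\<exists>N \<epsilon>. open N \<and> p \<in> N \<and> (\<epsilon> = mat 1 \<or> \<epsilon> = - mat 1) \<and>
      (\<forall>q\<in>N. (if q \<in> U then rot (?g (snd (lift q))) (ax A (lift q)) else mat 1) = \<epsilon>)"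
      using p open_Compl[OF closed_K] by blast
  qed
  moreover have "(\<lambda>s. t * bump (s + 1) + ?g' s) = (\<lambda>s. t * bump s)" by (simp add: algebra_simps)
  ultimately show ?thesis by (simp only: flow_def)
qed

lemma flow_two_pi:
  assumes A: "A \<in> S_gamma atl u"
  shows "\<exists>\<psi>\<in>gauge_group atl. gauge_act atl \<psi> A = flow bump (2 * pi) A"
proof -
  let ?g = "\<lambda>s. 2 * pi * smooth_step s"
  have "\<exists>\<psi>\<in>gauge_group atl. gauge_act atl \<psi> (shift (\<lambda>s. 0) A) = shift (\<lambda>s. 0 + 2 * pi * bump s) A"
  proof (rule gauge_rot_exists[where g="?g" and e="\<lambda>q. mat 1", OF A])
    show "tame (\<lambda>s. 0)" by (simp add: tame_def smooth_on_const)
    show "smooth_on UNIV ?g" by (intro smooth_on_mult smooth_on_const open_UNIV smooth_on_smooth_step)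
    show "(?g has_real_derivative 2 * pi * bump s) (at s)" for s by (rule DERIV_cmult[OF smooth_step_deriv])
    show "tame (\<lambda>s. 2 * pi * bump s)" by (rule tame_cmult[OF tame_bump(1)])
    fix p assume p: "p \<notin> K"
    have "(if q \<in> U then rot (?g (snd (lift q))) (ax A (lift q)) else mat 1) = mat 1" if "q \<in> - K" for q
    proof (cases "q \<in> U")
      case True
      from snd_lift_off_K[OF True] that have "?g (snd (lift q)) = 0 \<or> ?g (snd (lift q)) = 2 * pi"
        by (auto simp: smooth_step_eq_0 smooth_step_eq_1)
      then show ?thesis using rot_values by auto
    qed simp
    then show "\<exists>N \<epsilon>. open N \<and> p \<in> N \<and> (\<epsilon> = mat 1 \<or> \<epsilon> = - mat 1) \<and>
      (\<forall>q\<in>N. (if q \<in> U then rot (?g (snd (lift q))) (ax A (lift q)) else mat 1) = \<epsilon>)"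
      using p open_Compl[OF closed_K] by blast
  qed
  then show ?thesis by (simp add: flow_def shift_zero)
qed

lemma central_image_eq: "central_image u = u ` (UNIV \<times> {0..0})"
proof
  show "central_image u \<subseteq> u ` (UNIV \<times> {0..0})"
    by (auto simp: central_image_def central_curve_def)
  show "u ` (UNIV \<times> {0..0}) \<subseteq> central_image u"
  proof (rule image_subsetI)
    fix x :: "real \<times> real" assume x: "x \<in> UNIV \<times> {0..0}"
    let ?r = "frac (fst x / (2 * pi))"
    have "u x = u (2 * pi * ?r, 0)"
      using x by (subst u_eq_iff)
        (auto simp: strip_def frac_def algebra_simps intro!: exI[of _ "- \<lfloor>fst x / (2 * pi)\<rfloor>"])
    moreover have "?r \<in> {0..1}" using frac_lt_1[of "fst x / (2 * pi)"] by (simp add: less_imp_le)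
    ultimately show "u x \<in> central_image u" unfolding central_image_def central_curve_def by blast
  qed
qed

lemma connected_u_band: "J \<subseteq> {-1..1} \<Longrightarrow> connected J \<Longrightarrow> connected (u ` (UNIV \<times> J))"
  by (rule connected_continuous_image[OF continuous_on_subset[OF continuous_u]])
    (auto simp: strip_def intro: connected_Times)

text \<open>If the two sides of the central curve lay in the same part of a separation, the other part
  would be open and closed in the surface.\<close>

lemma separating_sides:
  assumes conn: "connected (UNIV :: 'a set)" and sep: "\<not> connected (UNIV - central_image u)"
  obtains P Q where "open P" "open Q" "P \<inter> Q = {}" "P \<union> Q = UNIV - central_image u"
    "u ` (UNIV \<times> {0<..<1}) \<subseteq> P" "u ` (UNIV \<times> {-1<..<0}) \<subseteq> Q"
proof -
  let ?C = "UNIV - central_image u"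
  let ?p = "u ` (UNIV \<times> {0<..<1})" and ?m = "u ` (UNIV \<times> {-1<..<0})"
  have "closed (central_image u)"
    using compact_u_band[of 0 0] by (simp add: central_image_eq compact_imp_closed)
  then have oC: "open ?C" by (simp add: Diff_eq open_Compl)
  obtain A B where AB: "open A" "open B" "?C \<subseteq> A \<union> B" "A \<inter> B \<inter> ?C = {}" "A \<inter> ?C \<noteq> {}" "B \<inter> ?C \<noteq> {}"
    using sep unfolding connected_def by blast
  define P where "P = A \<inter> ?C"
  define Q where "Q = B \<inter> ?C"
  have PQ: "open P" "open Q" "P \<inter> Q = {}" "P \<union> Q = ?C" "P \<noteq> {}" "Q \<noteq> {}"
    using AB oC by (auto simp: P_def Q_def)
  have sC: "?p \<subseteq> ?C" "?m \<subseteq> ?C"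
  proof -
    have "u x \<noteq> u y" if "x \<in> strip" "y \<in> strip" "snd x \<noteq> snd y" for x y
      using u_eq_iff[OF that(1,2)] that(3) by blast
    then show "?p \<subseteq> ?C" "?m \<subseteq> ?C" unfolding central_image_eq by (force simp: strip_def)+
  qed
  have U: "U \<subseteq> ?p \<union> ?m \<union> central_image u"
  proof
    fix q assume "q \<in> U"
    then obtain x where x: "x \<in> D" "q = u x" by (auto simp: U_def)
    then have "x \<in> UNIV \<times> {0<..<1} \<or> x \<in> UNIV \<times> {-1<..<0} \<or> x \<in> UNIV \<times> {0..0}"
      by (auto simp: D_def mem_Times_iff)
    then show "q \<in> ?p \<union> ?m \<union> central_image u" unfolding central_image_eq x(2) by blast
  qed
  have cU: "central_image u \<subseteq> U" unfolding central_image_eq U_def D_def by (intro image_mono Sigma_mono) auto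
  have side: "S \<subseteq> P \<or> S \<subseteq> Q" if "connected S" "S \<subseteq> ?C" for S
    using connectedD[OF that(1) PQ(1,2)] PQ(3,4) that(2) by blast
  have p: "?p \<subseteq> P \<or> ?p \<subseteq> Q" and m: "?m \<subseteq> P \<or> ?m \<subseteq> Q"
    by (intro side connected_u_band sC; auto)+
  have not_same: False if "?p \<subseteq> R" "?m \<subseteq> R" "open R" "open T" "R \<inter> T = {}" "R \<union> T = ?C" "T \<noteq> {}" for R T
  proof -
    have "U \<inter> T = {}" using U that(1,2,5,6) by blast
    then have "(R \<union> U) \<inter> T = {}" using that(5) by blast
    moreover have "UNIV \<subseteq> (R \<union> U) \<union> T" using that(6) cU by blast
    moreover have "open (R \<union> U)" using that(3) open_U by blast
    moreover have "U \<noteq> {}" using u_in_U[OF origin_in_D] by blast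
    ultimately show False using connectedD[OF conn, of "R \<union> U" T] that(4,7) by blast
  qed
  show thesis
  proof (cases "?p \<subseteq> P")
    case True
    then have "\<not> ?m \<subseteq> P" using not_same[of P Q] PQ by blast
    then show thesis using that[of P Q] PQ True m by blast
  next
    case False
    then have "?p \<subseteq> Q" using p by blast
    moreover from this have "\<not> ?m \<subseteq> Q" using not_same[of Q P] PQ by blast
    ultimately show thesis using that[of Q P] PQ m by blast
  qed
qed

text \<open>The rotation arrives at -1 on the positive side, and -1 cannot be joined to 1 by a
  locally constant function within one component. The separation gives the extension: -1 on the part
  \<open>P\<close> adjacent to the positive side and 1 on \<open>Q\<close>, both open once
  \<open>K\<close> is removed.\<close>

lemma flow_pi:
  assumes A: "A \<in> S_gamma atl u"
    and conn: "connected (UNIV :: 'a set)" and sep: "\<not> connected (UNIV - central_image u)"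
  shows "\<exists>\<psi>\<in>gauge_group atl. gauge_act atl \<psi> A = flow bump pi A"
proof -
  obtain P Q where PQ: "open P" "open Q" "P \<inter> Q = {}" "P \<union> Q = UNIV - central_image u"
    "u ` (UNIV \<times> {0<..<1}) \<subseteq> P" "u ` (UNIV \<times> {-1<..<0}) \<subseteq> Q"
    by (rule separating_sides[OF conn sep])
  let ?g = "\<lambda>s. pi * smooth_step s" and ?e = "\<lambda>q. if q \<in> P then - mat 1 else mat 1"
  let ?\<psi> = "\<lambda>q. if q \<in> U then rot (?g (snd (lift q))) (ax A (lift q)) else ?e q"
  have "\<exists>\<psi>\<in>gauge_group atl. gauge_act atl \<psi> (shift (\<lambda>s. 0) A) = shift (\<lambda>s. 0 + pi * bump s) A"
  proof (rule gauge_rot_exists[where g="?g" and e="?e", OF A])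
    show "tame (\<lambda>s. 0)" by (simp add: tame_def smooth_on_const)
    show "smooth_on UNIV ?g" by (intro smooth_on_mult smooth_on_const open_UNIV smooth_on_smooth_step)
    show "(?g has_real_derivative pi * bump s) (at s)" for s by (rule DERIV_cmult[OF smooth_step_deriv])
    show "tame (\<lambda>s. pi * bump s)" by (rule tame_cmult[OF tame_bump(1)])
    fix p assume p: "p \<notin> K"
    have pos: "q \<in> P" if "q \<in> U" "3/4 < snd (lift q)" for q
    proof -
      have "lift q \<in> UNIV \<times> {0<..<1}" using that(2) lift(1)[OF that(1)] by (auto simp: D_def mem_Times_iff)
      then have "u (lift q) \<in> u ` (UNIV \<times> {0<..<1})" by (rule imageI)
      then show ?thesis using PQ(5) lift(2)[OF that(1)] by auto
    qed
    have neg: "q \<in> Q" if "q \<in> U" "snd (lift q) < - (3/4)" for q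
    proof -
      have "lift q \<in> UNIV \<times> {-1<..<0}" using that(2) lift(1)[OF that(1)] by (auto simp: D_def mem_Times_iff)
      then have "u (lift q) \<in> u ` (UNIV \<times> {-1<..<0})" by (rule imageI)
      then show ?thesis using PQ(6) lift(2)[OF that(1)] by auto
    qed
    \<comment> \<open>A point of \<open>P\<close> on the cylinder but off \<open>K\<close> must lie
      above 3/4, the other end being in \<open>Q\<close>; there the step is 1 and the rotation
      agrees with \<open>?e\<close>.\<close>
    have P: "?\<psi> q = - mat 1" if q: "q \<in> P - K" for q
    proof (cases "q \<in> U")
      case True
      then have "3/4 < snd (lift q)" using snd_lift_off_K[OF True] neg[OF True] q PQ(3) by blast
      then show ?thesis using True by (simp add: smooth_step_eq_1 rot_values)
    qed (use q in simp)
    have Q: "?\<psi> q = mat 1" if q: "q \<in> Q - K" for q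
    proof (cases "q \<in> U")
      case True
      then have "snd (lift q) < - (3/4)" using snd_lift_off_K[OF True] pos[OF True] q PQ(3) by blast
      then show ?thesis using True by (simp add: smooth_step_eq_0 rot_values)
    qed (use q PQ(3) in auto)
    have "central_image u \<subseteq> K" unfolding central_image_eq K_def by (intro image_mono Sigma_mono) auto
    then have "p \<in> P \<or> p \<in> Q" using p PQ(4) by blast
    then show "\<exists>N \<epsilon>. open N \<and> p \<in> N \<and> (\<epsilon> = mat 1 \<or> \<epsilon> = - mat 1) \<and> (\<forall>q\<in>N. ?\<psi> q = \<epsilon>)"
    proof
      assume "p \<in> P"
      then show ?thesis using p P open_Diff[OF PQ(1) closed_K]
        by (intro exI[of _ "P - K"] exI[of _ "- mat 1"]) blast
    next
      assume "p \<in> Q"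
      then show ?thesis using p Q open_Diff[OF PQ(2) closed_K]
        by (intro exI[of _ "Q - K"] exI[of _ "mat 1"]) blast
    qed
  qed
  then show ?thesis by (simp add: flow_def shift_zero)
qed

subsection \<open>The induced action on gauge classes\<close>

lemma gauge_class_iff:
  "A' \<in> gauge_class atl u A \<longleftrightarrow> A \<in> S_gamma atl u \<and> (\<exists>\<psi>\<in>gauge_group atl. A' = gauge_act atl \<psi> A)"
  by (auto simp: gauge_class_def gauge_rel_def)

text \<open>The relation \<open>gauge_rel\<close> demands membership in \<open>S_gamma\<close> of
  its first entry only, so equality of the two classes is stated with membership of both
  connections.\<close>

lemma gauge_class_eq:
  assumes A: "A \<in> S_gamma atl u" and B: "gauge_act atl \<psi> A \<in> S_gamma atl u" and \<psi>: "\<psi> \<in> gauge_group atl"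
  shows "gauge_class atl u (gauge_act atl \<psi> A) = gauge_class atl u A"
proof (intro set_eqI iffI)
  fix A' assume "A' \<in> gauge_class atl u (gauge_act atl \<psi> A)"
  then obtain \<rho> where "\<rho> \<in> gauge_group atl" "A' = gauge_act atl \<rho> (gauge_act atl \<psi> A)"
    by (auto simp: gauge_class_iff)
  with gauge_mult[OF \<psi>] A show "A' \<in> gauge_class atl u A" unfolding gauge_class_iff by metis
next
  fix A' assume "A' \<in> gauge_class atl u A"
  then obtain \<rho> where \<rho>: "\<rho> \<in> gauge_group atl" "A' = gauge_act atl \<rho> A" by (auto simp: gauge_class_iff)
  let ?i = "\<lambda>p. ct (\<psi> p)"
  have "A' = gauge_act atl \<rho> (gauge_act atl ?i (gauge_act atl \<psi> A))"
    using \<rho>(2) gauge_act_inverse[OF \<psi> S_gamma_Omega1[OF A]] by simp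
  with gauge_mult[OF gauge_inverse[OF \<psi>] \<rho>(1)] B show "A' \<in> gauge_class atl u (gauge_act atl \<psi> A)"
    unfolding gauge_class_iff by metis
qed

lemma gauge_class_self: "A \<in> S_gamma atl u \<Longrightarrow> A \<in> gauge_class atl u A"
  using gauge_one gauge_act_one[OF S_gamma_Omega1] unfolding gauge_class_iff by metis

lemma M_gamma_eq: "M_gamma atl u = gauge_class atl u ` S_gamma atl u"
  by (auto simp: M_gamma_def quotient_def gauge_class_def)

text \<open>A representative is chosen arbitrarily; gauge equivariance of the flow makes the result
  independent of the choice.\<close>

definition class_flow :: "(real \<Rightarrow> real) \<Rightarrow> real \<Rightarrow> ('a, mat2) form1 set \<Rightarrow> ('a, mat2) form1 set" where
  "class_flow \<beta> t X = gauge_class atl u (flow \<beta> t (SOME A. A \<in> S_gamma atl u \<and> gauge_class atl u A = X))"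

lemma class_flow:
  assumes A: "A \<in> S_gamma atl u" and \<beta>: "tame \<beta>" "\<beta> 0 = 0"
  shows "class_flow \<beta> t (gauge_class atl u A) = gauge_class atl u (flow \<beta> t A)"
proof -
  define A0 where "A0 = (SOME A'. A' \<in> S_gamma atl u \<and> gauge_class atl u A' = gauge_class atl u A)"
  have A0: "A0 \<in> S_gamma atl u" "gauge_class atl u A0 = gauge_class atl u A"
    using someI[of "\<lambda>A'. A' \<in> S_gamma atl u \<and> gauge_class atl u A' = gauge_class atl u A" A] A
    by (auto simp: A0_def)
  then have "A \<in> gauge_class atl u A0" using gauge_class_self[OF A] by simp
  then obtain \<psi> where \<psi>: "\<psi> \<in> gauge_group atl" "A = gauge_act atl \<psi> A0" by (auto simp: gauge_class_iff)
  have "flow \<beta> t A = gauge_act atl \<psi> (flow \<beta> t A0)" using flow_gauge[OF \<psi>(1) A0(1)] \<psi>(2) by simp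
  then have "gauge_class atl u (flow \<beta> t A) = gauge_class atl u (flow \<beta> t A0)"
    using gauge_class_eq[OF flow_S_gamma[OF A0(1) \<beta>] _ \<psi>(1)] flow_S_gamma[OF A \<beta>] by metis
  then show ?thesis by (simp add: class_flow_def A0_def)
qed

lemma class_flow_action:
  assumes \<beta>: "tame \<beta>" "\<beta> 0 = 0"
  shows "real_action (M_gamma atl u) (class_flow \<beta>)"
  unfolding real_action_def M_gamma_eq
  using flow_S_gamma[OF _ \<beta>] by (auto simp: class_flow[OF _ \<beta>] flow_zero flow_add[OF _ \<beta>])

text \<open>The gauge equivalence over time \<open>T\<close> is assumed at every connection and
  applied to the one already moved by time \<open>t\<close>.\<close>

lemma class_flow_periodic:
  assumes \<beta>: "tame \<beta>" "\<beta> 0 = 0"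
    and T: "\<And>A. A \<in> S_gamma atl u \<Longrightarrow> \<exists>\<psi>\<in>gauge_group atl. gauge_act atl \<psi> A = flow \<beta> T A"
  shows "periodic_action (M_gamma atl u) (class_flow \<beta>) T"
  unfolding periodic_action_def M_gamma_eq
proof (intro allI ballI)
  fix t X assume "X \<in> gauge_class atl u ` S_gamma atl u"
  then obtain A where A: "A \<in> S_gamma atl u" "X = gauge_class atl u A" by blast
  note F = flow_S_gamma[OF A(1) \<beta>, of t]
  obtain \<psi> where \<psi>: "\<psi> \<in> gauge_group atl" "gauge_act atl \<psi> (flow \<beta> t A) = flow \<beta> T (flow \<beta> t A)"
    using T[OF F] by blast
  have "flow \<beta> (t + T) A = gauge_act atl \<psi> (flow \<beta> t A)"
    using flow_add[OF A(1) \<beta>, of T t] \<psi>(2) by (simp add: add.commute)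
  moreover from this have "gauge_act atl \<psi> (flow \<beta> t A) \<in> S_gamma atl u"
    using flow_S_gamma[OF A(1) \<beta>] by metis
  ultimately show "class_flow \<beta> (t + T) X = class_flow \<beta> t X"
    using gauge_class_eq[OF F _ \<psi>(1)] by (simp add: A class_flow[OF A(1) \<beta>])
qed

end

theorem theorem1:
  fixes atl :: "'a::{t2_space,second_countable_topology} chart set"
    and u :: "real \<times> real \<Rightarrow> 'a"
  assumes "smooth_surface atl"
    and "embedded_cylinder atl u"
  shows "\<exists>\<Xi>p \<Xi>m :: real \<Rightarrow> ('a, mat2) form1 \<Rightarrow> ('a, mat2) form1.
    real_action (S_gamma atl u) \<Xi>p \<and> real_action (S_gamma atl u) \<Xi>m \<and>
    supported_in (S_gamma atl u) \<Xi>m (u ` (UNIV \<times> {-1<..<0})) \<and>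
    supported_in (S_gamma atl u) \<Xi>p (u ` (UNIV \<times> {0<..<1})) \<and>
    (\<forall>\<Xi>\<in>{\<Xi>p, \<Xi>m}. \<forall>A\<in>S_gamma atl u. \<exists>V\<in>Omega1 atl. has_velocity \<Xi> A V \<and>
       (\<forall>B\<in>T_flat atl A. \<exists>D. has_df_gamma atl u A B D \<and>
          has_cylinder_integral atl u (wedge_inner V B) D)) \<and>
    (\<forall>\<Xi>\<in>{\<Xi>p, \<Xi>m}. \<forall>A\<in>S_gamma atl u. \<forall>\<psi>\<in>gauge_group atl. \<forall>t.
       \<Xi> t (gauge_act atl \<psi> A) = gauge_act atl \<psi> (\<Xi> t A)) \<and>
    (\<forall>A\<in>S_gamma atl u. \<forall>t. \<exists>\<psi>\<in>gauge_group atl. gauge_act atl \<psi> (\<Xi>m t A) = \<Xi>p t A) \<and>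
    (\<exists>\<Xi>. real_action (M_gamma atl u) \<Xi> \<and>
       (\<forall>A\<in>S_gamma atl u. \<forall>t.
          \<Xi> t (gauge_class atl u A) = gauge_class atl u (\<Xi>p t A) \<and>
          \<Xi> t (gauge_class atl u A) = gauge_class atl u (\<Xi>m t A)) \<and>
       (connected (UNIV :: 'a set) \<and> \<not> connected (UNIV - central_image u) \<longrightarrow>
          periodic_action (M_gamma atl u) \<Xi> pi) \<and>
       (connected (UNIV - central_image u) \<longrightarrow>
          periodic_action (M_gamma atl u) \<Xi> (2 * pi)))"
proof -
  interpret cylinder atl u using assms by unfold_locales
  let ?b = "\<lambda>s. bump (s + 1)"
  have p0: "bump 0 = 0" and m0: "?b 0 = 0" by (auto intro: bump_eq_0)
  have supp: "supported_in (S_gamma atl u) (flow bump) (u ` (UNIV \<times> {0<..<1}))"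
    "supported_in (S_gamma atl u) (flow ?b) (u ` (UNIV \<times> {-1<..<0}))"
    by (rule flow_supported[where a="1/4" and b="3/4"], auto intro!: bump_eq_0)
      (rule flow_supported[where a="-3/4" and b="-1/4"], auto intro!: bump_eq_0)
  \<comment> \<open>The action on classes is built from the flow on the positive side; this equality
    identifies it with the one induced from the negative side.\<close>
  have classes: "gauge_class atl u (flow bump t A) = gauge_class atl u (flow ?b t A)"
    if A: "A \<in> S_gamma atl u" for A t
    using flows_gauge_equivalent[OF A, of t] gauge_class_eq[OF flow_S_gamma[OF A tame_bump(2) m0]]
      flow_S_gamma[OF A tame_bump(1) p0] by metis
  show ?thesis
  proof (rule exI[of _ "flow bump"], rule exI[of _ "flow ?b"],
      intro exI[of _ "class_flow bump"] conjI ballI allI impI)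
    fix \<Xi> A assume "\<Xi> \<in> {flow bump, flow ?b}" and A: "A \<in> S_gamma atl u"
    then show "\<exists>V\<in>Omega1 atl. has_velocity \<Xi> A V \<and> (\<forall>B\<in>T_flat atl A. \<exists>D. has_df_gamma atl u A B D \<and>
          has_cylinder_integral atl u (wedge_inner V B) D)"
      using flow_hamiltonian[OF A tame_bump(1) bump_integrals(1)]
        flow_hamiltonian[OF A tame_bump(2) bump_integrals(2)] by blast
    fix \<psi> t assume "\<psi> \<in> gauge_group atl"
    with flow_gauge A \<open>\<Xi> \<in> {flow bump, flow ?b}\<close>
    show "\<Xi> t (gauge_act atl \<psi> A) = gauge_act atl \<psi> (\<Xi> t A)" by blast
  next
    fix A t assume A: "A \<in> S_gamma atl u"
    show "\<exists>\<psi>\<in>gauge_group atl. gauge_act atl \<psi> (flow ?b t A) = flow bump t A"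
      by (rule flows_gauge_equivalent[OF A])
    show c: "class_flow bump t (gauge_class atl u A) = gauge_class atl u (flow bump t A)"
      by (rule class_flow[OF A tame_bump(1) p0])
    then show "class_flow bump t (gauge_class atl u A) = gauge_class atl u (flow ?b t A)"
      using classes[OF A] by simp
  next
    assume "connected (UNIV :: 'a set) \<and> \<not> connected (UNIV - central_image u)"
    then show "periodic_action (M_gamma atl u) (class_flow bump) pi"
      by (intro class_flow_periodic[OF tame_bump(1) p0] flow_pi) auto
  next
    show "periodic_action (M_gamma atl u) (class_flow bump) (2 * pi)"
      by (intro class_flow_periodic[OF tame_bump(1) p0] flow_two_pi)
  qed (intro flow_action tame_bump p0 m0 supp class_flow_action)+
qed

end
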